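(* Let $n\ge 2k$, $\lambda\vdash n$ with $|\lambda^*|=m\le k$, and let $\kappa$ be a partition with $|\kappa|\le k$, $s=k-|\kappa|$. Then $$\chi^\lambda_{\mathbf P_k(n)}(\gamma_\kappa\otimes e^{\otimes s})=\sum_{\mu\vdash m}\ \sum_{\nu\mid\kappa}\ \prod_{i\ge1}\ \sum_{t\ge0}\left\{{\mathsf m_i(\nu)\atop t}\right\}\binom{t}{\mathsf m_i(\mu)}\,i^{\,\mathsf m_i(\nu)-t}\ \chi^{\lambda^*}_{\mathfrak S_m}(\gamma_\mu).$$
   Context: $\mathcal P_k$: set partitions of $\{1,\dots,k,1',\dots,k'\}$, drawn with top row $1..k$ and bottom row $1'..k'$; $\mathbf P_k(n)$ is the $\mathbb C$-algebra with basis $\mathcal P_k$ and product $d_1d_2=n^{\ell(d_1,d_2)}d_1\circ d_2$, where $d_1\circ d_2$ stacks $d_1$ above $d_2$, identifies the middle rows, and discards the $\ell(d_1,d_2)$ connected components lying entirely in the middle row. For $\lambda=[\lambda_1,\lambda_2,\dots]\vdash n$, $\lambda^*=[\lambda_2,\dots]$; for $n\ge 2k$ the irreducible $\mathbf P_k(n)$-modules $\mathbf P^\lambda_k$ are indexed by $\{\lambda\vdash n:|\lambda^*|\le k\}$, with $\mathbf P^\lambda_k=\mathbb C\mathcal W^m_{\mathcal P_k}\otimes\mathfrak S^{\lambda^*}_m$ (symmetric $m$-diagrams tensor the Specht module) under $d\cdot(w\otimes v)=n^{\ell(d,w)}(d\circ w\circ d^T)\otimes\sigma_{d,w}v$ if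 $d\circ w\circ d^T$ has $m$ propagating blocks, $0$ otherwise (here a symmetric $m$-diagram is given by a set partition of $\{1..k\}$ with $m$ distinguished blocks $B$, having blocks $B\cup B'$ for these and $B,B'$ otherwise; $\sigma_{d,w}$ is the induced permutation of propagating blocks ordered by largest element); $\chi^\lambda_{\mathbf P_k(n)}$ is the character of $\mathbf P^\lambda_k$. A permutation $\sigma\in\mathfrak S_r$ is the diagram with blocks $\{\sigma(j),j'\}$; $\gamma_r=(r,r-1,\dots,1)$; $\gamma_\kappa=\gamma_{\kappa_1}\otimes\cdots\otimes\gamma_{\kappa_\ell}$, where $\otimes$ juxtaposes diagrams left to right; $e=\frac1n\mathfrak p_1\in\mathbf P_1(n)$, $\mathfrak p_1$ being the diagram with the two singleton blocks $\{1\},\{1'\}$. $\chi^{\lambda^*}_{\mathfrak S_m}(\gamma_\mu)$ is the irreducible $\mathfrak S_m$-character on cycle type $\mu$ ($\chi^\emptyset_{\mathfrak S_0}=1$). $\{a\atop b\}$: Stirling numbers of the second kind; $\mathsf m_i(\nu)$: number of parts equal to $i$; a divisor $\nu\mid\kappa$ of $\kappa=[\kappa_1,\dots,\kappa_\ell]$ is a composition $[\nu_1,\dots,\nu_\ell]$ with $\nu_j\mid\kappa_j$. *)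

theory Defs
  imports Complex_Main "HOL-Combinatorics.Permutations" "HOL-Combinatorics.Stirling"
    "HOL-Library.Disjoint_Sets" "HOL-Library.Function_Algebras"
begin

definition is_partition :: "nat list \<Rightarrow> nat \<Rightarrow> bool" where
  "is_partition \<nu> m \<longleftrightarrow> sum_list \<nu> = m \<and> sorted_wrt (\<ge>) \<nu> \<and> 0 \<notin> set \<nu>"

definition mult :: "nat \<Rightarrow> nat list \<Rightarrow> nat" where
  "mult i \<nu> = count_list \<nu> i"

definition divisors_of :: "nat list \<Rightarrow> nat list set" where
  "divisors_of \<kappa> = {\<nu>. length \<nu> = length \<kappa> \<and>
      (\<forall>j<length \<kappa>. 0 < \<nu> ! j \<and> \<nu> ! j dvd \<kappa> ! j)}"

definition gamma_perm :: "nat \<Rightarrow> nat \<Rightarrow> nat" where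
  "gamma_perm r j = (if j \<in> {1..r} then (if j = 1 then r else j - 1) else j)"

fun gamma_perm_list :: "nat list \<Rightarrow> nat \<Rightarrow> nat" where
  "gamma_perm_list [] = id"
| "gamma_perm_list (a # \<mu>) = (\<lambda>j. if j \<in> {1..a} then gamma_perm a j
      else if a < j then gamma_perm_list \<mu> (j - a) + a else j)"

text \<open>Tabloids of shape lam on {1..m}: row functions (rows 1..length lam), 0 outside {1..m}.\<close>
definition tabloids :: "nat list \<Rightarrow> nat \<Rightarrow> (nat \<Rightarrow> nat) set" where
  "tabloids lam m = {r. (\<forall>i. i \<notin> {1..m} \<longrightarrow> r i = 0) \<and> r ` {1..m} \<subseteq> {1..length lam} \<and>
      (\<forall>j\<in>{1..length lam}. card {i\<in>{1..m}. r i = j} = lam ! (j - 1))}"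

definition cells :: "nat list \<Rightarrow> (nat \<times> nat) set" where
  "cells lam = {(j, c). j \<in> {1..length lam} \<and> c \<in> {1..lam ! (j - 1)}}"

text \<open>A tableau is encoded by its inverse p: {1..m} -> cells (entry i sits in cell p i).\<close>
definition tableaux_inv :: "nat list \<Rightarrow> nat \<Rightarrow> (nat \<Rightarrow> nat \<times> nat) set" where
  "tableaux_inv lam m = {p. bij_betw p {1..m} (cells lam) \<and> (\<forall>i. i \<notin> {1..m} \<longrightarrow> p i = (0, 0))}"

definition col_stab :: "nat \<Rightarrow> (nat \<Rightarrow> nat \<times> nat) \<Rightarrow> (nat \<Rightarrow> nat) set" where
  "col_stab m p = {\<pi>. \<pi> permutes {1..m} \<and> (\<forall>i. snd (p (\<pi> i)) = snd (p i))}"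

definition delta :: "(nat \<Rightarrow> nat) \<Rightarrow> (nat \<Rightarrow> nat) \<Rightarrow> complex" where
  "delta r = (\<lambda>r'. if r' = r then 1 else 0)"

text \<open>Polytabloid e_t = sum over pi in C_t of sgn(pi) {pi t}, in the permutation module
  (functions on tabloids).\<close>
definition polytabloid :: "nat \<Rightarrow> (nat \<Rightarrow> nat \<times> nat) \<Rightarrow> (nat \<Rightarrow> nat) \<Rightarrow> complex" where
  "polytabloid m p = (\<lambda>r. \<Sum>\<pi>\<in>col_stab m p. of_int (sign \<pi>) * delta (fst \<circ> p \<circ> \<pi>) r)"

definition cscale :: "complex \<Rightarrow> ((nat \<Rightarrow> nat) \<Rightarrow> complex) \<Rightarrow> ((nat \<Rightarrow> nat) \<Rightarrow> complex)" where
  "cscale c f = (\<lambda>x. c * f x)"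

definition specht :: "nat list \<Rightarrow> nat \<Rightarrow> ((nat \<Rightarrow> nat) \<Rightarrow> complex) set" where
  "specht lam m = module.span cscale (polytabloid m ` tableaux_inv lam m)"

text \<open>Action of a permutation sigma of {1..m}: sigma.{t} = {sigma t}.\<close>
definition perm_act :: "(nat \<Rightarrow> nat) \<Rightarrow> ((nat \<Rightarrow> nat) \<Rightarrow> complex) \<Rightarrow> ((nat \<Rightarrow> nat) \<Rightarrow> complex)" where
  "perm_act \<sigma> f = (\<lambda>r. f (r \<circ> \<sigma>))"

definition trace_on :: "((nat \<Rightarrow> nat) \<Rightarrow> complex) set \<Rightarrow>
    (((nat \<Rightarrow> nat) \<Rightarrow> complex) \<Rightarrow> ((nat \<Rightarrow> nat) \<Rightarrow> complex)) \<Rightarrow> complex" where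
  "trace_on S g = (let B = (SOME B. B \<subseteq> S \<and> \<not> module.dependent cscale B \<and> module.span cscale B = S)
      in \<Sum>b\<in>B. module.representation cscale B (g b) b)"

definition sym_char :: "nat list \<Rightarrow> nat \<Rightarrow> (nat \<Rightarrow> nat) \<Rightarrow> complex" where
  "sym_char lam m \<sigma> = trace_on (specht lam m) (perm_act \<sigma>)"

datatype pt = Top nat | Bot nat

type_synonym diagram = "pt set set"

definition pts :: "nat \<Rightarrow> pt set" where
  "pts k = Top ` {1..k} \<union> Bot ` {1..k}"

definition Pk :: "nat \<Rightarrow> diagram set" where
  "Pk k = {d. partition_on (pts k) d}"

text \<open>Stacking d1 above d2: levels 0 (top of d1), 1 (middle), 2 (bottom of d2).\<close>
fun up :: "pt \<Rightarrow> nat \<times> nat" where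
  "up (Top i) = (0, i)" | "up (Bot i) = (1, i)"
fun down :: "pt \<Rightarrow> nat \<times> nat" where
  "down (Top i) = (1, i)" | "down (Bot i) = (2, i)"

definition stack_rel :: "diagram \<Rightarrow> diagram \<Rightarrow> ((nat \<times> nat) \<times> (nat \<times> nat)) set" where
  "stack_rel d1 d2 = {(x, y). \<exists>B \<in> (image up ` d1) \<union> (image down ` d2). x \<in> B \<and> y \<in> B}"

definition comps :: "diagram \<Rightarrow> diagram \<Rightarrow> (nat \<times> nat) set set" where
  "comps d1 d2 = Field (stack_rel d1 d2) // (stack_rel d1 d2)\<^sup>+"

definition in_middle :: "(nat \<times> nat) set \<Rightarrow> bool" where
  "in_middle C \<longleftrightarrow> (\<forall>x\<in>C. fst x = 1)"

definition loops :: "diagram \<Rightarrow> diagram \<Rightarrow> nat" where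
  "loops d1 d2 = card {C \<in> comps d1 d2. in_middle C}"

definition outer :: "(nat \<times> nat) set \<Rightarrow> pt set" where
  "outer C = {Top i | i. (0, i) \<in> C} \<union> {Bot i | i. (2, i) \<in> C}"

definition compose :: "diagram \<Rightarrow> diagram \<Rightarrow> diagram" where
  "compose d1 d2 = outer ` {C \<in> comps d1 d2. \<not> in_middle C}"

fun flip :: "pt \<Rightarrow> pt" where
  "flip (Top i) = Bot i" | "flip (Bot i) = Top i"

definition transp :: "diagram \<Rightarrow> diagram" where
  "transp d = image flip ` d"

fun shift :: "nat \<Rightarrow> pt \<Rightarrow> pt" where
  "shift a (Top i) = Top (i + a)" | "shift a (Bot i) = Bot (i + a)"

definition dtensor :: "nat \<Rightarrow> diagram \<Rightarrow> diagram \<Rightarrow> diagram" where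
  "dtensor k1 d1 d2 = d1 \<union> image (shift k1) ` d2"

definition perm_diag :: "nat \<Rightarrow> (nat \<Rightarrow> nat) \<Rightarrow> diagram" where
  "perm_diag r \<sigma> = {{Top (\<sigma> j), Bot j} | j. j \<in> {1..r}}"

definition gamma_diag :: "nat \<Rightarrow> diagram" where
  "gamma_diag r = perm_diag r (gamma_perm r)"

fun gamma_kappa :: "nat list \<Rightarrow> diagram" where
  "gamma_kappa [] = {}"
| "gamma_kappa (a # \<kappa>) = dtensor a (gamma_diag a) (gamma_kappa \<kappa>)"

definition p1 :: diagram where
  "p1 = {{Top 1}, {Bot 1}}"

definition is_prop :: "pt set \<Rightarrow> bool" where
  "is_prop X \<longleftrightarrow> (\<exists>i. Top i \<in> X) \<and> (\<exists>i. Bot i \<in> X)"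

definition prop_blocks :: "diagram \<Rightarrow> pt set set" where
  "prop_blocks d = {X \<in> d. is_prop X}"

type_synonym pelem = "diagram \<Rightarrow> complex"

definition basis_el :: "diagram \<Rightarrow> pelem" where
  "basis_el d = (\<lambda>d'. if d' = d then 1 else 0)"

definition etensor :: "nat \<Rightarrow> nat \<Rightarrow> pelem \<Rightarrow> pelem \<Rightarrow> pelem" where
  "etensor k1 k2 x y = (\<lambda>d. \<Sum>d1\<in>Pk k1. \<Sum>d2\<in>Pk k2.
      if dtensor k1 d1 d2 = d then x d1 * y d2 else 0)"

definition e_el :: "nat \<Rightarrow> pelem" where
  "e_el n = (\<lambda>d. if d = p1 then 1 / of_nat n else 0)"

fun e_pow :: "nat \<Rightarrow> nat \<Rightarrow> pelem" where
  "e_pow n 0 = basis_el {}"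
| "e_pow n (Suc s) = etensor 1 s (e_el n) (e_pow n s)"

definition symd :: "nat set set \<Rightarrow> nat set set \<Rightarrow> diagram" where
  "symd \<pi> D = {Top ` B \<union> Bot ` B | B. B \<in> D} \<union> {Top ` B | B. B \<in> \<pi> - D}
      \<union> {Bot ` B | B. B \<in> \<pi> - D}"

definition sym_mdiags :: "nat \<Rightarrow> nat \<Rightarrow> diagram set" where
  "sym_mdiags k m = {symd \<pi> D | \<pi> D. partition_on {1..k} \<pi> \<and> D \<subseteq> \<pi> \<and> card D = m}"

definition top_idx :: "pt set \<Rightarrow> nat set" where
  "top_idx X = {i. Top i \<in> X}"

definition prop_block :: "diagram \<Rightarrow> nat \<Rightarrow> pt set" where
  "prop_block d j = (THE X. X \<in> prop_blocks d \<and>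
      Max (top_idx X) = sorted_list_of_set ((\<lambda>X. Max (top_idx X)) ` prop_blocks d) ! (j - 1))"

text \<open>sigma_{d,w}: the j-th propagating block of w is carried (through d) to the
  sigma(j)-th propagating block of d o w o d^T.\<close>
definition sigma_dw :: "nat \<Rightarrow> diagram \<Rightarrow> diagram \<Rightarrow> nat \<Rightarrow> nat" where
  "sigma_dw m d w j = (if j \<in> {1..m} then
      (THE i. i \<in> {1..m} \<and> (\<exists>C\<in>comps d w. (\<exists>u \<in> top_idx (prop_block w j). (1, u) \<in> C) \<and>
         (\<exists>u. (0, u) \<in> C \<and> Top u \<in> prop_block (compose (compose d w) (transp d)) i)))
     else j)"

definition star :: "nat list \<Rightarrow> nat list" where
  "star lam = tl lam"

text \<open>Action on basis vectors w (x) v: trace of a diagram d on P^lam_k, with m = |lam*|\<close>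
definition pchar_diag :: "nat \<Rightarrow> nat \<Rightarrow> nat list \<Rightarrow> diagram \<Rightarrow> complex" where
  "pchar_diag n k lam d = (let m = sum_list (star lam) in
     \<Sum>w\<in>sym_mdiags k m. (let w' = compose (compose d w) (transp d) in
        if card (prop_blocks w') = m \<and> w' = w
        then of_nat n ^ loops d w * sym_char (star lam) m (sigma_dw m d w) else 0))"

definition pchar :: "nat \<Rightarrow> nat \<Rightarrow> nat list \<Rightarrow> pelem \<Rightarrow> complex" where
  "pchar n k lam x = (\<Sum>d\<in>Pk k. x d * pchar_diag n k lam d)"

end

theory Submission
  imports Defs "HOL-Combinatorics.Cycles"
begin

text \<open>
  Write \<open>\<sigma>\<close> for \<open>\<gamma>_\<kappa>\<close>. A symmetric diagram \<open>w\<close> is fixed under conjugation by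
  \<open>\<gamma>_\<kappa> \<otimes> e^s\<close> iff the last \<open>s\<close> points are singleton non-propagating blocks and the
  remaining set partition, together with its set of distinguished blocks, is invariant
  under \<open>\<sigma>\<close>; each such \<open>w\<close> gives \<open>s\<close> loops, whose factor \<open>n^s\<close> cancels the \<open>n^(-s)\<close> in
  \<open>e^s\<close>, and so contributes the character of the permutation by which \<open>\<sigma>\<close> acts on the
  distinguished blocks. As characters are class functions, it remains to count invariant pairs by
  cycle type.

  This is done one cycle of \<open>\<sigma>\<close> at a time. The blocks meeting a new cycle of length \<open>a\<close> form one
  orbit of some size \<open>i\<close> dividing \<open>a\<close>: either a new orbit, distinguished or not, or an
  enlargement of an old orbit of size \<open>i\<close>, determined by the old block that
  receives a chosen point of the cycle. For \<open>f t x\<close> the number of structures with \<open>t\<close> orbits of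
  size \<open>i\<close>, of which \<open>x\<close> are distinguished, this is the recursion
  \<open>f' t x = f (t-1) (x-1) + f (t-1) x + i t f t x\<close>, which is solved by
  \<open>Stirling M t * (t choose x) * i ^ (M - t)\<close>. The size \<open>i\<close> chosen for the \<open>j\<close>-th cycle is the
  \<open>j\<close>-th part of the divisor \<open>\<nu>\<close> of \<open>\<kappa>\<close>.
\<close>

section \<open>Characters of symmetric groups as class functions\<close>

text \<open>Everything is arranged so that the sum over invariant pairs becomes a product. The cycle
  type of the action on the distinguished blocks is detected by an indicator that is a product over
  \<open>i\<close> of one condition on the number of distinguished blocks of period
  \<open>i\<close>. Inserting a cycle whose blocks have period \<open>i\<close> changes the factor
  for \<open>i\<close> only, so the recursion runs separately for each \<open>i\<close>. Counts are
  kept as numbers of blocks, which are \<open>i\<close> times the numbers of orbits: the factor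
  \<open>i * t\<close> is then simply the number of old blocks of period \<open>i\<close>. The
  indicator also forces the number of distinguished blocks to be \<open>m\<close>, so the sum may
  range over all invariant pairs. The rigidity behind the cycle-by-cycle step is that a point
  returns to its block exactly at the multiples of the period of the block; one chosen point
  therefore decides how the whole cycle is distributed. Permutations of points and the induced
  permutations of blocks are both handled through \<open>fin_ord\<close>, so that one set of orbit
  lemmas serves \<open>f\<close> and \<open>image f\<close>.\<close>

interpretation cs: vector_space cscale
  by unfold_locales (auto simp: cscale_def fun_eq_iff algebra_simps plus_fun_def)

text \<open>Both sides use the same basis \<open>B\<close>, selected once for \<open>V\<close>, so
  this is the usual comparison of matrix entries: expand both compositions in \<open>B\<close> and
  exchange the two sums. The finite spanning set \<open>F\<close> is what makes \<open>B\<close>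
  finite.\<close>

lemma trace_on_commute:
  assumes fin: "finite F" and V: "V = cs.span F"
    and P: "module_hom cscale cscale P" and Q: "module_hom cscale cscale Q"
    and PV: "\<And>x. x \<in> V \<Longrightarrow> P x \<in> V" and QV: "\<And>x. x \<in> V \<Longrightarrow> Q x \<in> V"
  shows "trace_on V (P \<circ> Q) = trace_on V (Q \<circ> P)"
proof -
  define B where "B = (SOME B. B \<subseteq> V \<and> \<not> cs.dependent B \<and> cs.span B = V)"
  have "\<exists>B. B \<subseteq> V \<and> \<not> cs.dependent B \<and> cs.span B = V"
  proof -
    obtain B where "B \<subseteq> V" "\<not> cs.dependent B" "V \<subseteq> cs.span B"
      by (rule cs.maximal_independent_subset)
    moreover have "cs.span B \<subseteq> V"
      using \<open>B \<subseteq> V\<close> V by (simp add: cs.span_minimal)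
    ultimately show ?thesis by blast
  qed
  then have B: "B \<subseteq> V" "cs.independent B" "cs.span B = V"
    unfolding B_def by (metis (mono_tags, lifting) someI_ex)+
  have finB: "finite B"
    using cs.independent_span_bound[OF fin B(2)] B(1) V by blast
  \<comment> \<open>The matrix entry of a product of two maps, stated for generic \<open>P'\<close>
    and \<open>Q'\<close> so that it serves both orders of composition.\<close>
  have expand: "cs.representation B (P' (Q' b)) b
      = (\<Sum>c\<in>B. cs.representation B (Q' b) c * cs.representation B (P' c) b)"
    if "b \<in> B" and P': "module_hom cscale cscale P'" and P'V: "\<And>x. x \<in> V \<Longrightarrow> P' x \<in> V"
      and Q'V: "\<And>x. x \<in> V \<Longrightarrow> Q' x \<in> V" for b P' Q'
  proof -
    have Qb: "Q' b \<in> V" using that B(1) Q'V by blast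
    have "P' (Q' b) = P' (\<Sum>c\<in>B. cscale (cs.representation B (Q' b) c) c)"
      using Qb B finB by (simp add: cs.sum_representation_eq)
    also have "\<dots> = (\<Sum>c\<in>B. cscale (cs.representation B (Q' b) c) (P' c))"
      by (simp add: module_hom.sum[OF P'] module_hom.scale[OF P'])
    finally have "cs.representation B (P' (Q' b))
        = cs.representation B (\<Sum>c\<in>B. cscale (cs.representation B (Q' b) c) (P' c))" by simp
    also have "\<dots> = (\<lambda>d. \<Sum>c\<in>B. cs.representation B (cscale (cs.representation B (Q' b) c) (P' c)) d)"
      by (rule cs.representation_sum) (use B P'V in \<open>auto intro!: cs.span_scale\<close>)
    also have "\<dots> = (\<lambda>d. \<Sum>c\<in>B. cs.representation B (Q' b) c * cs.representation B (P' c) d)"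
      by (intro ext sum.cong refl, subst cs.representation_scale) (use B P'V in auto)
    finally show ?thesis by simp
  qed
  have "trace_on V (P \<circ> Q)
      = (\<Sum>b\<in>B. \<Sum>c\<in>B. cs.representation B (Q b) c * cs.representation B (P c) b)"
    unfolding trace_on_def Let_def B_def[symmetric]
    by (intro sum.cong refl) (use expand[of _ P Q, OF _ P PV QV] in simp)
  also have "\<dots> = (\<Sum>c\<in>B. \<Sum>b\<in>B. cs.representation B (P c) b * cs.representation B (Q b) c)"
    by (subst sum.swap) (simp add: mult.commute)
  also have "\<dots> = trace_on V (Q \<circ> P)"
    unfolding trace_on_def Let_def B_def[symmetric]
    by (intro sum.cong refl) (use expand[of _ Q P, OF _ Q QV PV] in simp)
  finally show ?thesis .
qed

lemma module_hom_perm_act: "module_hom cscale cscale (perm_act \<sigma>)"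
  by unfold_locales (auto simp: perm_act_def cscale_def fun_eq_iff plus_fun_def algebra_simps)

lemma perm_act_comp: "perm_act \<sigma> \<circ> perm_act \<tau> = perm_act (\<sigma> \<circ> \<tau>)"
  by (auto simp: perm_act_def fun_eq_iff comp_assoc)

lemma finite_tableaux_inv: "finite (tableaux_inv lam m)"
proof -
  have "cells lam \<subseteq> (\<Union>j\<in>{1..length lam}. {j} \<times> {1..lam ! (j - 1)})"
    by (auto simp: cells_def)
  then have "finite (cells lam)" by (rule finite_subset) auto
  then have "finite {p. \<forall>i. (i \<in> {1..m} \<longrightarrow> p i \<in> cells lam) \<and> (i \<notin> {1..m} \<longrightarrow> p i = (0, 0))}"
    by (intro finite_set_of_finite_funs) auto
  then show ?thesis
    by (rule rev_finite_subset) (auto simp: tableaux_inv_def bij_betw_def)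
qed

lemma delta_comp_permutes:
  assumes "\<rho> permutes S"
  shows "delta r0 (r \<circ> \<rho>) = delta (r0 \<circ> inv \<rho>) r"
proof -
  have "r \<circ> \<rho> = r0 \<longleftrightarrow> r = r0 \<circ> inv \<rho>"
    by (metis assms comp_assoc comp_id permutes_inv_o)
  then show ?thesis by (simp add: delta_def)
qed

text \<open>A tableau is stored as its inverse \<open>p\<close>, so relabelling the entries by
  \<rho> replaces \<open>p\<close> by \<open>p \<circ> inv \<rho>\<close>. The column stabiliser of
  the new tableau is the conjugate of the old one by \<rho>, and conjugation preserves
  signs.\<close>

lemma perm_act_polytabloid:
  assumes \<rho>: "\<rho> permutes {1..m}"
  shows "perm_act \<rho> (polytabloid m p) = polytabloid m (p \<circ> inv \<rho>)"
proof
  fix r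
  have inv: "inv \<rho> permutes {1..m}" by (rule permutes_inv[OF \<rho>])
  have sgn: "sign (\<rho> \<circ> \<pi> \<circ> inv \<rho>) = sign \<pi>" if "\<pi> permutes {1..m}" for \<pi>
  proof -
    have "permutation \<pi>" "permutation \<rho>" "permutation (inv \<rho>)"
      using that \<rho> inv permutes_imp_permutation by blast+
    then show ?thesis
      by (simp add: sign_compose permutation_compose sign_inverse sign_idempotent
          mult.assoc mult.left_commute)
  qed
  have "perm_act \<rho> (polytabloid m p) r
      = (\<Sum>\<pi>\<in>col_stab m p. of_int (sign \<pi>) * delta (fst \<circ> p \<circ> \<pi> \<circ> inv \<rho>) r)"
    by (simp add: perm_act_def polytabloid_def delta_comp_permutes[OF \<rho>])
  also have "\<dots> = (\<Sum>\<pi>\<in>col_stab m (p \<circ> inv \<rho>). of_int (sign \<pi>) * delta (fst \<circ> (p \<circ> inv \<rho>) \<circ> \<pi>) r)"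
  proof (rule sum.reindex_bij_witness[where j = "\<lambda>\<pi>. \<rho> \<circ> \<pi> \<circ> inv \<rho>" and i = "\<lambda>\<pi>. inv \<rho> \<circ> \<pi> \<circ> \<rho>"])
    fix \<pi> assume \<pi>: "\<pi> \<in> col_stab m p"
    show "inv \<rho> \<circ> (\<rho> \<circ> \<pi> \<circ> inv \<rho>) \<circ> \<rho> = \<pi>"
      by (auto simp: fun_eq_iff permutes_inverses[OF \<rho>])
    show "\<rho> \<circ> \<pi> \<circ> inv \<rho> \<in> col_stab m (p \<circ> inv \<rho>)"
      using \<pi> \<rho> inv
      by (auto simp: col_stab_def permutes_inverses[OF \<rho>] intro!: permutes_compose)
    show "of_int (sign (\<rho> \<circ> \<pi> \<circ> inv \<rho>)) * delta (fst \<circ> (p \<circ> inv \<rho>) \<circ> (\<rho> \<circ> \<pi> \<circ> inv \<rho>)) r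
        = of_int (sign \<pi>) * delta (fst \<circ> p \<circ> \<pi> \<circ> inv \<rho>) r"
    proof -
      have "fst \<circ> (p \<circ> inv \<rho>) \<circ> (\<rho> \<circ> \<pi> \<circ> inv \<rho>) = fst \<circ> p \<circ> \<pi> \<circ> inv \<rho>"
        by (auto simp: fun_eq_iff permutes_inverses[OF \<rho>])
      moreover have "sign (\<rho> \<circ> \<pi> \<circ> inv \<rho>) = sign \<pi>"
        using \<pi> by (intro sgn) (simp add: col_stab_def)
      ultimately show ?thesis by simp
    qed
  next
    fix \<pi> assume \<pi>: "\<pi> \<in> col_stab m (p \<circ> inv \<rho>)"
    show "\<rho> \<circ> (inv \<rho> \<circ> \<pi> \<circ> \<rho>) \<circ> inv \<rho> = \<pi>"
      by (auto simp: fun_eq_iff permutes_inverses[OF \<rho>])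
    have "snd (p (inv \<rho> (\<pi> (\<rho> i)))) = snd (p i)" for i
      using \<pi> by (simp add: col_stab_def permutes_inverses[OF \<rho>])
    then show "inv \<rho> \<circ> \<pi> \<circ> \<rho> \<in> col_stab m p"
      using \<pi> \<rho> inv by (auto simp: col_stab_def intro!: permutes_compose)
  qed
  also have "\<dots> = polytabloid m (p \<circ> inv \<rho>) r" by (simp add: polytabloid_def)
  finally show "perm_act \<rho> (polytabloid m p) r = polytabloid m (p \<circ> inv \<rho>) r" .
qed

lemma perm_act_specht:
  assumes \<rho>: "\<rho> permutes {1..m}" and x: "x \<in> specht lam m"
  shows "perm_act \<rho> x \<in> specht lam m"
proof -
  have inv: "inv \<rho> permutes {1..m}" by (rule permutes_inv[OF \<rho>])
  have "perm_act \<rho> ` (polytabloid m ` tableaux_inv lam m) \<subseteq> polytabloid m ` tableaux_inv lam m"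
  proof (clarsimp simp: perm_act_polytabloid[OF \<rho>])
    fix p assume p: "p \<in> tableaux_inv lam m"
    have "bij_betw (p \<circ> inv \<rho>) {1..m} (cells lam)"
      using p permutes_imp_bij[OF inv] by (auto simp: tableaux_inv_def intro: bij_betw_trans)
    moreover have "inv \<rho> i \<notin> {1..m}" if "i \<notin> {1..m}" for i
      using that inv permutes_not_in by metis
    ultimately have "p \<circ> inv \<rho> \<in> tableaux_inv lam m"
      using p by (simp add: tableaux_inv_def)
    then show "polytabloid m (p \<circ> inv \<rho>) \<in> polytabloid m ` tableaux_inv lam m" by blast
  qed
  moreover have "perm_act \<rho> x \<in> cs.span (perm_act \<rho> ` (polytabloid m ` tableaux_inv lam m))"
    using x module_hom.span_image[OF module_hom_perm_act, of \<rho> "polytabloid m ` tableaux_inv lam m"]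
    unfolding specht_def by blast
  ultimately show ?thesis
    unfolding specht_def using cs.span_mono by blast
qed

text \<open>The two actions are the two products of the maps given by \<open>inv h\<close> and
  \<open>h \<circ> \<sigma>\<close>, so \<open>trace_on_commute\<close> applies.\<close>

lemma sym_char_conjugate:
  assumes "\<sigma> permutes {1..m}" and "\<tau> permutes {1..m}" and h: "h permutes {1..m}"
    and conj: "h \<circ> \<sigma> = \<tau> \<circ> h"
  shows "sym_char lam m \<sigma> = sym_char lam m \<tau>"
proof -
  have ih: "inv h permutes {1..m}" by (rule permutes_inv[OF h])
  have *: "inv h \<circ> (h \<circ> \<sigma>) = \<sigma>" "(h \<circ> \<sigma>) \<circ> inv h = \<tau>"
    by (simp add: comp_assoc[symmetric] permutes_inv_o[OF h])
       (simp add: conj comp_assoc permutes_inv_o[OF h])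
  have "sym_char lam m \<sigma> = trace_on (specht lam m) (perm_act (inv h) \<circ> perm_act (h \<circ> \<sigma>))"
    by (simp add: sym_char_def perm_act_comp *)
  also have "\<dots> = trace_on (specht lam m) (perm_act (h \<circ> \<sigma>) \<circ> perm_act (inv h))"
    using assms ih
    by (intro trace_on_commute[where F = "polytabloid m ` tableaux_inv lam m"])
       (auto simp: finite_tableaux_inv specht_def[symmetric]
         intro!: module_hom_perm_act perm_act_specht permutes_compose)
  also have "\<dots> = sym_char lam m \<tau>"
    by (simp add: sym_char_def perm_act_comp *)
  finally show ?thesis .
qed

section \<open>Cycle types\<close>

text \<open>A condition on a function on the whole type, with no carrier set. A permutation of a
  finite set, extended by the identity, satisfies it, and it passes from \<open>f\<close> to
  \<open>image f\<close>, so blocks can be treated as points.\<close>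

definition fin_ord :: "('a \<Rightarrow> 'a) \<Rightarrow> bool" where
  "fin_ord f \<longleftrightarrow> (\<exists>N>0. f ^^ N = id)"

text \<open>Only nonnegative powers occur; for functions of finite order this is the usual orbit,
  because inverses are powers.\<close>

definition orb :: "('a \<Rightarrow> 'a) \<Rightarrow> 'a \<Rightarrow> 'a set" where
  "orb f x = range (\<lambda>j. (f ^^ j) x)"

text \<open>Points are counted, not orbits: on a finite invariant set, for \<open>f\<close> of
  finite order, the value is \<open>i\<close> times the number of orbits of size
  \<open>i\<close>.\<close>

definition period_count :: "('a \<Rightarrow> 'a) \<Rightarrow> 'a set \<Rightarrow> nat \<Rightarrow> nat" where
  "period_count f S i = card {x \<in> S. least_power f x = i}"

lemma fin_ord_permutes: "f permutes S \<Longrightarrow> finite S \<Longrightarrow> fin_ord f"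
  unfolding fin_ord_def using permutation_is_nilpotent permutes_imp_permutation by metis

lemma funpow_image: "(image f ^^ j) A = (f ^^ j) ` A" for f :: "'a \<Rightarrow> 'a"
  by (induction j) (auto simp: image_image)

lemma fin_ord_image:
  assumes "fin_ord f"
  shows "fin_ord (image f)"
proof -
  obtain N where "N > 0" "f ^^ N = id" using assms unfolding fin_ord_def by blast
  then have "image f ^^ N = id" by (auto simp: fun_eq_iff funpow_image)
  with \<open>N > 0\<close> show ?thesis unfolding fin_ord_def by blast
qed

lemma fin_ord_inj: "fin_ord f \<Longrightarrow> inj f"
proof -
  assume "fin_ord f"
  then obtain N where "N > 0" "f ^^ N = id" unfolding fin_ord_def by blast
  then have "f ^^ (N - 1) \<circ> f = id"
    by (metis Suc_diff_1 funpow_Suc_right)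
  then show "inj f" by (metis inj_on_id inj_on_imageI2)
qed

lemma fin_ord_inj_funpow: "fin_ord f \<Longrightarrow> inj (f ^^ j)"
  using fin_ord_inj inj_fn by blast

lemma orb_self [simp]: "x \<in> orb f x"
  unfolding orb_def by (metis funpow_0 rangeI)

lemma funpow_in_orb [simp]: "(f ^^ j) x \<in> orb f x"
  unfolding orb_def by simp

lemma orb_closed: "y \<in> orb f x \<Longrightarrow> f y \<in> orb f x"
proof -
  assume "y \<in> orb f x"
  then obtain j where "f y = (f ^^ Suc j) x" unfolding orb_def by auto
  then show ?thesis unfolding orb_def by blast
qed

lemma funpow_closed: "(\<And>x. x \<in> S \<Longrightarrow> f x \<in> S) \<Longrightarrow> x \<in> S \<Longrightarrow> (f ^^ j) x \<in> S"
  by (induction j) auto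

lemma orb_subset: "(\<And>x. x \<in> S \<Longrightarrow> f x \<in> S) \<Longrightarrow> x \<in> S \<Longrightarrow> orb f x \<subseteq> S"
  unfolding orb_def by (auto intro: funpow_closed)

context
  fixes f :: "'a \<Rightarrow> 'a"
  assumes fo: "fin_ord f"
begin

lemma funpow_least_power: "(f ^^ least_power f x) x = x" and least_power_pos: "0 < least_power f x"
proof -
  obtain N where "N > 0" "f ^^ N = id" using fo unfolding fin_ord_def by blast
  then have "(f ^^ N) x = x" by simp
  then show "(f ^^ least_power f x) x = x" "0 < least_power f x"
    using \<open>N > 0\<close> least_powerI by metis+
qed

lemma least_power_dvd_iff: "least_power f x dvd j \<longleftrightarrow> (f ^^ j) x = x"
proof
  assume "least_power f x dvd j"
  then obtain l where "j = least_power f x * l" by blast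
  moreover have "(f ^^ (least_power f x * l)) x = x"
    by (induction l) (simp_all add: funpow_add funpow_least_power)
  ultimately show "(f ^^ j) x = x" by simp
qed (rule least_power_minimal)

lemma funpow_mod_least_power: "(f ^^ (j mod least_power f x)) x = (f ^^ j) x"
proof -
  have "(f ^^ j) x = (f ^^ (j mod least_power f x + least_power f x * (j div least_power f x))) x"
    by (simp add: mod_mult_div_eq)
  also have "\<dots> = (f ^^ (j mod least_power f x)) ((f ^^ (least_power f x * (j div least_power f x))) x)"
    by (simp only: funpow_add o_apply)
  also have "(f ^^ (least_power f x * (j div least_power f x))) x = x"
    by (subst least_power_dvd_iff[symmetric]) simp
  finally show ?thesis by simp
qed

lemma least_power_funpow: "least_power f ((f ^^ j) x) = least_power f x"
proof -
  have "(f ^^ i) ((f ^^ j) x) = (f ^^ j) x \<longleftrightarrow> (f ^^ i) x = x" for i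
  proof -
    have "(f ^^ i) ((f ^^ j) x) = (f ^^ j) ((f ^^ i) x)"
      by (metis add.commute funpow_add o_apply)
    then show ?thesis using fin_ord_inj_funpow[OF fo, of j] by (simp add: inj_eq)
  qed
  then show ?thesis unfolding least_power_def by simp
qed

lemma least_power_orb: "y \<in> orb f x \<Longrightarrow> least_power f y = least_power f x"
  unfolding orb_def by (auto simp: least_power_funpow)

lemma orb_sym: "y \<in> orb f x \<Longrightarrow> x \<in> orb f y"
proof -
  assume "y \<in> orb f x"
  then obtain j where y: "y = (f ^^ j) x" unfolding orb_def by auto
  let ?p = "least_power f x"
  \<comment> \<open>Continuing from step \<open>j\<close> to step \<open>j * ?p\<close> closes up
    the cycle and so undoes \<open>f ^^ j\<close> at \<open>x\<close>; \<open>?p > 0\<close> keeps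
    the subtraction from being truncated.\<close>
  have "(f ^^ (j * ?p - j)) y = (f ^^ (j * ?p)) x"
  proof -
    have "j * ?p - j + j = j * ?p"
      using least_power_pos[of x] by (simp add: Suc_leI)
    then show ?thesis unfolding y by (metis funpow_add o_apply)
  qed
  also have "\<dots> = x" by (subst least_power_dvd_iff[symmetric]) simp
  finally show ?thesis unfolding orb_def by (metis rangeI)
qed

lemma orb_eq: "y \<in> orb f x \<Longrightarrow> orb f y = orb f x"
proof -
  assume y: "y \<in> orb f x"
  have "orb f y \<subseteq> orb f x" by (rule orb_subset) (auto intro: orb_closed y)
  moreover have "orb f x \<subseteq> orb f y" by (rule orb_subset) (auto intro: orb_closed orb_sym y)
  ultimately show ?thesis by (rule subset_antisym)
qed

lemma orb_eq_image: "orb f x = (\<lambda>j. (f ^^ j) x) ` {..<least_power f x}"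
proof
  show "orb f x \<subseteq> (\<lambda>j. (f ^^ j) x) ` {..<least_power f x}"
  proof
    fix y assume "y \<in> orb f x"
    then obtain j where "y = (f ^^ (j mod least_power f x)) x"
      unfolding orb_def by (auto simp: funpow_mod_least_power)
    then show "y \<in> (\<lambda>j. (f ^^ j) x) ` {..<least_power f x}"
      using least_power_pos[of x] by (intro image_eqI[of _ _ "j mod least_power f x"]) auto
  qed
qed (auto simp: orb_def)

lemma finite_orb: "finite (orb f x)"
  by (simp add: orb_eq_image)

lemma funpow_eq_iff_mod:
  "(f ^^ i) x = (f ^^ j) x \<longleftrightarrow> i mod least_power f x = j mod least_power f x"
proof
  assume "(f ^^ i) x = (f ^^ j) x"
  then show "i mod least_power f x = j mod least_power f x"
  proof (induction i j rule: linorder_wlog)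
    case (le i j)
    then have "(f ^^ i) ((f ^^ (j - i)) x) = (f ^^ i) x"
      by (metis funpow_add le_add_diff_inverse o_apply)
    then have "(f ^^ (j - i)) x = x"
      using fin_ord_inj_funpow[OF fo, of i] by (simp add: inj_eq)
    then have "least_power f x dvd j - i" by (simp add: least_power_dvd_iff)
    then show ?case using le(1) by (metis mod_eq_dvd_iff_nat)
  qed simp
qed (metis funpow_mod_least_power)

lemma card_orb: "card (orb f x) = least_power f x"
proof -
  have "inj_on (\<lambda>j. (f ^^ j) x) {..<least_power f x}"
    by (rule inj_onI) (simp add: funpow_eq_iff_mod)
  then show ?thesis by (simp add: orb_eq_image card_image)
qed

lemma period_count_orb: "period_count f (orb f x) i = (if i = least_power f x then i else 0)"
proof -
  have "{y \<in> orb f x. least_power f y = i} = (if i = least_power f x then orb f x else {})"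
    by (auto simp: least_power_orb)
  then show ?thesis by (simp add: period_count_def card_orb)
qed

text \<open>Membership in an orbit is symmetric, so an invariant set that contains one point of an
  orbit contains all of it.\<close>

lemma orb_disjoint:
  assumes "\<And>x. x \<in> S \<Longrightarrow> f x \<in> S" "c \<notin> S"
  shows "orb f c \<inter> S = {}"
proof (rule ccontr)
  assume "orb f c \<inter> S \<noteq> {}"
  then obtain y where y: "y \<in> orb f c" "y \<in> S" by blast
  then have "c \<in> orb f y" by (simp add: orb_sym)
  moreover have "orb f y \<subseteq> S" by (rule orb_subset) (use assms(1) y in auto)
  ultimately show False using assms(2) by blast
qed

end

section \<open>Decomposition of an invariant set into cycles\<close>

lemma period_count_Un_disjoint:
  "finite S \<Longrightarrow> finite T \<Longrightarrow> S \<inter> T = {} \<Longrightarrow> period_count f (S \<union> T) i = period_count f S i + period_count f T i"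
proof -
  assume fin: "finite S" "finite T" "S \<inter> T = {}"
  have "{x \<in> S \<union> T. least_power f x = i} = {x \<in> S. least_power f x = i} \<union> {x \<in> T. least_power f x = i}"
    by blast
  moreover have "card \<dots> = card {x \<in> S. least_power f x = i} + card {x \<in> T. least_power f x = i}"
    by (rule card_Un_disjoint) (use fin in auto)
  ultimately show ?thesis unfolding period_count_def by simp
qed

text \<open>The list records orbit sizes in the order of construction and need not be sorted. This
  order pairs the \<open>j\<close>-th cycle of \<open>gamma_perm_list \<kappa>\<close> with the
  \<open>j\<close>-th part of a divisor, and the rule \<open>Cons\<close> is the induction by which
  cycles are added one at a time.\<close>

inductive cycle_list :: "('a \<Rightarrow> 'a) \<Rightarrow> 'a set \<Rightarrow> nat list \<Rightarrow> bool" for f where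
  Nil: "cycle_list f {} []"
| Cons: "cycle_list f S xs \<Longrightarrow> orb f c \<inter> S = {} \<Longrightarrow> cycle_list f (orb f c \<union> S) (least_power f c # xs)"

lemma cycle_list_closed: "cycle_list f S xs \<Longrightarrow> x \<in> S \<Longrightarrow> f x \<in> S"
  by (induction rule: cycle_list.induct) (auto intro: orb_closed)

lemma cycle_list_props:
  assumes "fin_ord f" "cycle_list f S xs"
  shows "finite S" "sum_list xs = card S" "0 \<notin> set xs" "set xs \<subseteq> least_power f ` S"
    "period_count f S i = i * count_list xs i"
proof -
  from assms(2)
  have "finite S \<and> sum_list xs = card S \<and> 0 \<notin> set xs \<and> set xs \<subseteq> least_power f ` S \<and>
    period_count f S i = i * count_list xs i"
  proof induction
    case Nil
    show ?case by (simp add: period_count_def)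
  next
    case (Cons S xs c)
    have "least_power f c \<in> least_power f ` (orb f c \<union> S)" by (intro imageI) simp
    then show ?case
      using Cons assms(1) least_power_pos[OF assms(1), of c]
      by (auto simp: finite_orb card_Un_disjoint card_orb period_count_Un_disjoint period_count_orb)
  qed
  then show "finite S" "sum_list xs = card S" "0 \<notin> set xs" "set xs \<subseteq> least_power f ` S"
    "period_count f S i = i * count_list xs i" by auto
qed

text \<open>Splitting off an orbit of maximal period at each stage makes the list weakly
  decreasing.\<close>

lemma cycle_list_exists:
  assumes "fin_ord f" "finite S" "\<And>x. x \<in> S \<Longrightarrow> f x \<in> S"
  shows "\<exists>\<mu>. cycle_list f S \<mu> \<and> sorted_wrt (\<ge>) \<mu>"
  using assms(2,3)
proof (induction "card S" arbitrary: S rule: less_induct)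
  case less
  show ?case
  proof (cases "S = {}")
    case True
    then show ?thesis using cycle_list.Nil by (intro exI[of _ "[]"]) auto
  next
    case False
    then have "Max (least_power f ` S) \<in> least_power f ` S" using less.prems(1) by simp
    then obtain c where c: "c \<in> S" "least_power f c = Max (least_power f ` S)" by auto
    have sub: "orb f c \<subseteq> S" by (rule orb_subset) (use less.prems c in auto)
    define S' where "S' = S - orb f c"
    have "card S' < card S"
      unfolding S'_def using less.prems(1) c(1) by (intro psubset_card_mono) (auto intro: orb_self)
    moreover have "f x \<in> S'" if "x \<in> S'" for x
    proof -
      have "f x \<notin> orb f c"
      proof
        assume "f x \<in> orb f c"
        then have "orb f (f x) = orb f c" by (rule orb_eq[OF assms(1)])
        moreover have "f x \<in> orb f x" by (intro orb_closed) simp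
        then have "x \<in> orb f (f x)" by (rule orb_sym[OF assms(1)])
        ultimately show False using that unfolding S'_def by blast
      qed
      then show ?thesis using that less.prems(2) unfolding S'_def by auto
    qed
    ultimately obtain \<mu> where \<mu>: "cycle_list f S' \<mu>" "sorted_wrt (\<ge>) \<mu>"
      using less.hyps[of S'] less.prems(1) unfolding S'_def by blast
    have "cycle_list f (orb f c \<union> S') (least_power f c # \<mu>)"
      by (rule cycle_list.Cons[OF \<mu>(1)]) (auto simp: S'_def)
    moreover have "orb f c \<union> S' = S" using sub by (auto simp: S'_def)
    moreover have "y \<le> least_power f c" if "y \<in> set \<mu>" for y
    proof -
      have "y \<in> least_power f ` S'" using that cycle_list_props(4)[OF assms(1) \<mu>(1)] by blast
      then have "y \<in> least_power f ` S" unfolding S'_def by blast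
      then show ?thesis unfolding c(2) using less.prems(1) by simp
    qed
    ultimately show ?thesis using \<mu>(2) by (intro exI[of _ "least_power f c # \<mu>"]) auto
  qed
qed

lemma funpow_intertwine:
  assumes "\<And>x. x \<in> S \<Longrightarrow> f x \<in> S" "\<And>x. x \<in> S \<Longrightarrow> h (f x) = g (h x)" "c \<in> S"
  shows "(g ^^ j) (h c) = h ((f ^^ j) c)"
proof (induction j)
  case (Suc j)
  have "(f ^^ j) c \<in> S" by (rule funpow_closed) (fact assms)+
  then show ?case using Suc assms(2) by simp
qed simp

lemma orb_intertwine:
  assumes "\<And>x. x \<in> S \<Longrightarrow> f x \<in> S" "\<And>x. x \<in> S \<Longrightarrow> h (f x) = g (h x)" "c \<in> S"
  shows "orb g (h c) = h ` orb f c"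
proof -
  have "(g ^^ j) (h c) = h ((f ^^ j) c)" for j by (rule funpow_intertwine) (fact assms)+
  then show ?thesis unfolding orb_def by (simp add: image_image)
qed

lemma least_power_intertwine:
  assumes "\<And>x. x \<in> S \<Longrightarrow> f x \<in> S" "\<And>x. x \<in> S \<Longrightarrow> h (f x) = g (h x)" "c \<in> S" "inj_on h S"
  shows "least_power g (h c) = least_power f c"
proof -
  have "(g ^^ j) (h c) = h c \<longleftrightarrow> (f ^^ j) c = c" for j
  proof -
    have "(f ^^ j) c \<in> S" by (rule funpow_closed) (fact assms)+
    moreover have "(g ^^ j) (h c) = h ((f ^^ j) c)" by (rule funpow_intertwine) (fact assms)+
    ultimately show ?thesis using assms(3,4) by (simp add: inj_on_eq_iff)
  qed
  then show ?thesis unfolding least_power_def by simp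
qed

text \<open>Used to shift the tail of \<open>gamma_perm_list\<close> by \<open>a\<close>, and to
  pass from the indices of the distinguished blocks to the blocks themselves.\<close>

lemma cycle_list_transfer:
  assumes "cycle_list f S xs" "inj_on h S" "\<And>x. x \<in> S \<Longrightarrow> h (f x) = g (h x)"
  shows "cycle_list g (h ` S) xs"
  using assms
proof (induction rule: cycle_list.induct)
  case Nil
  then show ?case by (simp add: cycle_list.Nil)
next
  case (Cons S xs c)
  have cl: "f x \<in> orb f c" if "x \<in> orb f c" for x using that by (rule orb_closed)
  have eq: "h (f x) = g (h x)" if "x \<in> orb f c" for x using that Cons.prems(2) by blast
  have inj: "inj_on h (orb f c)" using Cons.prems(1) by (rule inj_on_subset) auto
  have o: "orb g (h c) = h ` orb f c" by (rule orb_intertwine[of "orb f c"]) (auto simp: cl eq)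
  have l: "least_power g (h c) = least_power f c"
    by (rule least_power_intertwine[of "orb f c"]) (auto simp: cl eq inj)
  have "cycle_list g (h ` S) xs"
    using Cons.prems by (intro Cons.IH) (auto intro: inj_on_subset)
  moreover have "orb g (h c) \<inter> h ` S = {}"
    unfolding o using Cons.prems(1) Cons.hyps(2)
    by (simp add: inj_on_image_Int[symmetric])
  ultimately have "cycle_list g (orb g (h c) \<union> h ` S) (least_power g (h c) # xs)"
    by (rule cycle_list.Cons)
  then show ?case by (simp add: o l image_Un)
qed

inductive_cases cycle_list_ConsE: "cycle_list f S (a # xs)"

text \<open>On matching orbits the point \<open>(f ^^ j) c\<close> is sent to
  \<open>(g ^^ j) c'\<close>; equality of the periods makes this well defined and injective.\<close>

lemma cycle_list_conjugate:
  assumes "fin_ord f" "fin_ord g" "cycle_list f S xs" "cycle_list g T xs"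
  shows "\<exists>h. bij_betw h S T \<and> (\<forall>x\<in>S. h (f x) = g (h x))"
  using assms(3,4)
proof (induction arbitrary: T rule: cycle_list.induct)
  case Nil
  then have "T = {}" by (cases rule: cycle_list.cases) auto
  then show ?case by (simp add: bij_betw_def)
next
  case (Cons S xs c)
  from Cons.prems obtain T' c' where T: "T = orb g c' \<union> T'" "cycle_list g T' xs" "orb g c' \<inter> T' = {}"
    "least_power g c' = least_power f c"
    by (rule cycle_list_ConsE) metis
  obtain h where h: "bij_betw h S T'" "\<forall>x\<in>S. h (f x) = g (h x)"
    using Cons.IH[OF T(2)] by blast
  \<comment> \<open>An arbitrary exponent that reaches \<open>x\<close>. Exponents matter only
    modulo the common period, so \<open>h0\<close> does not depend on the choice.\<close>
  define idx where "idx x = (SOME j. x = (f ^^ j) c)" for x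
  have idx: "(f ^^ idx x) c = x" if "x \<in> orb f c" for x
  proof -
    have "\<exists>j. x = (f ^^ j) c" using that unfolding orb_def by auto
    then show ?thesis unfolding idx_def by (metis (mono_tags, lifting) someI_ex)
  qed
  define h0 where "h0 x = (g ^^ idx x) c'" for x
  have h0: "h0 ((f ^^ j) c) = (g ^^ j) c'" for j
    unfolding h0_def using idx[of "(f ^^ j) c"] T(4)
    by (simp add: funpow_eq_iff_mod[OF assms(1)] funpow_eq_iff_mod[OF assms(2)])
  have bij0: "bij_betw h0 (orb f c) (orb g c')"
  proof (rule bij_betw_imageI)
    show "inj_on h0 (orb f c)"
    proof (rule inj_onI)
      fix x y assume xy: "x \<in> orb f c" "y \<in> orb f c" and "h0 x = h0 y"
      then obtain i j where ij: "x = (f ^^ i) c" "y = (f ^^ j) c" unfolding orb_def by auto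
      with \<open>h0 x = h0 y\<close> have "(g ^^ i) c' = (g ^^ j) c'" by (simp add: h0)
      then show "x = y" using T(4)
        by (simp add: ij funpow_eq_iff_mod[OF assms(1)] funpow_eq_iff_mod[OF assms(2)])
    qed
    show "h0 ` orb f c = orb g c'" unfolding orb_def by (auto simp: h0 image_image)
  qed
  have comm0: "h0 (f x) = g (h0 x)" if "x \<in> orb f c" for x
  proof -
    from that obtain j where "x = (f ^^ j) c" unfolding orb_def by auto
    then show ?thesis using h0[of "Suc j"] h0[of j] by simp
  qed
  define H where "H x = (if x \<in> orb f c then h0 x else h x)" for x
  have "bij_betw H (orb f c) (orb g c')"
    using bij0 by (rule bij_betw_cong[THEN iffD1, rotated]) (simp add: H_def)
  moreover have "bij_betw H S T'"
    using h(1) by (rule bij_betw_cong[THEN iffD1, rotated]) (use Cons.hyps(2) in \<open>auto simp: H_def\<close>)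
  ultimately have "bij_betw H (orb f c \<union> S) T"
    unfolding T(1) by (rule bij_betw_combine) (rule T(3))
  moreover have "H (f x) = g (H x)" if "x \<in> orb f c \<union> S" for x
  proof (cases "x \<in> orb f c")
    case True
    then show ?thesis using orb_closed[of x f c] by (simp add: H_def comm0)
  next
    case False
    then have "x \<in> S" "f x \<in> S" using that cycle_list_closed[OF Cons.hyps(1)] by auto
    then show ?thesis using Cons.hyps(2) h(2) by (auto simp: H_def)
  qed
  ultimately show ?case by blast
qed

section \<open>Standard permutations of given cycle type\<close>

lemma gamma_perm_permutes: "gamma_perm r permutes {1..r}"
proof (rule inj_imp_permutes)
  show "inj_on (gamma_perm r) {1..r}"
  proof (rule inj_onI)
    fix x y assume a: "x \<in> {1..r}" "y \<in> {1..r}" "gamma_perm r x = gamma_perm r y"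
    have "x \<noteq> 0" "y \<noteq> 0" "x \<le> r" "y \<le> r" using a by auto
    then show "x = y" using a unfolding gamma_perm_def by (auto split: if_splits)
  qed
  show "gamma_perm r x \<in> {1..r}" if "x \<in> {1..r}" for x
    using that unfolding gamma_perm_def by auto
  show "finite {1..r}" by simp
  show "gamma_perm r x = x" if "x \<notin> {1..r}" for x
    using that unfolding gamma_perm_def by auto
qed

lemma gamma_perm_list_permutes: "gamma_perm_list xs permutes {1..sum_list xs}"
proof (induction xs)
  case Nil
  show ?case by (simp add: id_def)
next
  case (Cons a xs)
  let ?r = "sum_list xs"
  have gin: "gamma_perm a j \<in> {1..a}" if "j \<in> {1..a}" for j
    using that permutes_in_image[OF gamma_perm_permutes] by blast
  \<comment> \<open>Values of the tail are at least 1 before the shift by \<open>a\<close>, which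
    separates them from the values on the first cycle.\<close>
  have in1: "gamma_perm_list xs j \<ge> 1" if "j \<ge> 1" for j
  proof (cases "j \<in> {1..?r}")
    case True then show ?thesis using permutes_in_image[OF Cons] by (meson atLeastAtMost_iff)
  next
    case False then show ?thesis using permutes_not_in[OF Cons False] that by simp
  qed
  show ?case
  proof (rule inj_imp_permutes)
    show "inj_on (gamma_perm_list (a # xs)) {1..sum_list (a # xs)}"
    proof (rule inj_onI)
      fix x y assume xy: "x \<in> {1..sum_list (a # xs)}" "y \<in> {1..sum_list (a # xs)}"
        and eq: "gamma_perm_list (a # xs) x = gamma_perm_list (a # xs) y"
      consider "x \<le> a" "y \<le> a" | "x \<le> a" "a < y" | "a < x" "y \<le> a" | "a < x" "a < y" by linarith
      then show "x = y"
      proof cases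
        case 1
        then show ?thesis using eq xy permutes_inj[OF gamma_perm_permutes] by (simp add: inj_eq)
      next
        case 2
        then have "1 \<le> gamma_perm_list xs (y - a)" by (intro in1) simp
        then show ?thesis using 2 eq xy gin[of x] by simp
      next
        case 3
        then have "1 \<le> gamma_perm_list xs (x - a)" by (intro in1) simp
        then show ?thesis using 3 eq xy gin[of y] by simp
      next
        case 4
        then have "x - a = y - a" using eq permutes_inj[OF Cons] by (simp add: inj_eq)
        then show ?thesis using 4 by simp
      qed
    qed
    show "gamma_perm_list (a # xs) x \<in> {1..sum_list (a # xs)}"
      if "x \<in> {1..sum_list (a # xs)}" for x
    proof (cases "x \<le> a")
      case True
      then show ?thesis using gin[of x] that by auto
    next
      case False
      then have "x - a \<in> {1..?r}" using that by auto
      then have "gamma_perm_list xs (x - a) \<in> {1..?r}" using permutes_in_image[OF Cons] by blast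
      then show ?thesis using False by auto
    qed
    show "gamma_perm_list (a # xs) x = x" if "x \<notin> {1..sum_list (a # xs)}" for x
    proof (cases "x = 0")
      case False
      then have "a < x" "x - a \<notin> {1..?r}" using that by auto
      then show ?thesis using permutes_not_in[OF Cons] by simp
    qed simp
  qed simp
qed

text \<open>The first cycle runs downwards from its largest point \<open>a\<close>, which makes
  \<open>a\<close> the convenient base point: its \<open>j\<close>-th iterate is
  \<open>a - j\<close>. The remaining cycles are those of the tail, shifted by
  \<open>a\<close>.\<close>

lemma cycle_list_gamma:
  assumes "0 \<notin> set xs"
  shows "cycle_list (gamma_perm_list xs) {1..sum_list xs} xs"
  using assms
proof (induction xs)
  case Nil
  then show ?case by (simp add: cycle_list.Nil)
next
  case (Cons a xs)
  let ?g = "gamma_perm_list (a # xs)"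
  have a: "a > 0" using Cons.prems by auto
  have pow: "(?g ^^ j) a = a - j" if "j < a" for j
    using that by (induction j) (auto simp: gamma_perm_def)
  have fo: "fin_ord ?g" by (rule fin_ord_permutes[OF gamma_perm_list_permutes]) simp
  have lp: "least_power ?g a = a"
  proof (rule antisym)
    have "(?g ^^ a) a = ?g ((?g ^^ (a - 1)) a)"
      using a by (metis Suc_diff_1 funpow.simps(2) o_apply)
    also have "\<dots> = ?g 1" using a by (subst pow) auto
    also have "\<dots> = a" using a by (simp add: gamma_perm_def)
    finally show "least_power ?g a \<le> a" using a by (rule least_power_le)
    show "a \<le> least_power ?g a"
    proof (rule ccontr)
      assume "\<not> a \<le> least_power ?g a"
      then have "(?g ^^ least_power ?g a) a = a - least_power ?g a" by (intro pow) simp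
      then show False using funpow_least_power[OF fo, of a] least_power_pos[OF fo, of a] a by simp
    qed
  qed
  have orb: "orb ?g a = {1..a}"
  proof -
    have "orb ?g a = (\<lambda>j. (?g ^^ j) a) ` {..<a}" using orb_eq_image[OF fo, of a] lp by simp
    also have "\<dots> = (\<lambda>j. a - j) ` {..<a}" by (rule image_cong) (use pow in auto)
    also have "\<dots> = {1..a}"
    proof (intro set_eqI iffI)
      fix x assume "x \<in> {1..a}"
      then show "x \<in> (\<lambda>j. a - j) ` {..<a}" by (intro image_eqI[of _ _ "a - x"]) auto
    qed auto
    finally show ?thesis .
  qed
  have "cycle_list ?g ((\<lambda>j. j + a) ` {1..sum_list xs}) xs"
    by (rule cycle_list_transfer[of "gamma_perm_list xs"]) (use Cons in auto)
  then have "cycle_list ?g {a + 1..sum_list xs + a} xs"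
    by (simp add: add.commute image_add_atLeastAtMost' del: gamma_perm_list.simps)
  then have "cycle_list ?g (orb ?g a \<union> {a + 1..sum_list xs + a}) (least_power ?g a # xs)"
    by (rule cycle_list.Cons) (auto simp: orb simp del: gamma_perm_list.simps)
  moreover have "{1..a} \<union> {a + 1..sum_list xs + a} = {1..sum_list (a # xs)}"
    using a by auto
  ultimately show ?case unfolding orb lp by (simp del: gamma_perm_list.simps)
qed

lemma sym_char_cycle_list:
  assumes \<tau>: "\<tau> permutes {1..m}" and cyc: "cycle_list \<tau> {1..m} \<mu>"
  shows "sym_char lam m \<tau> = sym_char lam m (gamma_perm_list \<mu>)"
proof -
  let ?g = "gamma_perm_list \<mu>"
  have fo: "fin_ord \<tau>" by (rule fin_ord_permutes[OF \<tau>]) simp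
  have sum: "sum_list \<mu> = m" using cycle_list_props(2)[OF fo cyc] by simp
  then have g: "?g permutes {1..m}" using gamma_perm_list_permutes[of \<mu>] by simp
  have cyc': "cycle_list ?g {1..m} \<mu>"
    using cycle_list_gamma[OF cycle_list_props(3)[OF fo cyc]] sum by simp
  have fg: "fin_ord ?g" by (rule fin_ord_permutes[OF g]) simp
  obtain h where h: "bij_betw h {1..m} {1..m}" "\<forall>x\<in>{1..m}. h (\<tau> x) = ?g (h x)"
    using cycle_list_conjugate[OF fo fg cyc cyc'] by blast
  \<comment> \<open>\<open>h\<close> is controlled on \<open>{1..m}\<close> only. It is made the
    identity elsewhere, where \<tau> and \<open>?g\<close> are the identity as well.\<close>
  define H where "H x = (if x \<in> {1..m} then h x else x)" for x
  have H: "H permutes {1..m}"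
  proof (rule bij_imp_permutes)
    show "bij_betw H {1..m} {1..m}"
      using h(1) by (rule bij_betw_cong[THEN iffD1, rotated]) (simp add: H_def)
  qed (auto simp: H_def)
  have "H (\<tau> x) = ?g (H x)" for x
  proof (cases "x \<in> {1..m}")
    case True
    then have "\<tau> x \<in> {1..m}" using permutes_in_image[OF \<tau>] by blast
    then show ?thesis using True h(2) unfolding H_def by simp
  next
    case False
    then show ?thesis using permutes_not_in[OF \<tau> False] permutes_not_in[OF g False]
      unfolding H_def by auto
  qed
  then show ?thesis by (intro sym_char_conjugate[OF \<tau> g H]) auto
qed

section \<open>Integer partitions as cycle types\<close>

lemma finite_partitions: "finite {\<mu>. is_partition \<mu> m}"
proof (rule finite_subset)
  show "{\<mu>. is_partition \<mu> m} \<subseteq> {xs. set xs \<subseteq> {..m} \<and> length xs \<le> m}"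
  proof safe
    fix \<mu> x assume p: "is_partition \<mu> m"
    show "x \<le> m" if "x \<in> set \<mu>"
      using p that member_le_sum_list[of x \<mu>] by (auto simp: is_partition_def)
    have "0 \<notin> set \<mu> \<Longrightarrow> length \<mu> \<le> sum_list \<mu>" by (induction \<mu>) auto
    then show "length \<mu> \<le> m" using p by (auto simp: is_partition_def)
  qed
qed (rule finite_lists_length_le, simp)

text \<open>All parts lie in \<open>{1..m}\<close>, so these multiplicities determine the multiset
  of parts, and sortedness determines their order.\<close>

lemma partition_eqI:
  assumes "is_partition \<mu> m" "is_partition \<mu>' m" "\<And>i. i \<in> {1..m} \<Longrightarrow> mult i \<mu> = mult i \<mu>'"
  shows "\<mu> = \<mu>'"
proof -
  have out: "count_list xs i = 0" if "is_partition xs m" "i \<notin> {1..m}" for xs i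
  proof -
    have "i \<notin> set xs"
    proof
      assume "i \<in> set xs"
      moreover from this have "i \<le> m" "i \<noteq> 0"
        using that(1) member_le_sum_list[of i xs] by (auto simp: is_partition_def intro: Nat.gr0I)
      ultimately show False using that(2) by simp
    qed
    then show ?thesis by (simp add: count_list_0_iff)
  qed
  have "count_list \<mu> i = count_list \<mu>' i" for i
    using out[OF assms(1), of i] out[OF assms(2), of i] assms(3)[of i]
    unfolding mult_def by (cases "i \<in> {1..m}") auto
  then have "mset (rev \<mu>) = mset (rev \<mu>')"
    by (intro multiset_eqI) (simp add: count_mset)
  moreover have "sorted (rev \<mu>)" "sorted (rev \<mu>')"
    using assms(1,2) by (auto simp: is_partition_def sorted_wrt_rev)
  ultimately have "rev \<mu> = rev \<mu>'" by (metis properties_for_sort)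
  then show ?thesis by simp
qed

text \<open>Exactly one \<mu> is the cycle type of \<tau>, and the product of indicators picks it
  out. The gain is that the coefficients are products over \<open>i\<close> which can later be
  summed over all invariant pairs. The map \<open>b\<close> carries the cycles of \<tau> to the
  orbits of \<open>F\<close> on \<open>D\<close>, so the coefficients depend on \<open>D\<close>
  alone and no longer on \<tau>.\<close>

lemma sym_char_expand:
  fixes F :: "'b \<Rightarrow> 'b"
  assumes \<tau>: "\<tau> permutes {1..m}" and "fin_ord F" and b: "bij_betw b {1..m} D"
    and eq: "\<And>j. j \<in> {1..m} \<Longrightarrow> b (\<tau> j) = F (b j)" and "m \<le> k"
  shows "sym_char lam m \<tau> = (\<Sum>\<mu> | is_partition \<mu> m.
    (\<Prod>i\<in>{1..k}. of_bool (period_count F D i = i * mult i \<mu>)) * sym_char lam m (gamma_perm_list \<mu>))"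
proof -
  have fo: "fin_ord \<tau>" by (rule fin_ord_permutes[OF \<tau>]) simp
  obtain \<mu>0 where \<mu>0: "cycle_list \<tau> {1..m} \<mu>0" "sorted_wrt (\<ge>) \<mu>0"
    using cycle_list_exists[OF fo, of "{1..m}"] permutes_in_image[OF \<tau>] by blast
  have part: "is_partition \<mu>0 m"
    using \<mu>0 cycle_list_props(2,3)[OF fo \<mu>0(1)] by (simp add: is_partition_def)
  have "cycle_list F (b ` {1..m}) \<mu>0"
    by (rule cycle_list_transfer[OF \<mu>0(1)]) (use b eq in \<open>auto simp: bij_betw_def\<close>)
  then have "cycle_list F D \<mu>0" using b by (simp add: bij_betw_def)
  then have period_count: "period_count F D i = i * mult i \<mu>0" for i
    unfolding mult_def by (rule cycle_list_props(5)[OF assms(2)])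
  have "(\<Prod>i\<in>{1..k}. of_bool (period_count F D i = i * mult i \<mu>)) = (if \<mu> = \<mu>0 then 1 else 0 :: complex)"
    if "is_partition \<mu> m" for \<mu>
  proof (cases "\<mu> = \<mu>0")
    case False
    then obtain i where "i \<in> {1..m}" "mult i \<mu> \<noteq> mult i \<mu>0"
      using partition_eqI[OF \<open>is_partition \<mu> m\<close> part] by blast
    then have "i \<in> {1..k}" "period_count F D i \<noteq> i * mult i \<mu>" using assms(5) by (auto simp: period_count)
    then show ?thesis using False by (auto intro!: prod_zero)
  qed (simp add: period_count)
  then have "(\<Sum>\<mu> | is_partition \<mu> m.
      (\<Prod>i\<in>{1..k}. of_bool (period_count F D i = i * mult i \<mu>)) * sym_char lam m (gamma_perm_list \<mu>))
    = (\<Sum>\<mu> | is_partition \<mu> m. (if \<mu> = \<mu>0 then sym_char lam m (gamma_perm_list \<mu>0) else 0))"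
    by (intro sum.cong) auto
  also have "\<dots> = sym_char lam m (gamma_perm_list \<mu>0)"
    using part by (simp add: finite_partitions)
  finally show ?thesis using sym_char_cycle_list[OF \<tau> \<mu>0(1)] by simp
qed

text \<open>The periods of the elements of \<open>D\<close> lie in \<open>{1..k}\<close>, so the
  period counts add up to \<open>card D\<close>, while the products \<open>i * mult i \<mu>\<close>
  add up to \<open>m\<close>. This lets the condition \<open>card D = m\<close> be absorbed into the
  indicators.\<close>

lemma card_eq_sum_mult:
  assumes F: "fin_ord F" "finite D" "\<And>x. x \<in> D \<Longrightarrow> F x \<in> D" "card D \<le> k"
    and \<mu>: "is_partition \<mu> m" "m \<le> k" and period_count: "\<And>i. i \<in> {1..k} \<Longrightarrow> period_count F D i = i * mult i \<mu>"
  shows "card D = m"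
proof -
  have lp: "least_power F x \<in> {1..k}" if "x \<in> D" for x
  proof -
    have "orb F x \<subseteq> D" by (rule orb_subset) (use that F(3) in auto)
    then have "least_power F x \<le> card D" using card_mono[OF F(2)] card_orb[OF F(1)] by metis
    then show ?thesis using F(4) least_power_pos[OF F(1), of x] by simp
  qed
  have "D = (\<Union>i\<in>{1..k}. {x \<in> D. least_power F x = i})" using lp by auto
  then have "card D = card (\<Union>i\<in>{1..k}. {x \<in> D. least_power F x = i})" by (rule arg_cong)
  also have "\<dots> = (\<Sum>i\<in>{1..k}. period_count F D i)"
    unfolding period_count_def by (rule card_UN_disjoint) (use F(2) in auto)
  also have "\<dots> = (\<Sum>i\<in>{1..k}. i * count_list \<mu> i)" by (simp add: period_count mult_def)
  also have "\<dots> = (\<Sum>i\<in>set \<mu>. count_list \<mu> i * i)"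
  proof (rule sum.mono_neutral_cong_right)
    show "set \<mu> \<subseteq> {1..k}"
    proof
      fix i assume "i \<in> set \<mu>"
      moreover from this have "i \<le> m" "i \<noteq> 0"
        using \<mu>(1) member_le_sum_list[of i \<mu>] by (auto simp: is_partition_def intro: Nat.gr0I)
      ultimately show "i \<in> {1..k}" using \<mu>(2) by simp
    qed
  qed (auto simp: count_list_0_iff)
  also have "\<dots> = sum_list (map (\<lambda>x. x) \<mu>)" by (subst sum_list_map_eq_sum_count) simp
  also have "\<dots> = m" using \<mu>(1) by (simp add: is_partition_def)
  finally show ?thesis .
qed

section \<open>Counting invariant set partitions\<close>

lemma partition_on_unique:
  "partition_on A P \<Longrightarrow> B \<in> P \<Longrightarrow> B' \<in> P \<Longrightarrow> x \<in> B \<Longrightarrow> x \<in> B' \<Longrightarrow> B = B'"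
  unfolding partition_on_def disjoint_def by blast

lemma partition_on_Diff:
  assumes "partition_on A P" "Q \<subseteq> P"
  shows "partition_on (A - \<Union>Q) (P - Q)"
proof (rule partition_onI)
  show "\<Union>(P - Q) = A - \<Union>Q"
  proof
    show "\<Union>(P - Q) \<subseteq> A - \<Union>Q"
    proof
      fix x assume "x \<in> \<Union>(P - Q)"
      then obtain B where B: "x \<in> B" "B \<in> P" "B \<notin> Q" by blast
      have "x \<notin> \<Union>Q"
      proof
        assume "x \<in> \<Union>Q"
        then obtain B' where "x \<in> B'" "B' \<in> Q" by blast
        moreover from this have "B' \<in> P" using assms(2) by blast
        ultimately show False using B partition_on_unique[OF assms(1)] by blast
      qed
      then show "x \<in> A - \<Union>Q" using B partition_onD1[OF assms(1)] by blast
    qed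
    show "A - \<Union>Q \<subseteq> \<Union>(P - Q)" using partition_onD1[OF assms(1)] by blast
  qed
qed (use assms in \<open>auto simp: partition_on_def disjoint_def disjnt_def\<close>)

lemma partition_on_Un:
  assumes P: "partition_on A P" and Q: "partition_on B Q" and "A \<inter> B = {}"
  shows "partition_on (A \<union> B) (P \<union> Q)"
proof (rule partition_onI)
  show "\<Union>(P \<union> Q) = A \<union> B" using partition_onD1[OF P] partition_onD1[OF Q] by simp
  show "{} \<notin> P \<union> Q" using partition_onD3[OF P] partition_onD3[OF Q] by simp
  have "disjoint (P \<union> Q)"
    using partition_onD2[OF P] partition_onD2[OF Q]
    by (rule disjoint_union) (use assms(3) partition_onD1[OF P] partition_onD1[OF Q] in blast)
  then show "disjnt p q" if "p \<in> P \<union> Q" "q \<in> P \<union> Q" "p \<noteq> q" for p q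
    using that unfolding disjnt_def disjoint_def by blast
qed

definition block_of :: "'a \<Rightarrow> 'a set set \<Rightarrow> 'a set" where
  "block_of c P = (THE N. N \<in> P \<and> c \<in> N)"

lemma block_of_eq: "partition_on U P \<Longrightarrow> N \<in> P \<Longrightarrow> c \<in> N \<Longrightarrow> block_of c P = N"
  unfolding block_of_def by (rule the_equality) (blast, rule partition_on_unique, auto)

text \<open>\<open>D\<close> is the set of distinguished blocks. Only closure under \<open>f\<close>
  is asked for; with \<open>f\<close> injective and \<open>P\<close> finite it amounts to
  invariance, of the complement of \<open>D\<close> as well.\<close>

definition inv_parts :: "('a \<Rightarrow> 'a) \<Rightarrow> 'a set \<Rightarrow> ('a set set \<times> 'a set set) set" where
  "inv_parts f S = {(P, D). partition_on S P \<and> D \<subseteq> P \<and> (\<forall>B\<in>P. f ` B \<in> P) \<and> (\<forall>B\<in>D. f ` B \<in> D)}"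

lemma inv_partsD:
  assumes "(P, D) \<in> inv_parts f S"
  shows "partition_on S P" "D \<subseteq> P" "\<And>B. B \<in> P \<Longrightarrow> f ` B \<in> P" "\<And>B. B \<in> D \<Longrightarrow> f ` B \<in> D"
  using assms by (auto simp: inv_parts_def)

lemma inv_partsI:
  assumes "partition_on S P" "D \<subseteq> P" "\<And>B. B \<in> P \<Longrightarrow> f ` B \<in> P" "\<And>B. B \<in> D \<Longrightarrow> f ` B \<in> D"
  shows "(P, D) \<in> inv_parts f S"
  using assms by (auto simp: inv_parts_def)

lemma finite_inv_parts: "finite S \<Longrightarrow> finite (inv_parts f S)"
proof -
  assume "finite S"
  then have "finite (Pow (Pow S) \<times> Pow (Pow S))" by simp
  then show ?thesis
    by (rule rev_finite_subset) (auto simp: inv_parts_def partition_on_def)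
qed

lemma inv_parts_empty: "inv_parts f {} = {({}, {})}"
  by (auto simp: inv_parts_def partition_on_empty)

text \<open>Every \<open>i\<close>-th point of the cycle of \<open>c\<close>, starting at
  \<open>c\<close>. When \<open>i\<close> divides the length of the cycle, the translates of this
  set are the partition of the cycle into \<open>i\<close> blocks that \<open>f\<close>
  permutes.\<close>

definition sub_orb :: "('a \<Rightarrow> 'a) \<Rightarrow> 'a \<Rightarrow> nat \<Rightarrow> 'a set" where
  "sub_orb f c i = range (\<lambda>l. (f ^^ (i * l)) c)"

text \<open>Being the identity when \<open>U\<close> is absent, the operation can be applied to
  \<open>P\<close> and \<open>D\<close> alike, whether or not \<open>U\<close> is
  distinguished.\<close>

definition replace_orb :: "('a \<Rightarrow> 'a) \<Rightarrow> 'a \<Rightarrow> 'a \<Rightarrow> 'a set \<Rightarrow> 'a set" where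
  "replace_orb F U V Q = (if U \<in> Q then Q - orb F U \<union> orb F V else Q)"

context
  fixes F :: "'b \<Rightarrow> 'b"
  assumes fo: "fin_ord F"
begin

lemma Diff_orb_closed:
  assumes Q: "\<And>x. x \<in> Q \<Longrightarrow> F x \<in> Q" and x: "x \<in> Q - orb F U"
  shows "F x \<in> Q - orb F U"
proof -
  have "F x \<notin> orb F U"
  proof
    assume "F x \<in> orb F U"
    then have "orb F (F x) = orb F U" by (rule orb_eq[OF fo])
    moreover have "F x \<in> orb F x" by (intro orb_closed) simp
    then have "x \<in> orb F (F x)" by (rule orb_sym[OF fo])
    ultimately show False using x by blast
  qed
  then show ?thesis using Q x by blast
qed

lemma replace_orb_closed:
  assumes "\<And>x. x \<in> Q \<Longrightarrow> F x \<in> Q" "x \<in> replace_orb F U V Q"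
  shows "F x \<in> replace_orb F U V Q"
  using assms(2) Diff_orb_closed[of Q x U] orb_closed[of x F V] assms(1)
  unfolding replace_orb_def by (auto split: if_splits)

text \<open>If \<open>U\<close> is missing from the closed set \<open>D\<close>, so is its whole
  orbit; deleting that orbit from \<open>P\<close> then takes nothing away from
  \<open>D\<close>.\<close>

lemma replace_orb_mono:
  assumes "\<And>x. x \<in> D \<Longrightarrow> F x \<in> D" "D \<subseteq> P"
  shows "replace_orb F U V D \<subseteq> replace_orb F U V P"
proof (cases "U \<in> D")
  case False
  then have "orb F U \<inter> D = {}" using orb_disjoint[OF fo] assms(1) by blast
  then show ?thesis using False assms(2) unfolding replace_orb_def by auto
qed (use assms(2) in \<open>auto simp: replace_orb_def\<close>)

lemma replace_orb_inverse:
  assumes "\<And>x. x \<in> Q \<Longrightarrow> F x \<in> Q" "orb F V \<inter> Q = {}"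
  shows "replace_orb F V U (replace_orb F U V Q) = Q"
proof (cases "U \<in> Q")
  case True
  have "orb F U \<subseteq> Q" by (rule orb_subset) (use True assms(1) in auto)
  then show ?thesis using True assms(2) unfolding replace_orb_def by auto
next
  case False
  moreover have "V \<notin> Q" using assms(2) orb_self[of V F] by blast
  ultimately show ?thesis unfolding replace_orb_def by simp
qed

lemma period_count_replace_orb:
  assumes "\<And>x. x \<in> Q \<Longrightarrow> F x \<in> Q" "orb F V \<inter> Q = {}" "finite Q" "least_power F V = least_power F U"
  shows "period_count F (replace_orb F U V Q) i = period_count F Q i"
proof (cases "U \<in> Q")
  case True
  have sub: "orb F U \<subseteq> Q" by (rule orb_subset) (use True assms(1) in auto)
  have "period_count F (replace_orb F U V Q) i = period_count F (Q - orb F U) i + period_count F (orb F V) i"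
    unfolding replace_orb_def using True assms(2,3)
    by (auto simp: finite_orb[OF fo] intro!: period_count_Un_disjoint)
  also have "\<dots> = period_count F (Q - orb F U) i + period_count F (orb F U) i" by (simp add: period_count_orb[OF fo] assms(4))
  also have "\<dots> = period_count F (Q - orb F U \<union> orb F U) i"
    using assms(3) by (intro period_count_Un_disjoint[symmetric]) (auto simp: finite_orb[OF fo])
  also have "Q - orb F U \<union> orb F U = Q" using sub by blast
  finally show ?thesis .
qed (simp add: replace_orb_def)

end

lemma orb_image_iff: "B \<in> orb (image f) V \<longleftrightarrow> (\<exists>j. B = (f ^^ j) ` V)" for f :: "'a \<Rightarrow> 'a"
  unfolding orb_def by (auto simp: funpow_image)

text \<open>By injectivity, two translates of \<open>V\<close> that meet can be pulled back to
  \<open>V\<close> and one translate that meets it, so a condition on overlaps with \<open>V\<close>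
  itself controls all pairs.\<close>

lemma partition_on_orb_image:
  assumes fo: "fin_ord f" and ne: "V \<noteq> {}"
    and V: "\<And>j. (f ^^ j) ` V \<inter> V \<noteq> {} \<Longrightarrow> (f ^^ j) ` V = V"
  shows "partition_on (\<Union>(orb (image f) V)) (orb (image f) V)"
proof (rule partition_onI)
  have eq: "(f ^^ i) ` V = (f ^^ j) ` V" if "(f ^^ i) ` V \<inter> (f ^^ j) ` V \<noteq> {}" "i \<le> j" for i j
  proof -
    have split: "(f ^^ j) ` V = (f ^^ i) ` (f ^^ (j - i)) ` V"
      using that(2) by (metis funpow_add image_comp le_add_diff_inverse)
    then have "(f ^^ i) ` (V \<inter> (f ^^ (j - i)) ` V) \<noteq> {}"
      using that(1) fin_ord_inj_funpow[OF fo, of i] by (simp add: image_Int)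
    then have "(f ^^ (j - i)) ` V = V" by (intro V) auto
    then show ?thesis using split by simp
  qed
  fix p q assume "p \<in> orb (image f) V" "q \<in> orb (image f) V" "p \<noteq> q"
  then obtain i j where ij: "p = (f ^^ i) ` V" "q = (f ^^ j) ` V" by (auto simp: orb_image_iff)
  show "disjnt p q"
  proof (rule ccontr)
    assume "\<not> disjnt p q"
    then have "(f ^^ i) ` V \<inter> (f ^^ j) ` V \<noteq> {}" "(f ^^ j) ` V \<inter> (f ^^ i) ` V \<noteq> {}"
      unfolding ij disjnt_def by auto
    then have "p = q" unfolding ij using eq[of i j] eq[of j i] linear[of i j] by metis
    then show False using \<open>p \<noteq> q\<close> by simp
  qed
qed (use ne in \<open>auto simp: orb_image_iff\<close>)

text \<open>Blocks are permuted by \<open>f\<close>, so a point returns to its block exactly when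
  the block returns to itself, whichever point of the block is taken.\<close>

lemma inv_partition_block_period:
  assumes fo: "fin_ord f" and P: "partition_on U P" and cl: "\<And>B. B \<in> P \<Longrightarrow> f ` B \<in> P"
    and N: "N \<in> P" "x \<in> N"
  shows "(f ^^ j) x \<in> N \<longleftrightarrow> least_power (image f) N dvd j"
proof -
  have "(image f ^^ j) N \<in> P" by (rule funpow_closed) (use cl N in auto)
  then have in_P: "(f ^^ j) ` N \<in> P" by (simp add: funpow_image)
  have "(f ^^ j) x \<in> N \<longleftrightarrow> (f ^^ j) ` N = N"
    using partition_on_unique[OF P in_P N(1), of "(f ^^ j) x"] N(2) by blast
  then show ?thesis by (simp add: least_power_dvd_iff[OF fin_ord_image[OF fo]] funpow_image)
qed

lemma sub_orb_subset: "sub_orb f c i \<subseteq> orb f c"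
  unfolding sub_orb_def by auto

lemma in_sub_orb: "c \<in> sub_orb f c i"
  unfolding sub_orb_def by (rule image_eqI[of _ _ 0]) auto

section \<open>Inserting one cycle into an invariant pair\<close>

context
  fixes f :: "'a \<Rightarrow> 'a" and S :: "'a set" and c :: 'a
  assumes fo: "fin_ord f" and finS: "finite S" and clS: "\<And>x. x \<in> S \<Longrightarrow> f x \<in> S" and cS: "c \<notin> S"
begin

lemma orb_Int_empty: "orb f c \<inter> S = {}" by (rule orb_disjoint[OF fo clS cS])

lemma funpow_image_eq:
  assumes "finite A" "\<And>x. x \<in> A \<Longrightarrow> f x \<in> A"
  shows "(f ^^ j) ` A = A"
proof (rule endo_inj_surj[OF assms(1)])
  show "(f ^^ j) ` A \<subseteq> A"
  proof
    fix y assume "y \<in> (f ^^ j) ` A"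
    then obtain x where x: "x \<in> A" "y = (f ^^ j) x" by auto
    show "y \<in> A" unfolding x(2) by (rule funpow_closed) (use assms(2) x(1) in auto)
  qed
  show "inj_on (f ^^ j) A" using fin_ord_inj_funpow[OF fo] by (rule inj_on_subset) simp
qed

lemma funpow_image_orb: "(f ^^ j) ` orb f c = orb f c"
  by (rule funpow_image_eq) (auto simp: finite_orb[OF fo] intro: orb_closed)

lemma funpow_image_invariant: "(f ^^ j) ` S = S"
  by (rule funpow_image_eq) (auto simp: finS clS)

lemma funpow_in_sub_orb:
  assumes "i dvd least_power f c"
  shows "(f ^^ j) c \<in> sub_orb f c i \<longleftrightarrow> i dvd j"
proof
  assume "(f ^^ j) c \<in> sub_orb f c i"
  then obtain l where "(f ^^ j) c = (f ^^ (i * l)) c" unfolding sub_orb_def by auto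
  then have "j mod least_power f c = (i * l) mod least_power f c"
    by (simp add: funpow_eq_iff_mod[OF fo])
  then have "j mod i = (i * l) mod i" using assms by (metis mod_mod_cancel)
  then show "i dvd j" by (simp add: dvd_eq_mod_eq_0)
qed (auto simp: sub_orb_def)

lemma funpow_image_sub_orb_iff:
  assumes "i dvd least_power f c"
  shows "(f ^^ j) ` sub_orb f c i = sub_orb f c i \<longleftrightarrow> i dvd j"
proof
  assume "(f ^^ j) ` sub_orb f c i = sub_orb f c i"
  then have "(f ^^ j) c \<in> sub_orb f c i" using in_sub_orb[of c f i] by blast
  then show "i dvd j" by (simp add: funpow_in_sub_orb[OF assms])
next
  assume "i dvd j"
  then obtain q where q: "j = i * q" by blast
  show "(f ^^ j) ` sub_orb f c i = sub_orb f c i"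
  proof (rule endo_inj_surj)
    show "finite (sub_orb f c i)" using sub_orb_subset finite_orb[OF fo] by (rule finite_subset)
    show "inj_on (f ^^ j) (sub_orb f c i)" using fin_ord_inj_funpow[OF fo] by (rule inj_on_subset) simp
    show "(f ^^ j) ` sub_orb f c i \<subseteq> sub_orb f c i"
    proof
      fix y assume "y \<in> (f ^^ j) ` sub_orb f c i"
      then obtain l where "y = (f ^^ j) ((f ^^ (i * l)) c)" unfolding sub_orb_def by auto
      then have "y = (f ^^ (i * (q + l))) c" by (simp add: q funpow_add distrib_left)
      then show "y \<in> sub_orb f c i" unfolding sub_orb_def by blast
    qed
  qed
qed

lemma sub_orb_meets:
  assumes "i dvd least_power f c" "(f ^^ j) ` sub_orb f c i \<inter> sub_orb f c i \<noteq> {}"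
  shows "i dvd j"
proof -
  from assms(2) obtain l where "(f ^^ j) ((f ^^ (i * l)) c) \<in> sub_orb f c i" unfolding sub_orb_def by auto
  then have "(f ^^ (j + i * l)) c \<in> sub_orb f c i" by (simp add: funpow_add)
  then have "i dvd j + i * l" by (simp only: funpow_in_sub_orb[OF assms(1)])
  then show ?thesis by (simp add: dvd_add_left_iff)
qed

lemma least_power_sub_orb:
  assumes "i dvd least_power f c"
  shows "least_power (image f) (sub_orb f c i) = i"
proof -
  have "least_power (image f) (sub_orb f c i) dvd j \<longleftrightarrow> i dvd j" for j
    by (simp add: least_power_dvd_iff[OF fin_ord_image[OF fo]] funpow_image funpow_image_sub_orb_iff[OF assms])
  then show ?thesis by (meson dvd_antisym dvd_refl)
qed

lemma Union_orb_sub_orb: "\<Union>(orb (image f) (sub_orb f c i)) = orb f c"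
proof
  show "\<Union>(orb (image f) (sub_orb f c i)) \<subseteq> orb f c"
  proof
    fix x assume "x \<in> \<Union>(orb (image f) (sub_orb f c i))"
    then obtain B where "x \<in> B" "B \<in> orb (image f) (sub_orb f c i)" by blast
    then obtain j where "x \<in> (f ^^ j) ` sub_orb f c i" unfolding orb_image_iff by blast
    then show "x \<in> orb f c" using sub_orb_subset[of f c i] funpow_image_orb[of j] by blast
  qed
  show "orb f c \<subseteq> \<Union>(orb (image f) (sub_orb f c i))"
  proof
    fix x assume "x \<in> orb f c"
    then obtain j where "x = (f ^^ j) c" unfolding orb_def by auto
    then have "x \<in> (f ^^ j) ` sub_orb f c i" using in_sub_orb[of c f i] by simp
    then show "x \<in> \<Union>(orb (image f) (sub_orb f c i))" using orb_image_iff by blast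
  qed
qed

text \<open>The return times of \<open>c\<close> to its block are the multiples of the period of the
  block, so the block takes regularly spaced points of the cycle. The return of \<open>c\<close> to
  itself after a full cycle gives the divisibility.\<close>

lemma block_meets_orb:
  assumes P: "(P, D) \<in> inv_parts f (orb f c \<union> S)" and N: "N \<in> P" "c \<in> N"
  shows "N \<inter> orb f c = sub_orb f c (least_power (image f) N)" "least_power (image f) N dvd least_power f c"
proof -
  have iff: "(f ^^ j) c \<in> N \<longleftrightarrow> least_power (image f) N dvd j" for j
    by (rule inv_partition_block_period[OF fo]) (use inv_partsD[OF P] N in auto)
  show dvd: "least_power (image f) N dvd least_power f c"
    using iff[of "least_power f c"] N(2) funpow_least_power[OF fo] by simp
  show "N \<inter> orb f c = sub_orb f c (least_power (image f) N)"
  proof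
    show "N \<inter> orb f c \<subseteq> sub_orb f c (least_power (image f) N)"
    proof
      fix x assume x: "x \<in> N \<inter> orb f c"
      then obtain j where "x = (f ^^ j) c" unfolding orb_def by auto
      then show "x \<in> sub_orb f c (least_power (image f) N)"
        using x iff[of j] funpow_in_sub_orb[OF dvd, of j] by simp
    qed
    show "sub_orb f c (least_power (image f) N) \<subseteq> N \<inter> orb f c"
      using iff sub_orb_subset unfolding sub_orb_def by auto
  qed
qed

lemma orb_notin:
  assumes "c \<in> V" "partition_on S P"
  shows "orb (image f) V \<inter> P = {}"
proof (rule ccontr)
  assume "orb (image f) V \<inter> P \<noteq> {}"
  then obtain j where "(f ^^ j) ` V \<in> P" by (auto simp: orb_image_iff)
  then have "(f ^^ j) c \<in> S" using assms partition_onD1[OF assms(2)] by blast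
  then show False using orb_Int_empty funpow_in_orb[of j f c] by blast
qed

lemma block_of_orbit_point:
  assumes "partition_on (orb f c \<union> S) P"
  shows "block_of c P \<in> P" "c \<in> block_of c P"
proof -
  have "c \<in> \<Union>P" using partition_onD1[OF assms] orb_self[of c f] by blast
  then obtain N where "N \<in> P" "c \<in> N" by blast
  then show "block_of c P \<in> P" "c \<in> block_of c P" using block_of_eq[OF assms] by auto
qed

lemma inv_parts_new_orbit:
  assumes PD: "(P, D) \<in> inv_parts f S" and i: "i dvd least_power f c"
  defines "R \<equiv> orb (image f) (sub_orb f c i)"
  shows "(P \<union> R, if b then D \<union> R else D) \<in> inv_parts f (orb f c \<union> S)"
proof (rule inv_partsI)
  note p = inv_partsD[OF PD]
  have "partition_on (\<Union>R) R"
    unfolding R_def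
  proof (rule partition_on_orb_image[OF fo])
    show "sub_orb f c i \<noteq> {}" using in_sub_orb[of c f i] by blast
    show "(f ^^ j) ` sub_orb f c i = sub_orb f c i" if "(f ^^ j) ` sub_orb f c i \<inter> sub_orb f c i \<noteq> {}" for j
      using sub_orb_meets[OF i that] by (simp add: funpow_image_sub_orb_iff[OF i])
  qed
  then have "partition_on (orb f c) R" unfolding R_def by (simp add: Union_orb_sub_orb)
  then have "partition_on (orb f c \<union> S) (R \<union> P)" using p(1) orb_Int_empty by (rule partition_on_Un)
  then show "partition_on (orb f c \<union> S) (P \<union> R)" by (simp add: Un_commute)
  show "(if b then D \<union> R else D) \<subseteq> P \<union> R" using p(2) by auto
  have R: "f ` B \<in> R" if "B \<in> R" for B using that unfolding R_def by (rule orb_closed)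
  show "f ` B \<in> P \<union> R" if "B \<in> P \<union> R" for B using that p(3) R by blast
  show "f ` B \<in> (if b then D \<union> R else D)" if "B \<in> (if b then D \<union> R else D)" for B
    using that p(4) R by (auto split: if_splits)
qed

text \<open>Here the block of \<open>c\<close> lies in the cycle, hence its whole orbit does and can
  be removed from \<open>P\<close> and \<open>D\<close>. It suffices to remember the period
  \<open>i\<close> of that orbit and whether it was distinguished, since by
  \<open>block_meets_orb\<close> the period determines the removed blocks. The weight \<Phi> is kept
  arbitrary so that the identity can be iterated.\<close>

lemma sum_new_orbit:
  fixes \<Phi> :: "(nat \<Rightarrow> nat) \<Rightarrow> (nat \<Rightarrow> nat) \<Rightarrow> 'r::comm_monoid_add"
  shows "(\<Sum>(P, D) | (P, D) \<in> inv_parts f (orb f c \<union> S) \<and> block_of c P \<subseteq> orb f c.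
      \<Phi> (period_count (image f) D) (period_count (image f) P))
    = (\<Sum>((P, D), i, b) \<in> inv_parts f S \<times> {i. i dvd least_power f c} \<times> UNIV.
      \<Phi> (\<lambda>j. period_count (image f) D j + (if b \<and> j = i then i else 0))
        (\<lambda>j. period_count (image f) P j + (if j = i then i else 0)))"
proof -
  define A where "A = {(P, D). (P, D) \<in> inv_parts f (orb f c \<union> S) \<and> block_of c P \<subseteq> orb f c}"
  define T where "T = inv_parts f S \<times> {i. i dvd least_power f c} \<times> (UNIV :: bool set)"
  define to where "to = (\<lambda>(P, D). ((P - orb (image f) (block_of c P), D - orb (image f) (block_of c P)),
        least_power (image f) (block_of c P), block_of c P \<in> D))"
  define fro where "fro = (\<lambda>((P, D), i, b). (P \<union> orb (image f) (sub_orb f c i),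
        if b then D \<union> orb (image f) (sub_orb f c i) else D))"
  define G where "G = (\<lambda>(P, D). \<Phi> (period_count (image f) D) (period_count (image f) P))"
  define H where "H = (\<lambda>((P, D), i, b). \<Phi> (\<lambda>j. period_count (image f) D j + (if b \<and> j = i then i else 0))
        (\<lambda>j. period_count (image f) P j + (if j = i then i else 0)))"
  have 1: "fro (to (P, D)) = (P, D) \<and> to (P, D) \<in> T \<and> H (to (P, D)) = G (P, D)"
    if PD: "(P, D) \<in> inv_parts f (orb f c \<union> S)" and sub: "block_of c P \<subseteq> orb f c" for P D
  proof -
  note p = inv_partsD[OF PD]
  let ?N = "block_of c P" let ?O = "orb (image f) ?N"
  note N = block_of_orbit_point[OF p(1)]
  have eqN: "sub_orb f c (least_power (image f) ?N) = ?N"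
    using block_meets_orb(1)[OF PD N] sub by blast
  have OP: "?O \<subseteq> P" by (rule orb_subset) (use p(3) N in auto)
  \<comment> \<open>\<open>D\<close> is closed under the action, so it contains the orbit of
    \<open>?N\<close> entirely or not at all; this is why a single Boolean is enough.\<close>
  have OD: "?O \<subseteq> D" if "?N \<in> D" by (rule orb_subset) (use p(4) that in auto)
  have OD': "?O \<inter> D = {}" if "?N \<notin> D" by (rule orb_disjoint[OF fin_ord_image[OF fo]]) (use p(4) that in auto)
  have restore: "(P - ?O \<union> orb (image f) (sub_orb f c (least_power (image f) ?N)),
      if ?N \<in> D then D - ?O \<union> orb (image f) (sub_orb f c (least_power (image f) ?N)) else D - ?O) = (P, D)"
    unfolding eqN using OP OD OD' by auto
  have U: "\<Union>?O = orb f c" using Union_orb_sub_orb[of "least_power (image f) ?N"] unfolding eqN .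
  have "(P - ?O, D - ?O) \<in> inv_parts f S"
  proof (rule inv_partsI)
    have "orb f c \<union> S - \<Union>?O = S" using U orb_Int_empty by auto
    then show "partition_on S (P - ?O)" using partition_on_Diff[OF p(1) OP] by simp
    show "D - ?O \<subseteq> P - ?O" using p(2) by blast
    show "f ` B \<in> P - ?O" if "B \<in> P - ?O" for B
      using Diff_orb_closed[OF fin_ord_image[OF fo], of P B ?N] that p(3) by blast
    show "f ` B \<in> D - ?O" if "B \<in> D - ?O" for B
      using Diff_orb_closed[OF fin_ord_image[OF fo], of D B ?N] that p(4) by blast
  qed
  then have mem: "((P - ?O, D - ?O), least_power (image f) ?N, ?N \<in> D)
      \<in> inv_parts f S \<times> {i. i dvd least_power f c} \<times> UNIV"
    using block_meets_orb(2)[OF PD N] by simp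
  have fin: "finite P" "finite D"
    using finite_elements[OF _ p(1)] p(2) finS finite_orb[OF fo] finite_subset by auto
  have split: "period_count (image f) Q j = period_count (image f) (Q - ?O) j + (if ?N \<in> Q \<and> j = least_power (image f) ?N then j else 0)"
    if "finite Q" "\<And>B. B \<in> Q \<Longrightarrow> f ` B \<in> Q" for Q j
  proof (cases "?N \<in> Q")
    case True
    then have sub: "?O \<subseteq> Q" using that(2) orb_subset[of Q "image f" ?N] by blast
    have "period_count (image f) (Q - ?O \<union> ?O) j = period_count (image f) (Q - ?O) j + period_count (image f) ?O j"
      by (rule period_count_Un_disjoint) (use that(1) finite_orb[OF fin_ord_image[OF fo]] in auto)
    moreover have "Q - ?O \<union> ?O = Q" using sub by blast
    ultimately show ?thesis using True by (simp add: period_count_orb[OF fin_ord_image[OF fo]])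
  next
    case False
    then have "?O \<inter> Q = {}" using orb_disjoint[OF fin_ord_image[OF fo], of Q ?N] that(2) by blast
    then have "Q - ?O = Q" by blast
    then show ?thesis using False by simp
  qed
  have "period_count (image f) D = (\<lambda>j. period_count (image f) (D - ?O) j
      + (if ?N \<in> D \<and> j = least_power (image f) ?N then least_power (image f) ?N else 0))"
    using split[of D] fin(2) p(4) by (auto simp: fun_eq_iff)
  moreover have "period_count (image f) P = (\<lambda>j. period_count (image f) (P - ?O) j
      + (if j = least_power (image f) ?N then least_power (image f) ?N else 0))"
    using split[of P] fin(1) p(3) N(1) by (auto simp: fun_eq_iff)
  ultimately have "H (to (P, D)) = G (P, D)" unfolding H_def to_def G_def by simp
  then show ?thesis using restore mem by (simp add: fro_def to_def T_def)
  qed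
  have 2: "to (fro ((P, D), i, b)) = ((P, D), i, b) \<and> fro ((P, D), i, b) \<in> A"
    if PD: "(P, D) \<in> inv_parts f S" and i: "i dvd least_power f c" for P D i b
  proof -
  note p = inv_partsD[OF PD]
  let ?O = "orb (image f) (sub_orb f c i)"
  have new: "(P \<union> ?O, if b then D \<union> ?O else D) \<in> inv_parts f (orb f c \<union> S)"
    by (rule inv_parts_new_orbit[OF PD i])
  have N: "block_of c (P \<union> ?O) = sub_orb f c i"
    by (rule block_of_eq[OF inv_partsD(1)[OF new]]) (auto simp: in_sub_orb)
  have dis: "?O \<inter> P = {}" by (rule orb_notin[OF in_sub_orb p(1)])
  have mem: "(P \<union> ?O, if b then D \<union> ?O else D) \<in> inv_parts f (orb f c \<union> S) \<and> block_of c (P \<union> ?O) \<subseteq> orb f c"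
    using new N sub_orb_subset by simp
  have "sub_orb f c i \<in> (if b then D \<union> ?O else D) \<longleftrightarrow> b"
  proof -
    have "sub_orb f c i \<notin> D" using dis p(2) orb_self[of "sub_orb f c i" "image f"] by blast
    then show ?thesis by simp
  qed
  moreover have "P \<union> ?O - ?O = P" "(if b then D \<union> ?O else D) - ?O = D" using dis p(2) by auto
  ultimately show ?thesis using mem by (simp add: fro_def to_def A_def N least_power_sub_orb[OF i])
  qed
  have "sum G A = sum H T"
  proof (rule sum.reindex_bij_witness[where i = fro and j = to])
    show "fro (to x) = x" "to x \<in> T" "H (to x) = G x" if "x \<in> A" for x
    proof -
      obtain P D where x: "x = (P, D)" by (cases x)
      show "fro (to x) = x" "to x \<in> T" "H (to x) = G x"
        using 1[of P D] that unfolding A_def x by simp_all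
    qed
    show "to (fro y) = y" "fro y \<in> A" if "y \<in> T" for y
    proof -
      obtain P D i b where y: "y = ((P, D), i, b)" by (metis prod.exhaust)
      show "to (fro y) = y" "fro y \<in> A"
        using 2[of P D i b] that unfolding T_def y by simp_all
    qed
  qed
  then show ?thesis unfolding A_def T_def G_def H_def .
qed

lemma least_power_eq_blockI:
  assumes "\<And>j. (f ^^ j) ` U = U \<longleftrightarrow> (f ^^ j) ` V = V"
  shows "least_power (image f) U = least_power (image f) V"
  unfolding least_power_def funpow_image using assms by simp

lemma partition_on_replace_orb:
  assumes P: "partition_on T P" "U \<in> P" "\<And>B. B \<in> P \<Longrightarrow> f ` B \<in> P"
    and V: "V \<noteq> {}" "\<And>j. (f ^^ j) ` V \<inter> V \<noteq> {} \<Longrightarrow> (f ^^ j) ` V = V"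
    and dis: "\<Union>(orb (image f) V) \<inter> (T - \<Union>(orb (image f) U)) = {}"
  shows "partition_on (T - \<Union>(orb (image f) U) \<union> \<Union>(orb (image f) V)) (replace_orb (image f) U V P)"
proof -
  have "orb (image f) U \<subseteq> P" by (rule orb_subset) (use P in auto)
  then have "partition_on (T - \<Union>(orb (image f) U)) (P - orb (image f) U)"
    by (rule partition_on_Diff[OF P(1)])
  moreover have "partition_on (\<Union>(orb (image f) V)) (orb (image f) V)"
    by (rule partition_on_orb_image[OF fo V])
  moreover have "(T - \<Union>(orb (image f) U)) \<inter> \<Union>(orb (image f) V) = {}"
    using dis by blast
  ultimately have "partition_on (T - \<Union>(orb (image f) U) \<union> \<Union>(orb (image f) V))
      (P - orb (image f) U \<union> orb (image f) V)" by (rule partition_on_Un)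
  then show ?thesis using P(2) by (simp add: replace_orb_def)
qed

lemma inv_parts_replace_orb:
  assumes PD: "(P, D) \<in> inv_parts f T" and part: "partition_on T' (replace_orb (image f) U V P)"
  shows "(replace_orb (image f) U V P, replace_orb (image f) U V D) \<in> inv_parts f T'"
proof (rule inv_partsI[OF part])
  note p = inv_partsD[OF PD]
  show "replace_orb (image f) U V D \<subseteq> replace_orb (image f) U V P"
    by (rule replace_orb_mono[OF fin_ord_image[OF fo]]) (use p in auto)
  show "f ` B \<in> replace_orb (image f) U V P" if "B \<in> replace_orb (image f) U V P" for B
    by (rule replace_orb_closed[OF fin_ord_image[OF fo]]) (use p that in auto)
  show "f ` B \<in> replace_orb (image f) U V D" if "B \<in> replace_orb (image f) U V D" for B
    by (rule replace_orb_closed[OF fin_ord_image[OF fo]]) (use p that in auto)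
qed

text \<open>Here the block of \<open>c\<close> has old points too. Deleting the cycle from all
  blocks leaves blocks of unchanged period, so the counts stay the same. Conversely, an old block
  \<open>B\<close> whose period \<open>i\<close> divides the length of the cycle can receive
  \<open>c\<close>; it must then receive every \<open>i\<close>-th point, and the other points go to
  the translates of \<open>B\<close>. Different blocks of one orbit give different results, so the
  index runs over blocks and not over orbits.\<close>

lemma sum_attached_orbit:
  fixes \<Phi> :: "(nat \<Rightarrow> nat) \<Rightarrow> (nat \<Rightarrow> nat) \<Rightarrow> 'r::comm_monoid_add"
  shows "(\<Sum>(P, D) | (P, D) \<in> inv_parts f (orb f c \<union> S) \<and> \<not> block_of c P \<subseteq> orb f c.
      \<Phi> (period_count (image f) D) (period_count (image f) P))
    = (\<Sum>((P, D), B) \<in> Sigma (inv_parts f S) (\<lambda>(P, D). {B \<in> P. least_power (image f) B dvd least_power f c}).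
      \<Phi> (period_count (image f) D) (period_count (image f) P))"
proof -
  define A where "A = {(P, D). (P, D) \<in> inv_parts f (orb f c \<union> S) \<and> \<not> block_of c P \<subseteq> orb f c}"
  define T where "T = Sigma (inv_parts f S) (\<lambda>(P, D). {B \<in> P. least_power (image f) B dvd least_power f c})"
  define to where "to = (\<lambda>(P, D). ((replace_orb (image f) (block_of c P) (block_of c P - orb f c) P,
      replace_orb (image f) (block_of c P) (block_of c P - orb f c) D), block_of c P - orb f c))"
  define ext where "ext B = B \<union> sub_orb f c (least_power (image f) B)" for B
  define fro where "fro = (\<lambda>((P, D), B). (replace_orb (image f) B (ext B) P,
      replace_orb (image f) B (ext B) D))"
  define G where "G = (\<lambda>(P, D). \<Phi> (period_count (image f) D) (period_count (image f) P))"
  define H where "H = (\<lambda>((P, D), B :: 'a set). \<Phi> (period_count (image f) D) (period_count (image f) P))"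
  have 1: "fro (to (P, D)) = (P, D) \<and> to (P, D) \<in> T \<and> H (to (P, D)) = G (P, D)"
    if PD: "(P, D) \<in> inv_parts f (orb f c \<union> S)" and nsub: "\<not> block_of c P \<subseteq> orb f c" for P D
  proof -
    note p = inv_partsD[OF PD]
    define N where "N = block_of c P"
    have N: "N \<in> P" "c \<in> N" using block_of_orbit_point[OF p(1)] by (auto simp: N_def)
    define V where "V = N - orb f c"
    have Vne: "V \<noteq> {}" using nsub by (auto simp: V_def N_def)
    have img: "(f ^^ j) ` V = (f ^^ j) ` N - orb f c" for j
      unfolding V_def using fin_ord_inj_funpow[OF fo, of j] funpow_image_orb[of j] by (simp add: image_set_diff)
    have inP: "(f ^^ j) ` N \<in> P" for j
      using funpow_closed[of P "image f" N j] p(3) N(1) by (simp add: funpow_image)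
    have meets: "(f ^^ j) ` N = N" if "(f ^^ j) ` V \<inter> V \<noteq> {}" for j
    proof -
      from that obtain x where "x \<in> (f ^^ j) ` N" "x \<in> N" unfolding img V_def by blast
      then show ?thesis using partition_on_unique[OF p(1) inP N(1)] by blast
    qed
    have VV: "(f ^^ j) ` V = V" if "(f ^^ j) ` N = N" for j
      unfolding img that by (simp add: V_def)
    \<comment> \<open>Every power of \<open>f\<close> preserves the cycle, so a power that fixes
      \<open>N\<close> fixes \<open>V\<close>. Conversely, a power that fixes the nonempty set
      \<open>V\<close> makes \<open>N\<close> overlap its translate, so it fixes
      \<open>N\<close>.\<close>
    have lpV: "least_power (image f) V = least_power (image f) N"
    proof (rule least_power_eq_blockI)
      show "(f ^^ j) ` V = V \<longleftrightarrow> (f ^^ j) ` N = N" for j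
        using meets[of j] VV[of j] Vne by blast
    qed
    \<comment> \<open>A translate of \<open>V\<close> belonging to \<open>P\<close> would coincide
      with the corresponding translate of \<open>N\<close>, which contains a point of the
      cycle.\<close>
    have dis: "orb (image f) V \<inter> P = {}"
    proof (rule ccontr)
      assume "orb (image f) V \<inter> P \<noteq> {}"
      then obtain j where j: "(f ^^ j) ` V \<in> P" by (auto simp: orb_image_iff)
      obtain x where "x \<in> V" using Vne by blast
      then have "(f ^^ j) x \<in> (f ^^ j) ` V" "(f ^^ j) x \<in> (f ^^ j) ` N" unfolding V_def by auto
      then have "(f ^^ j) ` V = (f ^^ j) ` N" using partition_on_unique[OF p(1) j inP] by blast
      moreover have "(f ^^ j) c \<in> (f ^^ j) ` N" using N(2) by blast
      ultimately have "(f ^^ j) c \<notin> orb f c" unfolding img by blast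
      then show False by simp
    qed
    have UV: "\<Union>(orb (image f) V) = \<Union>(orb (image f) N) - orb f c"
    proof -
      have "orb (image f) X = range (\<lambda>j. (f ^^ j) ` X)" for X unfolding orb_def funpow_image ..
      then show ?thesis by (auto simp: img)
    qed
    have CN: "orb f c \<subseteq> \<Union>(orb (image f) N)"
    proof
      fix x assume "x \<in> orb f c"
      then obtain j where "x = (f ^^ j) c" unfolding orb_def by auto
      then have "x \<in> (f ^^ j) ` N" using N(2) by simp
      then show "x \<in> \<Union>(orb (image f) N)" using orb_image_iff by blast
    qed
    have NT: "\<Union>(orb (image f) N) \<subseteq> orb f c \<union> S"
    proof -
      have "orb (image f) N \<subseteq> P" by (rule orb_subset) (use p(3) N in auto)
      then show ?thesis using partition_onD1[OF p(1)] by blast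
    qed
    have "partition_on (orb f c \<union> S - \<Union>(orb (image f) N) \<union> \<Union>(orb (image f) V))
        (replace_orb (image f) N V P)"
    proof (rule partition_on_replace_orb)
      show "(f ^^ j) ` V = V" if "(f ^^ j) ` V \<inter> V \<noteq> {}" for j using meets[OF that] by (rule VV)
      show "\<Union>(orb (image f) V) \<inter> (orb f c \<union> S - \<Union>(orb (image f) N)) = {}" unfolding UV by blast
    qed (use p N Vne in auto)
    moreover have "orb f c \<union> S - \<Union>(orb (image f) N) \<union> \<Union>(orb (image f) V) = S"
      unfolding UV using CN NT orb_Int_empty by blast
    ultimately have "(replace_orb (image f) N V P, replace_orb (image f) N V D) \<in> inv_parts f S"
      by (intro inv_parts_replace_orb[OF PD]) simp
    moreover have "V \<in> replace_orb (image f) N V P" using N(1) by (simp add: replace_orb_def)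
    moreover have toPD: "to (P, D) = ((replace_orb (image f) N V P, replace_orb (image f) N V D), V)"
      by (simp add: to_def N_def V_def)
    ultimately have "to (P, D) \<in> T"
      using block_meets_orb(2)[OF PD N] lpV unfolding T_def by simp
    moreover have "ext V = N - orb f c \<union> N \<inter> orb f c"
      using block_meets_orb(1)[OF PD N] by (simp add: ext_def lpV) (simp add: V_def)
    then have "ext V = N" by blast
    then have "fro (to (P, D)) = (replace_orb (image f) V N (replace_orb (image f) N V P),
        replace_orb (image f) V N (replace_orb (image f) N V D))"
      by (simp add: toPD fro_def)
    moreover have "replace_orb (image f) V N (replace_orb (image f) N V P) = P"
      by (rule replace_orb_inverse[OF fin_ord_image[OF fo] p(3) dis])
    moreover have "replace_orb (image f) V N (replace_orb (image f) N V D) = D"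
      by (rule replace_orb_inverse[OF fin_ord_image[OF fo] p(4)]) (use dis p(2) in blast)+
    moreover have "period_count (image f) (replace_orb (image f) N V Q) = period_count (image f) Q" if "Q = P \<or> Q = D" for Q
    proof
      fix i
      have "finite P" using finite_elements[OF _ p(1)] finS finite_orb[OF fo] by auto
      then have "finite Q" "Q \<subseteq> P" using that p(2) finite_subset by auto
      then show "period_count (image f) (replace_orb (image f) N V Q) i = period_count (image f) Q i"
        using that p(3,4) dis lpV by (intro period_count_replace_orb[OF fin_ord_image[OF fo]]) auto
    qed
    then have "H (to (P, D)) = G (P, D)"
      unfolding toPD H_def G_def by simp
    ultimately show ?thesis by simp
  qed
  have 2: "to (fro ((P, D), B)) = ((P, D), B) \<and> fro ((P, D), B) \<in> A"
    if PD: "(P, D) \<in> inv_parts f S" and B: "B \<in> P" and dvd: "least_power (image f) B dvd least_power f c" for P D B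
  proof -
    note p = inv_partsD[OF PD]
    define i where "i = least_power (image f) B"
    define V where "V = ext B"
    have V: "V = B \<union> sub_orb f c i" by (simp add: V_def ext_def i_def)
    have cV: "c \<in> V" using in_sub_orb[of c f i] by (simp add: V)
    have BS: "B \<subseteq> S" using partition_onD1[OF p(1)] B by blast
    have Bne: "B \<noteq> {}" using partition_onD3[OF p(1)] B by blast
    have VB: "V - orb f c = B" using BS orb_Int_empty sub_orb_subset[of f c i] unfolding V by blast
    have dis: "orb (image f) V \<inter> P = {}" by (rule orb_notin[OF cV p(1)])
    have iff: "(f ^^ j) ` B = B \<longleftrightarrow> i dvd j" for j
      unfolding i_def by (simp add: least_power_dvd_iff[OF fin_ord_image[OF fo]] funpow_image)
    have inP: "(f ^^ j) ` B \<in> P" for j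
      using funpow_closed[of P "image f" B j] p(3) B by (simp add: funpow_image)
    have idvd: "i dvd least_power f c" using dvd by (simp add: i_def)
    have VV: "(f ^^ j) ` V = V" if "i dvd j" for j
      using that iff[of j] funpow_image_sub_orb_iff[OF idvd, of j] unfolding V by (simp add: image_Un)
    \<comment> \<open>The old part of \<open>V\<close> stays in \<open>S\<close> and the new part
      stays in the cycle, so an overlap must occur within one of the two parts; for either of them
      it forces \<open>i\<close> to divide \<open>j\<close>.\<close>
    have meets: "i dvd j" if "(f ^^ j) ` V \<inter> V \<noteq> {}" for j
    proof -
      have "(f ^^ j) ` B \<subseteq> S" using BS funpow_image_invariant[of j] by blast
      moreover have "(f ^^ j) ` sub_orb f c i \<subseteq> orb f c" using sub_orb_subset[of f c i] funpow_image_orb[of j] by blast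
      ultimately have "(f ^^ j) ` B \<inter> B \<noteq> {} \<or> (f ^^ j) ` sub_orb f c i \<inter> sub_orb f c i \<noteq> {}"
        using that BS orb_Int_empty sub_orb_subset[of f c i] unfolding V image_Un by blast
      then show ?thesis
      proof
        assume "(f ^^ j) ` B \<inter> B \<noteq> {}"
        then have "(f ^^ j) ` B = B" using partition_on_unique[OF p(1) inP B] by blast
        then show ?thesis using iff by simp
      qed (rule sub_orb_meets[OF idvd])
    qed
    have UV: "\<Union>(orb (image f) V) = \<Union>(orb (image f) B) \<union> orb f c"
    proof -
      have "orb (image f) X = range (\<lambda>j. (f ^^ j) ` X)" for X unfolding orb_def funpow_image ..
      then have "\<Union>(orb (image f) V) = \<Union>(orb (image f) B) \<union> \<Union>(orb (image f) (sub_orb f c i))"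
        by (simp add: V image_Un UN_Un_distrib)
      then show ?thesis by (simp only: Union_orb_sub_orb)
    qed
    have "partition_on (S - \<Union>(orb (image f) B) \<union> \<Union>(orb (image f) V)) (replace_orb (image f) B V P)"
    proof (rule partition_on_replace_orb)
      show "(f ^^ j) ` V = V" if "(f ^^ j) ` V \<inter> V \<noteq> {}" for j using meets[OF that] by (rule VV)
      show "\<Union>(orb (image f) V) \<inter> (S - \<Union>(orb (image f) B)) = {}" unfolding UV using orb_Int_empty by blast
    qed (use p B cV in auto)
    moreover have "S - \<Union>(orb (image f) B) \<union> \<Union>(orb (image f) V) = orb f c \<union> S"
    proof -
      have "orb (image f) B \<subseteq> P" by (rule orb_subset) (use p(3) B in auto)
      then show ?thesis unfolding UV using partition_onD1[OF p(1)] by blast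
    qed
    ultimately have part: "partition_on (orb f c \<union> S) (replace_orb (image f) B V P)" by simp
    then have new: "(replace_orb (image f) B V P, replace_orb (image f) B V D) \<in> inv_parts f (orb f c \<union> S)"
      by (rule inv_parts_replace_orb[OF PD])
    have "V \<in> replace_orb (image f) B V P" using B by (simp add: replace_orb_def)
    then have N: "block_of c (replace_orb (image f) B V P) = V" by (rule block_of_eq[OF part _ cV])
    have "\<not> V \<subseteq> orb f c" using VB Bne by blast
    moreover have froPD: "fro ((P, D), B) = (replace_orb (image f) B V P, replace_orb (image f) B V D)"
      by (simp add: fro_def V_def)
    ultimately have "fro ((P, D), B) \<in> A" using new N unfolding A_def by simp
    moreover have "replace_orb (image f) V B (replace_orb (image f) B V P) = P"
      by (rule replace_orb_inverse[OF fin_ord_image[OF fo] p(3) dis])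
    moreover have "replace_orb (image f) V B (replace_orb (image f) B V D) = D"
      by (rule replace_orb_inverse[OF fin_ord_image[OF fo] p(4)]) (use dis p(2) in blast)+
    ultimately show ?thesis unfolding froPD to_def by (simp add: N VB)
  qed
  have "sum G A = sum H T"
  proof (rule sum.reindex_bij_witness[where i = fro and j = to])
    show "fro (to x) = x" "to x \<in> T" "H (to x) = G x" if "x \<in> A" for x
    proof -
      obtain P D where x: "x = (P, D)" by (cases x)
      show "fro (to x) = x" "to x \<in> T" "H (to x) = G x"
        using 1[of P D] that unfolding A_def x by simp_all
    qed
    show "to (fro y) = y" "fro y \<in> A" if "y \<in> T" for y
    proof -
      obtain P D B where y: "y = ((P, D), B)" by (metis prod.exhaust)
      show "to (fro y) = y" "fro y \<in> A"
        using 2[of P D B] that unfolding T_def y by simp_all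
    qed
  qed
  then show ?thesis unfolding A_def T_def G_def H_def .
qed

text \<open>The three summands are a new distinguished orbit, a new undistinguished orbit, and
  attachment to one of the old blocks of period \<open>i\<close>.\<close>

lemma sum_inv_parts_insert_orbit:
  fixes \<Phi> :: "(nat \<Rightarrow> nat) \<Rightarrow> (nat \<Rightarrow> nat) \<Rightarrow> 'r::comm_semiring_1"
  shows "(\<Sum>(P, D)\<in>inv_parts f (orb f c \<union> S). \<Phi> (period_count (image f) D) (period_count (image f) P))
    = (\<Sum>i | i dvd least_power f c. \<Sum>(P, D)\<in>inv_parts f S.
        \<Phi> (\<lambda>j. period_count (image f) D j + (if j = i then i else 0)) (\<lambda>j. period_count (image f) P j + (if j = i then i else 0))
      + \<Phi> (period_count (image f) D) (\<lambda>j. period_count (image f) P j + (if j = i then i else 0))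
      + of_nat (period_count (image f) P i) * \<Phi> (period_count (image f) D) (period_count (image f) P))"
proof -
  let ?I = "inv_parts f (orb f c \<union> S)" and ?J = "inv_parts f S"
  let ?Di = "{i. i dvd least_power f c}"
  have finI: "finite ?I" using finS finite_orb[OF fo] by (intro finite_inv_parts) auto
  have finJ: "finite ?J" using finS by (rule finite_inv_parts)
  have finD: "finite ?Di" using least_power_pos[OF fo, of c] by simp
  have "(\<Sum>(P, D)\<in>?I. \<Phi> (period_count (image f) D) (period_count (image f) P))
    = (\<Sum>(P, D) | (P, D) \<in> ?I \<and> block_of c P \<subseteq> orb f c. \<Phi> (period_count (image f) D) (period_count (image f) P))
    + (\<Sum>(P, D) | (P, D) \<in> ?I \<and> \<not> block_of c P \<subseteq> orb f c. \<Phi> (period_count (image f) D) (period_count (image f) P))"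
  proof -
    have fin: "finite {(P, D). (P, D) \<in> ?I \<and> block_of c P \<subseteq> orb f c}"
      "finite {(P, D). (P, D) \<in> ?I \<and> \<not> block_of c P \<subseteq> orb f c}"
      using finI by (auto elim!: rev_finite_subset)
    have "?I = {(P, D). (P, D) \<in> ?I \<and> block_of c P \<subseteq> orb f c} \<union> {(P, D). (P, D) \<in> ?I \<and> \<not> block_of c P \<subseteq> orb f c}"
      by auto
    then have "sum g ?I = sum g ({(P, D). (P, D) \<in> ?I \<and> block_of c P \<subseteq> orb f c}
        \<union> {(P, D). (P, D) \<in> ?I \<and> \<not> block_of c P \<subseteq> orb f c})" for g :: "_ \<Rightarrow> 'r"
      by (rule arg_cong)
    then show ?thesis by (subst sum.union_disjoint[OF fin, symmetric]) auto
  qed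
  also have "(\<Sum>(P, D) | (P, D) \<in> ?I \<and> block_of c P \<subseteq> orb f c. \<Phi> (period_count (image f) D) (period_count (image f) P))
    = (\<Sum>(P, D)\<in>?J. \<Sum>i\<in>?Di. \<Phi> (\<lambda>j. period_count (image f) D j + (if j = i then i else 0)) (\<lambda>j. period_count (image f) P j + (if j = i then i else 0))
      + \<Phi> (period_count (image f) D) (\<lambda>j. period_count (image f) P j + (if j = i then i else 0)))"
  proof -
    have prod: "(\<Sum>((P, D), i, b)\<in>?J \<times> ?Di \<times> UNIV. g P D i b)
        = (\<Sum>(P, D)\<in>?J. \<Sum>i\<in>?Di. \<Sum>b\<in>UNIV. g P D i b)" for g :: "_ \<Rightarrow> _ \<Rightarrow> _ \<Rightarrow> bool \<Rightarrow> 'r"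
      by (simp add: sum.cartesian_product case_prod_unfold)
    show ?thesis unfolding sum_new_orbit prod by (simp add: UNIV_bool add.commute)
  qed
  also have "(\<Sum>(P, D) | (P, D) \<in> ?I \<and> \<not> block_of c P \<subseteq> orb f c. \<Phi> (period_count (image f) D) (period_count (image f) P))
    = (\<Sum>(P, D)\<in>?J. \<Sum>i\<in>?Di. of_nat (period_count (image f) P i) * \<Phi> (period_count (image f) D) (period_count (image f) P))"
  proof -
    have finP: "finite P" if "(P, D) \<in> ?J" for P D
      using finite_elements[OF finS inv_partsD(1)[OF that]] .
    have "(\<Sum>(P, D) | (P, D) \<in> ?I \<and> \<not> block_of c P \<subseteq> orb f c. \<Phi> (period_count (image f) D) (period_count (image f) P))
      = (\<Sum>x\<in>?J. \<Sum>B | B \<in> fst x \<and> least_power (image f) B dvd least_power f c.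
          \<Phi> (period_count (image f) (snd x)) (period_count (image f) (fst x)))"
      unfolding sum_attached_orbit
      by (subst sum.Sigma) (use finJ finP in \<open>auto simp: case_prod_unfold\<close>)
    also have "\<dots> = (\<Sum>x\<in>?J. \<Sum>i\<in>?Di. of_nat (period_count (image f) (fst x) i) *
          \<Phi> (period_count (image f) (snd x)) (period_count (image f) (fst x)))"
    proof (rule sum.cong[OF refl])
      fix x assume x: "x \<in> ?J"
      then have fin: "finite (fst x)" using finP[of "fst x" "snd x"] by simp
      \<comment> \<open>The blocks able to receive \<open>c\<close> are grouped by their period,
        which turns their number into a sum over the divisors.\<close>
      have "card {B. B \<in> fst x \<and> least_power (image f) B dvd least_power f c}
          = card (\<Union>i\<in>?Di. {B \<in> fst x. least_power (image f) B = i})"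
        by (rule arg_cong[where f = card]) blast
      also have "\<dots> = (\<Sum>i\<in>?Di. period_count (image f) (fst x) i)"
        unfolding period_count_def by (rule card_UN_disjoint) (use fin finD in auto)
      finally show "(\<Sum>B | B \<in> fst x \<and> least_power (image f) B dvd least_power f c.
          \<Phi> (period_count (image f) (snd x)) (period_count (image f) (fst x)))
        = (\<Sum>i\<in>?Di. of_nat (period_count (image f) (fst x) i) * \<Phi> (period_count (image f) (snd x)) (period_count (image f) (fst x)))"
        by (simp add: sum_distrib_right[symmetric])
    qed
    finally show ?thesis by (simp add: case_prod_unfold)
  qed
  finally show ?thesis
    by (subst sum.swap) (simp add: case_prod_unfold sum.distrib)
qed

end

text \<open>The transpose of the recursion for the numbers \<open>c\<close> of distinguished and \<open>u\<close> of all blocks of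
  period \<open>i\<close>; acting on weights instead of counts avoids truncated subtraction.\<close>
definition step_op :: "nat \<Rightarrow> (nat \<Rightarrow> nat \<Rightarrow> 'r::comm_semiring_1) \<Rightarrow> nat \<Rightarrow> nat \<Rightarrow> 'r" where
  "step_op i \<phi> c u = \<phi> (c + i) (u + i) + \<phi> c (u + i) + of_nat u * \<phi> c u"

text \<open>By Pascal's rule, replacing \<phi> by \<open>step_op i \<phi>\<close> replaces the inner
  binomial sum \<open>h t\<close> by \<open>h (Suc t) + i * t * h t\<close>; the recurrence of the
  Stirling numbers then advances \<open>M\<close>. The arguments are multiples of \<open>i\<close>
  because \<open>t\<close> orbits of size \<open>i\<close> have \<open>i * t\<close> blocks. The
  innermost operator is peeled off, which is why the induction keeps \<phi> arbitrary.\<close>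

lemma funpow_step_op:
  "(step_op i ^^ M) \<phi> 0 0
    = (\<Sum>t\<le>M. of_nat (Stirling M t * i ^ (M - t)) * (\<Sum>x\<le>t. of_nat (t choose x) * \<phi> (i * x) (i * t)))"
proof (induction M arbitrary: \<phi>)
  case 0
  then show ?case by simp
next
  case (Suc M)
  define h where "h t = (\<Sum>x\<le>t. of_nat (t choose x) * \<phi> (i * x) (i * t))" for t
  have inner: "(\<Sum>x\<le>t. of_nat (t choose x) * step_op i \<phi> (i * x) (i * t)) = h (Suc t) + of_nat (i * t) * h t" for t
  proof -
    have "h (Suc t) = (\<Sum>x\<le>t. of_nat (t choose x) * \<phi> (i * x + i) (i * t + i))
        + (\<Sum>x\<le>t. of_nat (t choose x) * \<phi> (i * x) (i * t + i))"
    proof -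
      have "h (Suc t) = of_nat 1 * \<phi> 0 (i * Suc t)
          + (\<Sum>x\<le>t. of_nat (Suc t choose Suc x) * \<phi> (i * Suc x) (i * Suc t))"
        unfolding h_def by (subst sum.atMost_Suc_shift) simp
      also have "(\<Sum>x\<le>t. of_nat (Suc t choose Suc x) * \<phi> (i * Suc x) (i * Suc t))
          = (\<Sum>x\<le>t. of_nat (t choose x) * \<phi> (i * Suc x) (i * Suc t))
            + (\<Sum>x\<le>t. of_nat (t choose Suc x) * \<phi> (i * Suc x) (i * Suc t))"
        by (simp add: sum.distrib[symmetric] distrib_right)
      also have "of_nat 1 * \<phi> 0 (i * Suc t) + (\<dots>)
          = (\<Sum>x\<le>t. of_nat (t choose x) * \<phi> (i * Suc x) (i * Suc t))
            + (\<Sum>x\<le>Suc t. of_nat (t choose x) * \<phi> (i * x) (i * Suc t))"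
        by (subst sum.atMost_Suc_shift) (simp add: add_ac)
      finally show ?thesis by (simp add: add_ac binomial_eq_0)
    qed
    then show ?thesis
      unfolding step_op_def h_def by (simp add: distrib_left sum.distrib sum_distrib_left mult_ac)
  qed
  have "(step_op i ^^ Suc M) \<phi> 0 0 = (step_op i ^^ M) (step_op i \<phi>) 0 0"
    by (simp add: funpow_swap1)
  also have "\<dots> = (\<Sum>t\<le>M. of_nat (Stirling M t * i ^ (M - t)) * (h (Suc t) + of_nat (i * t) * h t))"
    unfolding Suc.IH inner ..
  also have "\<dots> = (\<Sum>t\<le>M. of_nat (Stirling M t * i ^ (M - t)) * h (Suc t))
      + (\<Sum>t\<le>M. of_nat (t * Stirling M t * i ^ (Suc M - t)) * h t)"
    by (simp add: sum.distrib[symmetric] distrib_left Suc_diff_le mult_ac)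
  \<comment> \<open>The term \<open>t = Suc M\<close> can be added because
    \<open>Stirling M (Suc M)\<close> is 0. In the index shift that follows, the term
    \<open>t = 0\<close> disappears through the factor \<open>t\<close>.\<close>
  also have "(\<Sum>t\<le>M. of_nat (t * Stirling M t * i ^ (Suc M - t)) * h t)
      = (\<Sum>t\<le>Suc M. of_nat (t * Stirling M t * i ^ (Suc M - t)) * h t)"
    by simp
  also have "\<dots> = (\<Sum>t\<le>M. of_nat (Suc t * Stirling M (Suc t) * i ^ (M - t)) * h (Suc t))"
    by (subst sum.atMost_Suc_shift) simp
  also have "(\<Sum>t\<le>M. of_nat (Stirling M t * i ^ (M - t)) * h (Suc t)) + \<dots>
      = (\<Sum>t\<le>M. of_nat (Stirling (Suc M) (Suc t) * i ^ (Suc M - Suc t)) * h (Suc t))"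
    by (simp add: sum.distrib[symmetric] distrib_right distrib_left add_ac mult_ac)
  also have "\<dots> = (\<Sum>t\<le>Suc M. of_nat (Stirling (Suc M) t * i ^ (Suc M - t)) * h t)"
    by (subst sum.atMost_Suc_shift) simp
  finally show ?case unfolding h_def .
qed

lemma divisors_of_Cons:
  assumes "0 < a"
  shows "divisors_of (a # xs) = (\<lambda>(i, \<nu>). i # \<nu>) ` ({i. i dvd a} \<times> divisors_of xs)"
proof (intro set_eqI iffI)
  fix \<nu> assume "\<nu> \<in> divisors_of (a # xs)"
  then have len: "length \<nu> = Suc (length xs)"
    and dv: "\<And>j. j < Suc (length xs) \<Longrightarrow> 0 < \<nu> ! j \<and> \<nu> ! j dvd (a # xs) ! j"
    by (auto simp: divisors_of_def)
  then obtain i \<nu>' where \<nu>: "\<nu> = i # \<nu>'" "length \<nu>' = length xs" by (cases \<nu>) auto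
  have "i dvd a" using dv[of 0] by (simp add: \<nu>)
  moreover have "\<nu>' \<in> divisors_of xs" using dv[of "Suc _"] by (auto simp: divisors_of_def \<nu>)
  ultimately show "\<nu> \<in> (\<lambda>(i, \<nu>). i # \<nu>) ` ({i. i dvd a} \<times> divisors_of xs)" using \<nu> by auto
next
  fix \<nu> assume "\<nu> \<in> (\<lambda>(i, \<nu>). i # \<nu>) ` ({i. i dvd a} \<times> divisors_of xs)"
  then show "\<nu> \<in> divisors_of (a # xs)"
    using assms by (auto simp: divisors_of_def less_Suc_eq_0_disj intro: dvd_pos_nat)
qed

text \<open>A cycle whose blocks have period \<open>i\<close> affects the counts for
  \<open>i\<close> only, so it turns the factor \<open>\<phi> i\<close> into
  \<open>step_op i (\<phi> i)\<close> and leaves the others alone; hence the induction over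
  arbitrary \<phi>. Once all cycles are used up, only the empty pair is left, and every factor is
  evaluated at counts 0.\<close>

lemma sum_inv_parts_prod:
  fixes \<phi> :: "nat \<Rightarrow> nat \<Rightarrow> nat \<Rightarrow> 'r::comm_semiring_1"
  assumes fo: "fin_ord f" and "cycle_list f S \<kappa>" and "set \<kappa> \<subseteq> {1..k}"
  shows "(\<Sum>(P, D)\<in>inv_parts f S. \<Prod>i\<in>{1..k}. \<phi> i (period_count (image f) D i) (period_count (image f) P i))
    = (\<Sum>\<nu>\<in>divisors_of \<kappa>. \<Prod>i\<in>{1..k}. (step_op i ^^ mult i \<nu>) (\<phi> i) 0 0)"
  using assms(2,3)
proof (induction arbitrary: \<phi> rule: cycle_list.induct)
  case Nil
  have "divisors_of [] = {[]}" by (auto simp: divisors_of_def)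
  then show ?case by (simp add: inv_parts_empty mult_def period_count_def)
next
  case (Cons S xs c)
  let ?a = "least_power f c"
  have a: "0 < ?a" "?a \<le> k" using Cons.prems by auto
  have c: "c \<notin> S" using Cons.hyps(2) orb_self[of c f] by blast
  have fin: "finite S" by (rule cycle_list_props(1)[OF fo Cons.hyps(1)])
  have cl: "f x \<in> S" if "x \<in> S" for x by (rule cycle_list_closed[OF Cons.hyps(1) that])
  \<comment> \<open>The three summands share all factors except the one for \<open>i\<close>, where
    they add up to \<open>step_op\<close>. The index \<open>i\<close> occurs in the product because
    it divides a cycle length that is at most \<open>k\<close>.\<close>
  have factor: "(\<Prod>j\<in>{1..k}. \<phi> j (u j + (if j = i then i else 0)) (v j + (if j = i then i else 0)))
      + (\<Prod>j\<in>{1..k}. \<phi> j (u j) (v j + (if j = i then i else 0)))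
      + of_nat (v i) * (\<Prod>j\<in>{1..k}. \<phi> j (u j) (v j))
    = (\<Prod>j\<in>{1..k}. (\<phi>(i := step_op i (\<phi> i))) j (u j) (v j))" if "i dvd ?a" for i and u v :: "nat \<Rightarrow> nat"
  proof -
    have i: "i \<in> {1..k}" using that a dvd_imp_le[OF that a(1)] dvd_pos_nat[OF a(1) that] by simp
    have rest: "(\<Prod>j\<in>{1..k}. g j) = g i * (\<Prod>j\<in>{1..k} - {i}. \<phi> j (u j) (v j))"
      if "\<And>j. j \<noteq> i \<Longrightarrow> g j = \<phi> j (u j) (v j)" for g :: "nat \<Rightarrow> 'r"
      using that by (subst prod.remove[OF _ i]) (auto intro!: arg_cong2[where f = "(*)"] prod.cong)
    show ?thesis
      by (subst (1 2 3 4) rest) (auto simp: step_op_def algebra_simps)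
  qed
  have "(\<Sum>(P, D)\<in>inv_parts f (orb f c \<union> S). \<Prod>j\<in>{1..k}. \<phi> j (period_count (image f) D j) (period_count (image f) P j))
    = (\<Sum>i | i dvd ?a. \<Sum>(P, D)\<in>inv_parts f S.
        \<Prod>j\<in>{1..k}. (\<phi>(i := step_op i (\<phi> i))) j (period_count (image f) D j) (period_count (image f) P j))"
  proof (subst sum_inv_parts_insert_orbit[OF fo fin _ c, of "\<lambda>u v. \<Prod>j\<in>{1..k}. \<phi> j (u j) (v j)"], fact cl,
      intro sum.cong refl)
    fix i and x :: "'a set set \<times> 'a set set" assume "i \<in> {i. i dvd ?a}"
    then have i: "i dvd ?a" by simp
    obtain P D where x: "x = (P, D)" by (cases x)
    show "(case x of (P, D) \<Rightarrow>
        (\<Prod>j\<in>{1..k}. \<phi> j (period_count (image f) D j + (if j = i then i else 0)) (period_count (image f) P j + (if j = i then i else 0)))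
        + (\<Prod>j\<in>{1..k}. \<phi> j (period_count (image f) D j) (period_count (image f) P j + (if j = i then i else 0)))
        + of_nat (period_count (image f) P i) * (\<Prod>j\<in>{1..k}. \<phi> j (period_count (image f) D j) (period_count (image f) P j)))
      = (case x of (P, D) \<Rightarrow>
        \<Prod>j\<in>{1..k}. (\<phi>(i := step_op i (\<phi> i))) j (period_count (image f) D j) (period_count (image f) P j))"
      unfolding x split_conv by (rule factor[OF i])
  qed
  also have "\<dots> = (\<Sum>i | i dvd ?a. \<Sum>\<nu>\<in>divisors_of xs.
      \<Prod>j\<in>{1..k}. (step_op j ^^ mult j \<nu>) ((\<phi>(i := step_op i (\<phi> i))) j) 0 0)"
    using Cons.prems by (intro sum.cong refl Cons.IH) auto
  also have "\<dots> = (\<Sum>i | i dvd ?a. \<Sum>\<nu>\<in>divisors_of xs.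
      \<Prod>j\<in>{1..k}. (step_op j ^^ mult j (i # \<nu>)) (\<phi> j) 0 0)"
    by (intro sum.cong prod.cong refl) (auto simp: mult_def funpow_swap1)
  also have "\<dots> = (\<Sum>\<nu>\<in>divisors_of (?a # xs). \<Prod>j\<in>{1..k}. (step_op j ^^ mult j \<nu>) (\<phi> j) 0 0)"
    unfolding divisors_of_Cons[OF a(1)]
    by (subst sum.reindex) (auto simp: inj_on_def sum.cartesian_product case_prod_unfold)
  finally show ?case .
qed

text \<open>With the indicator as weight only \<open>x = q i\<close> survives in the binomial sum,
  since \<open>i > 0\<close> can be cancelled; if \<open>q i > t\<close> nothing survives, in
  agreement with the binomial coefficient being 0.\<close>

lemma sum_inv_parts_indicator:
  assumes "fin_ord f" and "cycle_list f S \<kappa>" and "set \<kappa> \<subseteq> {1..k}"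
  shows "(\<Sum>(P, D)\<in>inv_parts f S. \<Prod>i\<in>{1..k}. of_bool (period_count (image f) D i = i * q i))
    = (\<Sum>\<nu>\<in>divisors_of \<kappa>. \<Prod>i\<in>{1..k}. \<Sum>t\<in>{0..mult i \<nu>}.
        of_nat (Stirling (mult i \<nu>) t * (t choose q i) * i ^ (mult i \<nu> - t)) :: 'r::comm_semiring_1)"
proof -
  have "(\<Sum>x\<le>t. of_nat (t choose x) * of_bool (i * x = i * q i)) = (of_nat (t choose q i) :: 'r)"
    if "0 < i" for i t
  proof -
    have "(\<Sum>x\<le>t. of_nat (t choose x) * of_bool (i * x = i * q i))
        = (\<Sum>x\<le>t. if x = q i then of_nat (t choose q i) else (0 :: 'r))"
      using that by (intro sum.cong) auto
    then show ?thesis by (simp add: binomial_eq_0)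
  qed
  then have "(step_op i ^^ mult i \<nu>) (\<lambda>c u. of_bool (c = i * q i)) 0 0
    = (\<Sum>t\<in>{0..mult i \<nu>}. of_nat (Stirling (mult i \<nu>) t * (t choose q i) * i ^ (mult i \<nu> - t)) :: 'r)"
    if "i \<in> {1..k}" for i \<nu>
    using that unfolding funpow_step_op atLeast0AtMost by (intro sum.cong) (auto simp: mult_ac)
  then show ?thesis
    using sum_inv_parts_prod[OF assms, of "\<lambda>i c u. of_bool (c = i * q i) :: 'r"] by simp
qed

section \<open>Stacking with the diagram of a partial permutation\<close>

lemma pts_iff [simp]: "Top i \<in> pts k \<longleftrightarrow> i \<in> {1..k}" "Bot i \<in> pts k \<longleftrightarrow> i \<in> {1..k}"
  by (auto simp: pts_def)

definition p1pow :: "nat \<Rightarrow> diagram" where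
  "p1pow s = (\<lambda>i. {Top i}) ` {1..s} \<union> (\<lambda>i. {Bot i}) ` {1..s}"

text \<open>A partial permutation with domain and range \<open>{1..r}\<close>, the later columns
  being isolated. The extreme cases \<open>k = r\<close> and \<open>r = 0\<close> are the
  permutation diagrams and the tensor powers of \<open>p1\<close>, so one membership lemma covers
  every diagram that occurs.\<close>

definition pdiag :: "nat \<Rightarrow> nat \<Rightarrow> (nat \<Rightarrow> nat) \<Rightarrow> diagram" where
  "pdiag r k \<sigma> = (\<lambda>j. {Top (\<sigma> j), Bot j}) ` {1..r} \<union> (\<lambda>i. {Top i}) ` {r+1..k} \<union> (\<lambda>i. {Bot i}) ` {r+1..k}"

lemma image_shift_interval:
  "(\<lambda>i. g (i + a)) ` {1..s} = g ` {a+1..a+s}" for g :: "nat \<Rightarrow> 'b"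
proof -
  have "(\<lambda>i. i + a) ` {1..s} = {a+1..a+s}" by (simp add: add.commute)
  then show ?thesis by (metis image_image)
qed

text \<open>Shifting the tail by \<open>a\<close> in the diagram matches the shift inside
  \<open>gamma_perm_list\<close>, so the nested tensor product is one permutation diagram.\<close>

lemma gamma_kappa_eq: "gamma_kappa \<kappa> = perm_diag (sum_list \<kappa>) (gamma_perm_list \<kappa>)"
proof (induction \<kappa>)
  case Nil
  show ?case by (simp add: perm_diag_def)
next
  case (Cons a \<kappa>)
  let ?g = "gamma_perm_list (a # \<kappa>)"
  have img: "perm_diag r \<tau> = (\<lambda>j. {Top (\<tau> j), Bot j}) ` {1..r}" for r \<tau>
    by (auto simp: perm_diag_def)
  have 1: "gamma_diag a = (\<lambda>j. {Top (?g j), Bot j}) ` {1..a}"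
    unfolding gamma_diag_def img by (rule image_cong) auto
  have "image (shift a) ` gamma_kappa \<kappa>
      = (\<lambda>j. {Top (gamma_perm_list \<kappa> j + a), Bot (j + a)}) ` {1..sum_list \<kappa>}"
    unfolding Cons.IH img by (simp add: image_image)
  also have "\<dots> = (\<lambda>j. {Top (?g (j + a)), Bot (j + a)}) ` {1..sum_list \<kappa>}"
    by (rule image_cong) auto
  also have "\<dots> = (\<lambda>j. {Top (?g j), Bot j}) ` {a+1..a+sum_list \<kappa>}"
    by (rule image_shift_interval)
  finally have "gamma_kappa (a # \<kappa>) = (\<lambda>j. {Top (?g j), Bot j}) ` ({1..a} \<union> {a+1..a+sum_list \<kappa>})"
    by (simp only: gamma_kappa.simps dtensor_def 1 image_Un)
  also have "{1..a} \<union> {a+1..a+sum_list \<kappa>} = {1..sum_list (a # \<kappa>)}" by auto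
  finally show ?case unfolding img .
qed

lemma pdiag_in_Pk:
  assumes \<sigma>: "\<sigma> permutes {1..r}" and "r \<le> k"
  shows "pdiag r k \<sigma> \<in> Pk k"
  unfolding Pk_def mem_Collect_eq
proof (rule partition_onI)
  have 1: "(\<Union>j\<in>{1..r}. {Top (\<sigma> j), Bot j}) = Top ` {1..r} \<union> Bot ` {1..r}"
  proof -
    have "(\<Union>j\<in>{1..r}. {Top (\<sigma> j), Bot j}) = Top ` \<sigma> ` {1..r} \<union> Bot ` {1..r}" by auto
    then show ?thesis using permutes_image[OF \<sigma>] by simp
  qed
  have 2: "{1..k} = {1..r} \<union> {r+1..k}" using assms(2) by auto
  show "\<Union>(pdiag r k \<sigma>) = pts k"
    unfolding pdiag_def pts_def Union_Un_distrib 1 2 image_Un by auto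
  have in1: "\<sigma> j \<le> r" if "j \<le> r" "1 \<le> j" for j
    using permutes_in_image[OF \<sigma>, of j] that by simp
  show "disjnt p q" if "p \<in> pdiag r k \<sigma>" "q \<in> pdiag r k \<sigma>" "p \<noteq> q" for p q
    using that in1 permutes_inj[OF \<sigma>] unfolding pdiag_def disjnt_def
    by (fastforce simp: inj_eq)
  show "{} \<notin> pdiag r k \<sigma>" by (auto simp: pdiag_def)
qed

lemma perm_diag_eq_pdiag: "perm_diag r \<sigma> = pdiag r r \<sigma>"
  by (auto simp: perm_diag_def pdiag_def)

lemma p1pow_eq_pdiag: "p1pow s = pdiag 0 s id"
  by (auto simp: p1pow_def pdiag_def)

lemma dtensor_pdiag: "dtensor r (perm_diag r \<sigma>) (p1pow s) = pdiag r (r + s) \<sigma>"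
proof -
  have "image (shift r) ` p1pow s = (\<lambda>i. {Top (i + r)}) ` {1..s} \<union> (\<lambda>i. {Bot (i + r)}) ` {1..s}"
    by (simp add: p1pow_def image_Un image_image)
  also have "\<dots> = (\<lambda>i. {Top i}) ` {r+1..r+s} \<union> (\<lambda>i. {Bot i}) ` {r+1..r+s}"
    using image_shift_interval[of "\<lambda>i. {Top i}"] image_shift_interval[of "\<lambda>i. {Bot i}"] by simp
  finally show ?thesis
    unfolding dtensor_def pdiag_def perm_diag_def by auto
qed

lemma finite_Pk: "finite (Pk k)"
  unfolding Pk_def by (rule finitely_many_partition_on) (simp add: pts_def)

lemma etensor_single:
  assumes "a \<in> Pk k1" "b \<in> Pk k2"
  shows "etensor k1 k2 (\<lambda>d. if d = a then x else 0) (\<lambda>d. if d = b then y else 0)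
    = (\<lambda>d. if d = dtensor k1 a b then x * y else 0)"
proof
  fix d
  have "(\<Sum>d2\<in>Pk k2. if dtensor k1 d1 d2 = d then (if d1 = a then x else 0) * (if d2 = b then y else 0) else 0)
      = (if d1 = a then (if dtensor k1 a b = d then x * y else 0) else 0)" for d1
  proof -
    have "(\<Sum>d2\<in>Pk k2. if dtensor k1 d1 d2 = d then (if d1 = a then x else 0) * (if d2 = b then y else 0) else 0)
      = (\<Sum>d2\<in>Pk k2. if d2 = b then (if d1 = a then (if dtensor k1 a b = d then x * y else 0) else 0) else 0)"
      by (rule sum.cong) auto
    then show ?thesis using assms(2) by (simp add: finite_Pk)
  qed
  then show "etensor k1 k2 (\<lambda>d. if d = a then x else 0) (\<lambda>d. if d = b then y else 0) d
      = (if d = dtensor k1 a b then x * y else 0)"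
    unfolding etensor_def using assms(1) by (auto simp: finite_Pk)
qed

lemma p1pow_in_Pk: "p1pow s \<in> Pk s"
  unfolding p1pow_eq_pdiag by (rule pdiag_in_Pk) (auto simp: permutes_id)

lemma e_pow_eq: "e_pow n s = (\<lambda>d. if d = p1pow s then (1 / of_nat n) ^ s else 0)"
proof (induction s)
  case 0
  then show ?case by (simp add: basis_el_def p1pow_def fun_eq_iff)
next
  case (Suc s)
  have p1': "p1 = p1pow 1" by (auto simp: p1_def p1pow_def)
  have "dtensor 1 p1 (p1pow s) = p1pow (Suc s)"
  proof -
    have "image (shift 1) ` p1pow s = (\<lambda>i. {Top (i + 1)}) ` {1..s} \<union> (\<lambda>i. {Bot (i + 1)}) ` {1..s}"
      by (simp add: p1pow_def image_Un image_image)
    also have "\<dots> = (\<lambda>i. {Top i}) ` {1+1..1+s} \<union> (\<lambda>i. {Bot i}) ` {1+1..1+s}"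
      unfolding image_shift_interval[of "\<lambda>i. {Top i}" 1 s] image_shift_interval[of "\<lambda>i. {Bot i}" 1 s] ..
    finally have "dtensor 1 p1 (p1pow s) = (\<lambda>i. {Top i}) ` ({1} \<union> {1+1..1+s}) \<union> (\<lambda>i. {Bot i}) ` ({1} \<union> {1+1..1+s})"
      unfolding dtensor_def p1_def image_Un by auto
    also have "{1} \<union> {1+1..1+s} = {1..Suc s}" by auto
    finally show ?thesis unfolding p1pow_def .
  qed
  moreover have "p1 \<in> Pk 1" unfolding p1' by (rule p1pow_in_Pk)
  ultimately show ?case
    unfolding e_pow.simps Suc.IH e_el_def by (subst etensor_single) (simp_all add: p1pow_in_Pk fun_eq_iff)
qed

text \<open>The algebra element is supported on a single diagram, so its character is a scalar
  multiple of the trace of that diagram.\<close>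

lemma pchar_eq:
  assumes "sum_list \<kappa> \<le> k"
  shows "pchar n k lam (etensor (sum_list \<kappa>) (k - sum_list \<kappa>)
            (basis_el (gamma_kappa \<kappa>)) (e_pow n (k - sum_list \<kappa>)))
    = (1 / of_nat n) ^ (k - sum_list \<kappa>) * pchar_diag n k lam (pdiag (sum_list \<kappa>) k (gamma_perm_list \<kappa>))"
proof -
  let ?r = "sum_list \<kappa>" and ?d = "pdiag (sum_list \<kappa>) k (gamma_perm_list \<kappa>)"
  have "perm_diag ?r (gamma_perm_list \<kappa>) \<in> Pk ?r"
    unfolding perm_diag_eq_pdiag by (rule pdiag_in_Pk[OF gamma_perm_list_permutes]) simp
  then have "etensor ?r (k - ?r) (basis_el (gamma_kappa \<kappa>)) (e_pow n (k - ?r))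
      = (\<lambda>d. if d = ?d then (1 / of_nat n) ^ (k - ?r) else 0)"
    using assms unfolding basis_el_def e_pow_eq gamma_kappa_eq
    by (subst etensor_single) (simp_all add: p1pow_in_Pk dtensor_pdiag fun_eq_iff)
  moreover have "?d \<in> Pk k" by (rule pdiag_in_Pk[OF gamma_perm_list_permutes assms])
  ultimately show ?thesis
    unfolding pchar_def using finite_Pk by (simp add: if_distrib[of "\<lambda>x. x * _"] cong: if_cong)
qed

text \<open>A certificate for the components: the transitive closure lies inside the equivalence
  relation of \<open>C\<close> by \<open>edge\<close> and contains it by \<open>conn\<close>, which
  avoids computing the closure.\<close>

lemma comps_eqI:
  assumes part: "partition_on (Field (stack_rel d1 d2)) C"
    and edge: "\<And>B. B \<in> image up ` d1 \<union> image down ` d2 \<Longrightarrow> \<exists>X\<in>C. B \<subseteq> X"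
    and conn: "\<And>X x y. X \<in> C \<Longrightarrow> x \<in> X \<Longrightarrow> y \<in> X \<Longrightarrow> (x, y) \<in> (stack_rel d1 d2)\<^sup>+"
  shows "comps d1 d2 = C"
proof -
  let ?E = "{(x, y). \<exists>X\<in>C. x \<in> X \<and> y \<in> X}"
  have "trans ?E"
  proof (rule transI, clarify)
    fix x y z X Y assume "X \<in> C" "x \<in> X" "y \<in> X" "Y \<in> C" "y \<in> Y" "z \<in> Y"
    moreover from this have "X = Y" using partition_on_unique[OF part] by blast
    ultimately show "\<exists>X\<in>C. x \<in> X \<and> z \<in> X" by blast
  qed
  moreover have "stack_rel d1 d2 \<subseteq> ?E"
  proof clarify
    fix a b a' b' assume "((a, b), (a', b')) \<in> stack_rel d1 d2"
    then obtain B where B: "B \<in> image up ` d1 \<union> image down ` d2" "(a, b) \<in> B" "(a', b') \<in> B"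
      unfolding stack_rel_def by blast
    obtain X where "X \<in> C" "B \<subseteq> X" using edge[OF B(1)] by blast
    then show "\<exists>X\<in>C. (a, b) \<in> X \<and> (a', b') \<in> X" using B by blast
  qed
  ultimately have "(stack_rel d1 d2)\<^sup>+ \<subseteq> ?E"
    using trancl_mono_subset[of "stack_rel d1 d2" ?E] trancl_id[of ?E] by simp
  moreover have "?E \<subseteq> (stack_rel d1 d2)\<^sup>+" using conn by blast
  ultimately have "(stack_rel d1 d2)\<^sup>+ = ?E" by blast
  then show ?thesis unfolding comps_def using partition_on_eq_quotient[OF part] by simp
qed

lemma stack_relI:
  "X \<in> d1 \<Longrightarrow> p \<in> X \<Longrightarrow> q \<in> X \<Longrightarrow> (up p, up q) \<in> stack_rel d1 d2"
  "X \<in> d2 \<Longrightarrow> p \<in> X \<Longrightarrow> q \<in> X \<Longrightarrow> (down p, down q) \<in> stack_rel d1 d2"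
proof -
  have edge: "(x, y) \<in> stack_rel d1 d2" if "B \<in> image up ` d1 \<union> image down ` d2" "x \<in> B" "y \<in> B" for B x y
    using that unfolding stack_rel_def by blast
  show "(up p, up q) \<in> stack_rel d1 d2" if "X \<in> d1" "p \<in> X" "q \<in> X"
    by (rule edge[of "up ` X"]) (use that in auto)
  show "(down p, down q) \<in> stack_rel d1 d2" if "X \<in> d2" "p \<in> X" "q \<in> X"
    by (rule edge[of "down ` X"]) (use that in auto)
qed

lemma Field_stack_rel:
  assumes "d1 \<in> Pk k" "d2 \<in> Pk k"
  shows "Field (stack_rel d1 d2) = {0, 1, 2} \<times> {1..k}"
proof -
  have "Field (stack_rel d1 d2) = up ` \<Union>d1 \<union> down ` \<Union>d2"
  proof
    show "Field (stack_rel d1 d2) \<subseteq> up ` \<Union>d1 \<union> down ` \<Union>d2"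
      unfolding Field_def stack_rel_def by auto
    show "up ` \<Union>d1 \<union> down ` \<Union>d2 \<subseteq> Field (stack_rel d1 d2)"
    proof
      fix x assume "x \<in> up ` \<Union>d1 \<union> down ` \<Union>d2"
      then have "(x, x) \<in> stack_rel d1 d2" using stack_relI[of _ _ _ _] unfolding stack_rel_def by blast
      then show "x \<in> Field (stack_rel d1 d2)" by (rule FieldI1)
    qed
  qed
  also have "\<dots> = up ` pts k \<union> down ` pts k"
    using assms by (simp add: Pk_def partition_on_def)
  also have "\<dots> = {0, 1, 2} \<times> {1..k}"
    unfolding pts_def image_Un image_image by auto
  finally show ?thesis .
qed

lemma Pk_ex: "w \<in> Pk k \<Longrightarrow> p \<in> pts k \<Longrightarrow> \<exists>X\<in>w. p \<in> X"
  unfolding Pk_def partition_on_def by blast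

lemma Pk_unique: "w \<in> Pk k \<Longrightarrow> X \<in> w \<Longrightarrow> Y \<in> w \<Longrightarrow> p \<in> X \<Longrightarrow> p \<in> Y \<Longrightarrow> X = Y"
  unfolding Pk_def mem_Collect_eq by (rule partition_on_unique)

lemma Pk_nonempty: "w \<in> Pk k \<Longrightarrow> X \<in> w \<Longrightarrow> X \<noteq> {}"
  unfolding Pk_def partition_on_def by blast

text \<open>The component that contains a given block \<open>X\<close> of the other diagram, in the levels of
  \<open>stack_rel\<close>.\<close>
definition left_comp :: "nat \<Rightarrow> (nat \<Rightarrow> nat) \<Rightarrow> pt set \<Rightarrow> (nat \<times> nat) set" where
  "left_comp r \<sigma> X = {(l, u). l = 0 \<and> (\<exists>i\<in>{1..r}. u = \<sigma> i \<and> Top i \<in> X) \<or> l = 1 \<and> Top u \<in> X \<or> l = 2 \<and> Bot u \<in> X}"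

definition right_comp :: "nat \<Rightarrow> (nat \<Rightarrow> nat) \<Rightarrow> pt set \<Rightarrow> (nat \<times> nat) set" where
  "right_comp r \<sigma> X = {(l, u). l = 0 \<and> Top u \<in> X \<or> l = 1 \<and> Bot u \<in> X \<or> l = 2 \<and> (\<exists>i\<in>{1..r}. u = \<sigma> i \<and> Bot i \<in> X)}"

lemma left_comp_mem [simp]:
  "(0, u) \<in> left_comp r \<sigma> X \<longleftrightarrow> (\<exists>i\<in>{1..r}. u = \<sigma> i \<and> Top i \<in> X)"
  "(Suc 0, u) \<in> left_comp r \<sigma> X \<longleftrightarrow> Top u \<in> X"
  "(2, u) \<in> left_comp r \<sigma> X \<longleftrightarrow> Bot u \<in> X"
  by (auto simp: left_comp_def)

lemma right_comp_mem [simp]: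
  "(0, u) \<in> right_comp r \<sigma> X \<longleftrightarrow> Top u \<in> X"
  "(Suc 0, u) \<in> right_comp r \<sigma> X \<longleftrightarrow> Bot u \<in> X"
  "(2, u) \<in> right_comp r \<sigma> X \<longleftrightarrow> (\<exists>i\<in>{1..r}. u = \<sigma> i \<and> Bot i \<in> X)"
  by (auto simp: right_comp_def)

lemma ball_left_comp:
  "(\<forall>x\<in>left_comp r \<sigma> X. Q x) \<longleftrightarrow> (\<forall>i\<in>{1..r}. Top i \<in> X \<longrightarrow> Q (0, \<sigma> i)) \<and>
    (\<forall>u. Top u \<in> X \<longrightarrow> Q (1, u)) \<and> (\<forall>u. Bot u \<in> X \<longrightarrow> Q (2, u))"
  unfolding left_comp_def by auto

lemma ball_right_comp:
  "(\<forall>x\<in>right_comp r \<sigma> X. Q x) \<longleftrightarrow> (\<forall>i\<in>{1..r}. Bot i \<in> X \<longrightarrow> Q (2, \<sigma> i)) \<and>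
    (\<forall>u. Bot u \<in> X \<longrightarrow> Q (1, u)) \<and> (\<forall>u. Top u \<in> X \<longrightarrow> Q (0, u))"
  unfolding right_comp_def by auto

text \<open>What remains of a block on the outer rows once \<open>pdiag\<close> is stacked on top:
  top points up to \<open>r\<close> are moved by \<sigma>, later ones are cut off.
  \<open>act_bot\<close> is the mirror image for the transpose below, and \<open>act_both\<close> is
  the composite.\<close>

definition act_top :: "nat \<Rightarrow> (nat \<Rightarrow> nat) \<Rightarrow> pt set \<Rightarrow> pt set" where
  "act_top r \<sigma> X = {Top (\<sigma> i) | i. i \<in> {1..r} \<and> Top i \<in> X} \<union> {Bot u | u. Bot u \<in> X}"

definition act_bot :: "nat \<Rightarrow> (nat \<Rightarrow> nat) \<Rightarrow> pt set \<Rightarrow> pt set" where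
  "act_bot r \<sigma> X = {Top u | u. Top u \<in> X} \<union> {Bot (\<sigma> i) | i. i \<in> {1..r} \<and> Bot i \<in> X}"

definition act_both :: "nat \<Rightarrow> (nat \<Rightarrow> nat) \<Rightarrow> pt set \<Rightarrow> pt set" where
  "act_both r \<sigma> X = {Top (\<sigma> i) | i. i \<in> {1..r} \<and> Top i \<in> X} \<union> {Bot (\<sigma> i) | i. i \<in> {1..r} \<and> Bot i \<in> X}"

lemma partition_on_singleton_image: "inj_on g A \<Longrightarrow> partition_on (g ` A) ((\<lambda>i. {g i}) ` A)"
  by (auto simp: partition_on_def disjoint_def inj_on_def)

lemma pdiag_blocks:
  "j \<in> {1..r} \<Longrightarrow> {Top (\<sigma> j), Bot j} \<in> pdiag r k \<sigma>"
  "i \<in> {r+1..k} \<Longrightarrow> {Top i} \<in> pdiag r k \<sigma>" "i \<in> {r+1..k} \<Longrightarrow> {Bot i} \<in> pdiag r k \<sigma>"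
  unfolding pdiag_def by (blast, blast, blast)

lemma transp_pdiag_blocks:
  "j \<in> {1..r} \<Longrightarrow> {Bot (\<sigma> j), Top j} \<in> transp (pdiag r k \<sigma>)"
  "i \<in> {r+1..k} \<Longrightarrow> {Top i} \<in> transp (pdiag r k \<sigma>)" "i \<in> {r+1..k} \<Longrightarrow> {Bot i} \<in> transp (pdiag r k \<sigma>)"
proof -
  have "transp (pdiag r k \<sigma>) = (\<lambda>j. {Bot (\<sigma> j), Top j}) ` {1..r} \<union> (\<lambda>i. {Bot i}) ` {r+1..k} \<union> (\<lambda>i. {Top i}) ` {r+1..k}"
    unfolding transp_def pdiag_def image_Un image_image by simp
  then show "j \<in> {1..r} \<Longrightarrow> {Bot (\<sigma> j), Top j} \<in> transp (pdiag r k \<sigma>)"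
    "i \<in> {r+1..k} \<Longrightarrow> {Top i} \<in> transp (pdiag r k \<sigma>)" "i \<in> {r+1..k} \<Longrightarrow> {Bot i} \<in> transp (pdiag r k \<sigma>)"
    by blast+
qed

lemma transp_in_Pk:
  assumes "d \<in> Pk k"
  shows "transp d \<in> Pk k"
proof -
  have inj: "inj flip"
  proof (rule injI)
    fix x y assume "flip x = flip y"
    then show "x = y" by (cases x; cases y) auto
  qed
  have "partition_on (flip ` pts k) ((`) flip ` d - {{}})"
    using assms unfolding Pk_def by (intro partition_on_inj_image) (auto intro: inj_on_subset[OF inj])
  moreover have "flip ` pts k = pts k" by (auto simp: pts_def image_Un image_image)
  moreover have "{} \<notin> (`) flip ` d" using Pk_nonempty[OF assms] by auto
  ultimately show ?thesis by (simp add: Pk_def transp_def)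
qed

context
  fixes r k :: nat and \<sigma> :: "nat \<Rightarrow> nat"
  assumes \<sigma>: "\<sigma> permutes {1..r}" and rk: "r \<le> k"
begin

text \<open>Each middle point is joined upwards to at most one point, so the components are the
  blocks of \<open>w\<close> with these ends attached, together with the isolated top points beyond
  \<open>r\<close>.\<close>

lemma comps_pdiag_left:
  assumes w: "w \<in> Pk k"
  shows "comps (pdiag r k \<sigma>) w = left_comp r \<sigma> ` w \<union> (\<lambda>i. {(0, i)}) ` {r+1..k}"
proof (rule comps_eqI)
  have d: "pdiag r k \<sigma> \<in> Pk k" by (rule pdiag_in_Pk[OF \<sigma> rk])
  let ?R = "stack_rel (pdiag r k \<sigma>) w"
  have "partition_on (left_comp r \<sigma> (pts k)) (left_comp r \<sigma> ` w - {{}})"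
  proof (rule partition_on_transform)
    show "partition_on (pts k) w" using w by (simp add: Pk_def)
    show "\<Union>(left_comp r \<sigma> ` P) = left_comp r \<sigma> (\<Union>P)" for P by (auto simp: left_comp_def)
    show "disjnt (left_comp r \<sigma> p) (left_comp r \<sigma> q)" if "disjnt p q" for p q
    proof -
      have "\<forall>x\<in>left_comp r \<sigma> p. x \<notin> left_comp r \<sigma> q"
        using that permutes_inj[OF \<sigma>] unfolding ball_left_comp by (auto simp: disjnt_def inj_eq)
      then show ?thesis by (auto simp: disjnt_def)
    qed
  qed
  moreover have "{} \<notin> left_comp r \<sigma> ` w"
  proof
    assume "{} \<in> left_comp r \<sigma> ` w"
    then obtain X where X: "X \<in> w" "left_comp r \<sigma> X = {}" by auto
    then have "\<forall>u. Top u \<notin> X" "\<forall>u. Bot u \<notin> X"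
      using left_comp_mem(2,3)[of _ r \<sigma> X] by blast+
    then have "X = {}" by (metis all_not_in_conv pt.exhaust)
    then show False using Pk_nonempty[OF w X(1)] by simp
  qed
  ultimately have "partition_on (left_comp r \<sigma> (pts k)) (left_comp r \<sigma> ` w)" by simp
  moreover have "partition_on ((\<lambda>i. (0 :: nat, i)) ` {r+1..k}) ((\<lambda>i. {(0, i)}) ` {r+1..k})"
    by (rule partition_on_singleton_image) (simp add: inj_on_def)
  moreover have cA: "left_comp r \<sigma> (pts k) = {0} \<times> {1..r} \<union> {1, 2} \<times> {1..k}"
  proof -
    have "left_comp r \<sigma> (pts k) = {0} \<times> \<sigma> ` {1..r} \<union> {1, 2} \<times> {1..k}"
      using rk unfolding left_comp_def by auto
    then show ?thesis using permutes_image[OF \<sigma>] by simp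
  qed
  ultimately have "partition_on ({0} \<times> {1..r} \<union> {1, 2} \<times> {1..k} \<union> (\<lambda>i. (0, i)) ` {r+1..k})
      (left_comp r \<sigma> ` w \<union> (\<lambda>i. {(0, i)}) ` {r+1..k})"
    by (intro partition_on_Un) auto
  moreover have "{0} \<times> {1..r} \<union> {1, 2} \<times> {1..k} \<union> (\<lambda>i. (0, i)) ` {r+1..k} = {0, 1, 2 :: nat} \<times> {1..k}"
    using rk by auto
  ultimately show "partition_on (Field ?R) (left_comp r \<sigma> ` w \<union> (\<lambda>i. {(0, i)}) ` {r+1..k})"
    by (simp only: Field_stack_rel[OF d w])
  show "\<exists>X\<in>left_comp r \<sigma> ` w \<union> (\<lambda>i. {(0, i)}) ` {r+1..k}. B \<subseteq> X"
    if B: "B \<in> image up ` pdiag r k \<sigma> \<union> image down ` w" for B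
  proof -
    consider j where "j \<in> {1..r}" "B = {(0, \<sigma> j), (1, j)}" | i where "i \<in> {r+1..k}" "B = {(0, i)}"
      | i where "i \<in> {r+1..k}" "B = {(1, i)}" | X where "X \<in> w" "B = down ` X"
      using B unfolding pdiag_def by auto
    then show ?thesis
    proof cases
      case 1
      then obtain X where "X \<in> w" "Top j \<in> X" using Pk_ex[OF w, of "Top j"] rk by auto
      then have "B \<subseteq> left_comp r \<sigma> X" using 1 by auto
      then show ?thesis using \<open>X \<in> w\<close> by blast
    next
      case 2
      then show ?thesis by blast
    next
      case 3
      then obtain X where "X \<in> w" "Top i \<in> X" using Pk_ex[OF w, of "Top i"] rk by auto
      then have "B \<subseteq> left_comp r \<sigma> X" using 3 by auto
      then show ?thesis using \<open>X \<in> w\<close> by blast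
    next
      case 4
      have "down p \<in> left_comp r \<sigma> X" if "p \<in> X" for p using that by (cases p) auto
      then have "B \<subseteq> left_comp r \<sigma> X" using 4 by auto
      then show ?thesis using \<open>X \<in> w\<close> by blast
    qed
  qed
  show "(x, y) \<in> ?R\<^sup>+"
    if X: "X \<in> left_comp r \<sigma> ` w \<union> (\<lambda>i. {(0, i)}) ` {r+1..k}" and xy: "x \<in> X" "y \<in> X" for X x y
    using X
  proof
    assume "X \<in> (\<lambda>i. {(0, i)}) ` {r+1..k}"
    then obtain i where i: "i \<in> {r+1..k}" "X = {(0, i)}" by blast
    then have "(up (Top i), up (Top i)) \<in> ?R" by (intro stack_relI(1)[OF pdiag_blocks(2)]) auto
    then show ?thesis using xy i by auto
  next
    assume "X \<in> left_comp r \<sigma> ` w"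
    then obtain Y where Y: "Y \<in> w" "X = left_comp r \<sigma> Y" by blast
    \<comment> \<open>Every point of the component is one edge away from the lower copy of
      \<open>Y\<close>, so any two of its points are joined by a path of three edges.\<close>
    have hub: "\<exists>p\<in>Y. (x, down p) \<in> ?R \<and> (down p, x) \<in> ?R" if "x \<in> left_comp r \<sigma> Y" for x
    proof -
      have "\<forall>x\<in>left_comp r \<sigma> Y. \<exists>p\<in>Y. (x, down p) \<in> ?R \<and> (down p, x) \<in> ?R"
        unfolding ball_left_comp
      proof (intro conjI ballI allI impI)
        fix i assume i: "i \<in> {1..r}" "Top i \<in> Y"
        have "(up (Top (\<sigma> i)), up (Bot i)) \<in> ?R" "(up (Bot i), up (Top (\<sigma> i))) \<in> ?R"
          by (intro stack_relI(1)[OF pdiag_blocks(1)[OF i(1)]]; simp)+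
        then show "\<exists>p\<in>Y. ((0, \<sigma> i), down p) \<in> ?R \<and> (down p, (0, \<sigma> i)) \<in> ?R"
          using i(2) by (intro bexI[of _ "Top i"]) auto
      next
        fix u assume u: "Top u \<in> Y"
        have "(down (Top u), down (Top u)) \<in> ?R" by (rule stack_relI(2)[OF Y(1) u u])
        then show "\<exists>p\<in>Y. ((1, u), down p) \<in> ?R \<and> (down p, (1, u)) \<in> ?R"
          using u by (intro bexI[of _ "Top u"]) auto
      next
        fix u assume u: "Bot u \<in> Y"
        have "(down (Bot u), down (Bot u)) \<in> ?R" by (rule stack_relI(2)[OF Y(1) u u])
        then show "\<exists>p\<in>Y. ((2, u), down p) \<in> ?R \<and> (down p, (2, u)) \<in> ?R"
          using u by (intro bexI[of _ "Bot u"]) auto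
      qed
      then show ?thesis using that by blast
    qed
    obtain p q where pq: "p \<in> Y" "q \<in> Y" "(x, down p) \<in> ?R" "(down q, y) \<in> ?R"
      using hub xy unfolding Y(2) by meson
    have "(down p, down q) \<in> ?R" by (rule stack_relI(2)[OF Y(1) pq(1,2)])
    then show ?thesis using pq(3,4) by (meson trancl.r_into_trancl trancl_into_trancl)
  qed
qed

text \<open>The mirror image of \<open>comps_pdiag_left\<close>: the transpose carries \<sigma> in
  its bottom row, so the ends are attached below.\<close>

lemma comps_pdiag_right:
  assumes w: "w \<in> Pk k"
  shows "comps w (transp (pdiag r k \<sigma>)) = right_comp r \<sigma> ` w \<union> (\<lambda>i. {(2, i)}) ` {r+1..k}"
proof (rule comps_eqI)
  have d: "transp (pdiag r k \<sigma>) \<in> Pk k" by (rule transp_in_Pk[OF pdiag_in_Pk[OF \<sigma> rk]])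
  let ?R = "stack_rel w (transp (pdiag r k \<sigma>))"
  have "partition_on (right_comp r \<sigma> (pts k)) (right_comp r \<sigma> ` w - {{}})"
  proof (rule partition_on_transform)
    show "partition_on (pts k) w" using w by (simp add: Pk_def)
    show "\<Union>(right_comp r \<sigma> ` P) = right_comp r \<sigma> (\<Union>P)" for P by (auto simp: right_comp_def)
    show "disjnt (right_comp r \<sigma> p) (right_comp r \<sigma> q)" if "disjnt p q" for p q
    proof -
      have "\<forall>x\<in>right_comp r \<sigma> p. x \<notin> right_comp r \<sigma> q"
        using that permutes_inj[OF \<sigma>] unfolding ball_right_comp by (auto simp: disjnt_def inj_eq)
      then show ?thesis by (auto simp: disjnt_def)
    qed
  qed
  moreover have "{} \<notin> right_comp r \<sigma> ` w"
  proof
    assume "{} \<in> right_comp r \<sigma> ` w"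
    then obtain X where X: "X \<in> w" "right_comp r \<sigma> X = {}" by auto
    then have "\<forall>u. Bot u \<notin> X" "\<forall>u. Top u \<notin> X"
      using right_comp_mem(1,2)[of _ r \<sigma> X] by blast+
    then have "X = {}" by (metis all_not_in_conv pt.exhaust)
    then show False using Pk_nonempty[OF w X(1)] by simp
  qed
  ultimately have "partition_on (right_comp r \<sigma> (pts k)) (right_comp r \<sigma> ` w)" by simp
  moreover have "partition_on ((\<lambda>i. (2 :: nat, i)) ` {r+1..k}) ((\<lambda>i. {(2, i)}) ` {r+1..k})"
    by (rule partition_on_singleton_image) (simp add: inj_on_def)
  moreover have cA: "right_comp r \<sigma> (pts k) = {2} \<times> {1..r} \<union> {0, 1} \<times> {1..k}"
  proof -
    have "right_comp r \<sigma> (pts k) = {2} \<times> \<sigma> ` {1..r} \<union> {0, 1} \<times> {1..k}"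
      using rk unfolding right_comp_def by auto
    then show ?thesis using permutes_image[OF \<sigma>] by simp
  qed
  ultimately have "partition_on ({2} \<times> {1..r} \<union> {0, 1} \<times> {1..k} \<union> (\<lambda>i. (2, i)) ` {r+1..k})
      (right_comp r \<sigma> ` w \<union> (\<lambda>i. {(2, i)}) ` {r+1..k})"
    by (intro partition_on_Un) auto
  moreover have "{2} \<times> {1..r} \<union> {0, 1} \<times> {1..k} \<union> (\<lambda>i. (2, i)) ` {r+1..k} = {0, 1, 2 :: nat} \<times> {1..k}"
    using rk by auto
  ultimately show "partition_on (Field ?R) (right_comp r \<sigma> ` w \<union> (\<lambda>i. {(2, i)}) ` {r+1..k})"
    by (simp only: Field_stack_rel[OF w d])
  show "\<exists>X\<in>right_comp r \<sigma> ` w \<union> (\<lambda>i. {(2, i)}) ` {r+1..k}. B \<subseteq> X"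
    if B: "B \<in> image up ` w \<union> image down ` transp (pdiag r k \<sigma>)" for B
  proof -
    consider j where "j \<in> {1..r}" "B = {(2, \<sigma> j), (1, j)}" | i where "i \<in> {r+1..k}" "B = {(2, i)}"
      | i where "i \<in> {r+1..k}" "B = {(1, i)}" | X where "X \<in> w" "B = up ` X"
      using B unfolding pdiag_def transp_def by auto
    then show ?thesis
    proof cases
      case 1
      then obtain X where "X \<in> w" "Bot j \<in> X" using Pk_ex[OF w, of "Bot j"] rk by auto
      then have "B \<subseteq> right_comp r \<sigma> X" using 1 by auto
      then show ?thesis using \<open>X \<in> w\<close> by blast
    next
      case 2
      then show ?thesis by blast
    next
      case 3
      then obtain X where "X \<in> w" "Bot i \<in> X" using Pk_ex[OF w, of "Bot i"] rk by auto
      then have "B \<subseteq> right_comp r \<sigma> X" using 3 by auto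
      then show ?thesis using \<open>X \<in> w\<close> by blast
    next
      case 4
      have "up p \<in> right_comp r \<sigma> X" if "p \<in> X" for p using that by (cases p) auto
      then have "B \<subseteq> right_comp r \<sigma> X" using 4 by auto
      then show ?thesis using \<open>X \<in> w\<close> by blast
    qed
  qed
  show "(x, y) \<in> ?R\<^sup>+"
    if X: "X \<in> right_comp r \<sigma> ` w \<union> (\<lambda>i. {(2, i)}) ` {r+1..k}" and xy: "x \<in> X" "y \<in> X" for X x y
    using X
  proof
    assume "X \<in> (\<lambda>i. {(2, i)}) ` {r+1..k}"
    then obtain i where i: "i \<in> {r+1..k}" "X = {(2, i)}" by blast
    then have "(down (Bot i), down (Bot i)) \<in> ?R" by (intro stack_relI(2)[OF transp_pdiag_blocks(3)]) auto
    then show ?thesis using xy i by auto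
  next
    assume "X \<in> right_comp r \<sigma> ` w"
    then obtain Y where Y: "Y \<in> w" "X = right_comp r \<sigma> Y" by blast
    have hub: "\<exists>p\<in>Y. (x, up p) \<in> ?R \<and> (up p, x) \<in> ?R" if "x \<in> right_comp r \<sigma> Y" for x
    proof -
      have "\<forall>x\<in>right_comp r \<sigma> Y. \<exists>p\<in>Y. (x, up p) \<in> ?R \<and> (up p, x) \<in> ?R"
        unfolding ball_right_comp
      proof (intro conjI ballI allI impI)
        fix i assume i: "i \<in> {1..r}" "Bot i \<in> Y"
        have "(down (Bot (\<sigma> i)), down (Top i)) \<in> ?R" "(down (Top i), down (Bot (\<sigma> i))) \<in> ?R"
          by (intro stack_relI(2)[OF transp_pdiag_blocks(1)[OF i(1)]]; simp)+
        then show "\<exists>p\<in>Y. ((2, \<sigma> i), up p) \<in> ?R \<and> (up p, (2, \<sigma> i)) \<in> ?R"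
          using i(2) by (intro bexI[of _ "Bot i"]) auto
      next
        fix u assume u: "Bot u \<in> Y"
        have "(up (Bot u), up (Bot u)) \<in> ?R" by (rule stack_relI(1)[OF Y(1) u u])
        then show "\<exists>p\<in>Y. ((1, u), up p) \<in> ?R \<and> (up p, (1, u)) \<in> ?R"
          using u by (intro bexI[of _ "Bot u"]) auto
      next
        fix u assume u: "Top u \<in> Y"
        have "(up (Top u), up (Top u)) \<in> ?R" by (rule stack_relI(1)[OF Y(1) u u])
        then show "\<exists>p\<in>Y. ((0, u), up p) \<in> ?R \<and> (up p, (0, u)) \<in> ?R"
          using u by (intro bexI[of _ "Top u"]) auto
      qed
      then show ?thesis using that by blast
    qed
    obtain p q where pq: "p \<in> Y" "q \<in> Y" "(x, up p) \<in> ?R" "(up q, y) \<in> ?R"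
      using hub xy unfolding Y(2) by meson
    have "(up p, up q) \<in> ?R" by (rule stack_relI(1)[OF Y(1) pq(1,2)])
    then show ?thesis using pq(3,4) by (meson trancl.r_into_trancl trancl_into_trancl)
  qed
qed

end

lemma outer_left_comp: "outer (left_comp r \<sigma> X) = act_top r \<sigma> X"
  unfolding outer_def act_top_def by auto

lemma outer_right_comp: "outer (right_comp r \<sigma> X) = act_bot r \<sigma> X"
  unfolding outer_def act_bot_def by auto

lemma in_middle_left_comp: "in_middle (left_comp r \<sigma> X) \<longleftrightarrow> act_top r \<sigma> X = {}"
  unfolding in_middle_def ball_left_comp act_top_def by auto

lemma in_middle_right_comp: "in_middle (right_comp r \<sigma> X) \<longleftrightarrow> act_bot r \<sigma> X = {}"
  unfolding in_middle_def ball_right_comp act_bot_def by auto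

lemma act_bot_act_top: "act_bot r \<sigma> (act_top r \<sigma> X) = act_both r \<sigma> X"
  unfolding act_top_def act_bot_def act_both_def by auto

lemma act_bot_empty: "act_bot r \<sigma> {} = {}"
  unfolding act_bot_def by auto

lemma act_bot_Top: "act_bot r \<sigma> {Top i} = {Top i}"
  unfolding act_bot_def by auto

text \<open>Reduces an equality of two diagrams on the same points to one inclusion.\<close>

lemma partition_on_subset_eq:
  assumes P: "partition_on A P" and Q: "partition_on A Q" and sub: "P \<subseteq> Q"
  shows "P = Q"
proof
  show "Q \<subseteq> P"
  proof
    fix B assume B: "B \<in> Q"
    have "B \<noteq> {}" using B partition_onD3[OF Q] by metis
    then obtain x where x: "x \<in> B" by blast
    have "x \<in> \<Union>P" using x B partition_onD1[OF P] partition_onD1[OF Q] by blast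
    then obtain B' where B': "B' \<in> P" "x \<in> B'" by blast
    then have "B' \<in> Q" using sub by blast
    then have "B = B'" by (rule partition_on_unique[OF Q B _ x B'(2)])
    then show "B \<in> P" using B' by simp
  qed
qed (rule sub)

context
  fixes r k :: nat and \<sigma> :: "nat \<Rightarrow> nat"
  assumes \<sigma>: "\<sigma> permutes {1..r}" and rk: "r \<le> k"
begin

text \<open>The empty set that is removed is the image of the blocks whose components stay in the
  middle row, which are the components that composition discards.\<close>

lemma compose_pdiag_left:
  assumes w: "w \<in> Pk k"
  shows "compose (pdiag r k \<sigma>) w = (act_top r \<sigma> ` w - {{}}) \<union> (\<lambda>i. {Top i}) ` {r+1..k}"
proof -
  have "{C \<in> comps (pdiag r k \<sigma>) w. \<not> in_middle C}
      = left_comp r \<sigma> ` {X \<in> w. act_top r \<sigma> X \<noteq> {}} \<union> (\<lambda>i. {(0, i)}) ` {r+1..k}"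
    unfolding comps_pdiag_left[OF \<sigma> rk w] by (auto simp: in_middle_left_comp) (auto simp: in_middle_def)
  moreover have "outer {(0, i)} = {Top i}" for i unfolding outer_def by auto
  ultimately show ?thesis
    unfolding compose_def by (auto simp: image_Un image_image outer_left_comp)
qed

lemma compose_pdiag_right:
  assumes w: "w \<in> Pk k"
  shows "compose w (transp (pdiag r k \<sigma>)) = (act_bot r \<sigma> ` w - {{}}) \<union> (\<lambda>i. {Bot i}) ` {r+1..k}"
proof -
  have "{C \<in> comps w (transp (pdiag r k \<sigma>)). \<not> in_middle C}
      = right_comp r \<sigma> ` {X \<in> w. act_bot r \<sigma> X \<noteq> {}} \<union> (\<lambda>i. {(2, i)}) ` {r+1..k}"
    unfolding comps_pdiag_right[OF \<sigma> rk w] by (auto simp: in_middle_right_comp) (auto simp: in_middle_def)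
  moreover have "outer {(2, i)} = {Bot i}" for i unfolding outer_def by auto
  ultimately show ?thesis
    unfolding compose_def by (auto simp: image_Un image_image outer_right_comp)
qed

lemma compose_pdiag_left_Pk:
  assumes w: "w \<in> Pk k"
  shows "compose (pdiag r k \<sigma>) w \<in> Pk k"
proof -
  have split: "{1..k} = {1..r} \<union> {r+1..k}" using rk by auto
  have "partition_on (act_top r \<sigma> (pts k)) (act_top r \<sigma> ` w - {{}})"
  proof (rule partition_on_transform)
    show "partition_on (pts k) w" using w by (simp add: Pk_def)
    show "\<Union>(act_top r \<sigma> ` P) = act_top r \<sigma> (\<Union>P)" for P unfolding act_top_def by blast
    show "disjnt (act_top r \<sigma> p) (act_top r \<sigma> q)" if "disjnt p q" for p q
      using that permutes_inj[OF \<sigma>] unfolding act_top_def disjnt_def by (auto simp: inj_eq)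
  qed
  moreover have "act_top r \<sigma> (pts k) = Top ` \<sigma> ` {1..r} \<union> Bot ` {1..k}"
    using rk unfolding act_top_def by auto
  then have "act_top r \<sigma> (pts k) = Top ` {1..r} \<union> Bot ` {1..k}" using permutes_image[OF \<sigma>] by simp
  moreover have "partition_on (Top ` {r+1..k}) ((\<lambda>i. {Top i}) ` {r+1..k})"
    by (rule partition_on_singleton_image) (simp add: inj_on_def)
  ultimately have "partition_on (Top ` {1..r} \<union> Bot ` {1..k} \<union> Top ` {r+1..k}) (compose (pdiag r k \<sigma>) w)"
    unfolding compose_pdiag_left[OF w] by (intro partition_on_Un) auto
  moreover have "Top ` {1..r} \<union> Bot ` {1..k} \<union> Top ` {r+1..k} = pts k"
    unfolding pts_def split image_Un by blast
  ultimately show ?thesis by (simp add: Pk_def)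
qed

lemma compose_pdiag_right_Pk:
  assumes w: "w \<in> Pk k"
  shows "compose w (transp (pdiag r k \<sigma>)) \<in> Pk k"
proof -
  have split: "{1..k} = {1..r} \<union> {r+1..k}" using rk by auto
  have "partition_on (act_bot r \<sigma> (pts k)) (act_bot r \<sigma> ` w - {{}})"
  proof (rule partition_on_transform)
    show "partition_on (pts k) w" using w by (simp add: Pk_def)
    show "\<Union>(act_bot r \<sigma> ` P) = act_bot r \<sigma> (\<Union>P)" for P unfolding act_bot_def by blast
    show "disjnt (act_bot r \<sigma> p) (act_bot r \<sigma> q)" if "disjnt p q" for p q
      using that permutes_inj[OF \<sigma>] unfolding act_bot_def disjnt_def by (auto simp: inj_eq)
  qed
  moreover have "act_bot r \<sigma> (pts k) = Top ` {1..k} \<union> Bot ` \<sigma> ` {1..r}"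
    using rk unfolding act_bot_def by auto
  then have "act_bot r \<sigma> (pts k) = Top ` {1..k} \<union> Bot ` {1..r}" using permutes_image[OF \<sigma>] by simp
  moreover have "partition_on (Bot ` {r+1..k}) ((\<lambda>i. {Bot i}) ` {r+1..k})"
    by (rule partition_on_singleton_image) (simp add: inj_on_def)
  ultimately have "partition_on (Top ` {1..k} \<union> Bot ` {1..r} \<union> Bot ` {r+1..k}) (compose w (transp (pdiag r k \<sigma>)))"
    unfolding compose_pdiag_right[OF w] by (intro partition_on_Un) auto
  moreover have "Top ` {1..k} \<union> Bot ` {1..r} \<union> Bot ` {r+1..k} = pts k"
    unfolding pts_def split image_Un by blast
  ultimately show ?thesis by (simp add: Pk_def)
qed

lemma compose_pdiag_conj:
  assumes w: "w \<in> Pk k"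
  shows "compose (compose (pdiag r k \<sigma>) w) (transp (pdiag r k \<sigma>))
    = (act_both r \<sigma> ` w - {{}}) \<union> (\<lambda>i. {Top i}) ` {r+1..k} \<union> (\<lambda>i. {Bot i}) ` {r+1..k}"
proof -
  \<comment> \<open>A block emptied by the first stacking remains empty under the second, so
    discarding the empty set twice amounts to discarding it once.\<close>
  have "act_bot r \<sigma> ` (act_top r \<sigma> ` w - {{}}) - {{}} = act_both r \<sigma> ` w - {{}}"
    using act_bot_empty[of r \<sigma>] by (auto simp: act_bot_act_top[symmetric])
  moreover have "act_bot r \<sigma> ` (\<lambda>i. {Top i}) ` {r+1..k} - {{}} = (\<lambda>i. {Top i}) ` {r+1..k}"
    by (auto simp: image_image act_bot_Top)
  ultimately have "act_bot r \<sigma> ` ((act_top r \<sigma> ` w - {{}}) \<union> (\<lambda>i. {Top i}) ` {r+1..k}) - {{}}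
      = (act_both r \<sigma> ` w - {{}}) \<union> (\<lambda>i. {Top i}) ` {r+1..k}"
    by (simp only: image_Un Un_Diff)
  moreover have "compose (compose (pdiag r k \<sigma>) w) (transp (pdiag r k \<sigma>))
      = (act_bot r \<sigma> ` compose (pdiag r k \<sigma>) w - {{}}) \<union> (\<lambda>i. {Bot i}) ` {r+1..k}"
    by (rule compose_pdiag_right[OF compose_pdiag_left_Pk[OF w]])
  ultimately show ?thesis by (simp only: compose_pdiag_left[OF w])
qed

end

section \<open>Symmetric diagrams and the data that define them\<close>

lemma symd_eq: "symd \<pi> D = (\<lambda>B. Top ` B \<union> Bot ` B) ` D \<union> image Top ` (\<pi> - D) \<union> image Bot ` (\<pi> - D)"
  unfolding symd_def by auto

lemma symd_iff: "X \<in> symd \<pi> D \<longleftrightarrow>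
    (\<exists>B\<in>D. X = Top ` B \<union> Bot ` B) \<or> (\<exists>B\<in>\<pi> - D. X = Top ` B) \<or> (\<exists>B\<in>\<pi> - D. X = Bot ` B)"
  by (simp only: symd_eq Un_iff image_iff disj_assoc)

text \<open>Doubled, top and bottom blocks are told apart by the rows that they meet. Only the empty
  set would blur the distinction.\<close>

lemma symd_mem:
  assumes "{} \<notin> \<pi>" "D \<subseteq> \<pi>" "B \<noteq> {}"
  shows "Top ` B \<union> Bot ` B \<in> symd \<pi> D \<longleftrightarrow> B \<in> D" "Top ` B \<in> symd \<pi> D \<longleftrightarrow> B \<in> \<pi> - D"
    "Bot ` B \<in> symd \<pi> D \<longleftrightarrow> B \<in> \<pi> - D"
proof -
  have inj: "inj Top" "inj Bot" by (auto intro: injI)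
  have TB: "Top ` A \<union> Bot ` A = Top ` A' \<union> Bot ` A' \<longleftrightarrow> A = A'" for A A'
    by (auto simp: set_eq_iff)
  have T: "Top ` A = Top ` A' \<longleftrightarrow> A = A'" "Bot ` A = Bot ` A' \<longleftrightarrow> A = A'" for A A'
    using inj by (auto simp: inj_image_eq_iff)
  have ne: "Top ` A \<union> Bot ` A \<noteq> Top ` A'" "Top ` A \<union> Bot ` A \<noteq> Bot ` A'"
    "Top ` A \<noteq> Bot ` A'" if A: "A \<noteq> {}" for A A' :: "nat set"
  proof -
    obtain a where "a \<in> A" using A by blast
    then have "Top a \<in> Top ` A" "Bot a \<in> Bot ` A" by (rule imageI)+
    moreover have "Bot a \<notin> Top ` A'" "Top a \<notin> Bot ` A'" by auto
    ultimately show "Top ` A \<union> Bot ` A \<noteq> Top ` A'" "Top ` A \<union> Bot ` A \<noteq> Bot ` A'"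
      "Top ` A \<noteq> Bot ` A'" by (metis UnI1 UnI2)+
  qed
  have neD: "A \<noteq> {}" if "A \<in> D" for A using that assms by auto
  show "Top ` B \<union> Bot ` B \<in> symd \<pi> D \<longleftrightarrow> B \<in> D"
  proof
    assume "Top ` B \<union> Bot ` B \<in> symd \<pi> D"
    then obtain B' where "B' \<in> D" "Top ` B \<union> Bot ` B = Top ` B' \<union> Bot ` B'"
      unfolding symd_eq using ne(1,2)[OF assms(3)] by fast
    then show "B \<in> D" by (simp add: TB)
  qed (auto simp: symd_eq)
  show "Top ` B \<in> symd \<pi> D \<longleftrightarrow> B \<in> \<pi> - D"
  proof
    assume "Top ` B \<in> symd \<pi> D"
    then obtain B' where "B' \<in> \<pi> - D" "Top ` B = Top ` B'"
      unfolding symd_iff using ne(1)[OF neD, of _ B] ne(3)[OF assms(3)] by fastforce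
    then show "B \<in> \<pi> - D" by (simp only: T)
  qed (auto simp: symd_eq)
  show "Bot ` B \<in> symd \<pi> D \<longleftrightarrow> B \<in> \<pi> - D"
  proof
    assume "Bot ` B \<in> symd \<pi> D"
    then have "(\<exists>B'\<in>D. Bot ` B = Top ` B' \<union> Bot ` B') \<or> (\<exists>B'\<in>\<pi> - D. Bot ` B = Top ` B')
        \<or> (\<exists>B'\<in>\<pi> - D. Bot ` B = Bot ` B')"
      by (simp only: symd_iff)
    then show "B \<in> \<pi> - D"
    proof (elim disjE bexE)
      fix B' assume "B' \<in> D" "Bot ` B = Top ` B' \<union> Bot ` B'"
      then show ?thesis using ne(2)[OF neD, of B' B] by simp
    next
      fix B' assume B': "Bot ` B = Top ` B'"
      then have "B' \<noteq> {}" using assms(3) by auto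
      then show ?thesis using B' ne(3)[of B' B] by simp
    next
      fix B' assume "B' \<in> \<pi> - D" "Bot ` B = Bot ` B'"
      then show ?thesis by (simp only: T)
    qed
  qed (auto simp: symd_eq)
qed

lemma symd_in_Pk:
  assumes \<pi>: "partition_on {1..k} \<pi>" and D: "D \<subseteq> \<pi>"
  shows "symd \<pi> D \<in> Pk k"
  unfolding Pk_def mem_Collect_eq
proof (rule partition_onI)
  have U: "\<Union>\<pi> = {1..k}" using partition_onD1[OF \<pi>] by simp
  have "\<Union>(symd \<pi> D) = Top ` (\<Union>D \<union> \<Union>(\<pi> - D)) \<union> Bot ` (\<Union>D \<union> \<Union>(\<pi> - D))"
    unfolding symd_eq by auto
  also have "\<Union>D \<union> \<Union>(\<pi> - D) = {1..k}" using D U by blast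
  finally show "\<Union>(symd \<pi> D) = pts k" by (simp add: pts_def)
  show "{} \<notin> symd \<pi> D" using partition_onD3[OF \<pi>] D unfolding symd_eq by auto
  fix p q assume pq: "p \<in> symd \<pi> D" "q \<in> symd \<pi> D" "p \<noteq> q"
  have form: "\<exists>B\<in>\<pi>. B \<in> D \<and> X = Top ` B \<union> Bot ` B \<or> B \<notin> D \<and> (X = Top ` B \<or> X = Bot ` B)"
    if "X \<in> symd \<pi> D" for X using that D unfolding symd_eq by auto
  obtain B where B: "B \<in> \<pi>" "B \<in> D \<and> p = Top ` B \<union> Bot ` B \<or> B \<notin> D \<and> (p = Top ` B \<or> p = Bot ` B)"
    using form[OF pq(1)] by blast
  obtain B' where B': "B' \<in> \<pi>" "B' \<in> D \<and> q = Top ` B' \<union> Bot ` B' \<or> B' \<notin> D \<and> (q = Top ` B' \<or> q = Bot ` B')"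
    using form[OF pq(2)] by blast
  show "disjnt p q"
  proof (cases "B = B'")
    case True
    then show ?thesis using B(2) B'(2) pq(3) by (auto simp: disjnt_def)
  next
    case False
    then have "B \<inter> B' = {}" using partition_onD2[OF \<pi>] B(1) B'(1) by (auto simp: disjoint_def)
    then show ?thesis using B(2) B'(2) by (auto simp: disjnt_def)
  qed
qed

section \<open>Fixed symmetric diagrams\<close>

lemma act_both_symd_blocks:
  "act_both r \<sigma> (Top ` B \<union> Bot ` B) = Top ` \<sigma> ` (B \<inter> {1..r}) \<union> Bot ` \<sigma> ` (B \<inter> {1..r})"
  "act_both r \<sigma> (Top ` B) = Top ` \<sigma> ` (B \<inter> {1..r})"
  "act_both r \<sigma> (Bot ` B) = Bot ` \<sigma> ` (B \<inter> {1..r})"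
  unfolding act_both_def by auto

text \<open>In a fixed diagram the columns beyond \<open>r\<close> carry no information; this puts
  their singletons back.\<close>

definition ext_parts :: "nat \<Rightarrow> nat \<Rightarrow> nat set set \<Rightarrow> nat set set" where
  "ext_parts r k P = P \<union> (\<lambda>i. {i}) ` {r+1..k}"

lemma partition_on_ext_parts:
  assumes P: "partition_on {1..r} P" and rk: "r \<le> k"
  shows "partition_on {1..k} (ext_parts r k P)"
proof -
  have "partition_on {r+1..k} ((\<lambda>i. {i}) ` {r+1..k})" by (rule partition_on_singletons)
  with P have "partition_on ({1..r} \<union> {r+1..k}) (P \<union> (\<lambda>i. {i}) ` {r+1..k})"
    by (rule partition_on_Un) auto
  moreover have "{1..r} \<union> {r+1..k} = {1..k}" using rk by auto
  ultimately show ?thesis by (simp only: ext_parts_def)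
qed

lemma ext_parts_inv:
  assumes P: "partition_on {1..r} P"
  shows "{B \<in> ext_parts r k P. B \<subseteq> {1..r}} = P"
proof
  show "{B \<in> ext_parts r k P. B \<subseteq> {1..r}} \<subseteq> P" by (auto simp: ext_parts_def)
  show "P \<subseteq> {B \<in> ext_parts r k P. B \<subseteq> {1..r}}"
    using partition_onD1[OF P] by (auto simp: ext_parts_def)
qed

context
  fixes r k :: nat and \<sigma> :: "nat \<Rightarrow> nat"
  assumes \<sigma>: "\<sigma> permutes {1..r}" and rk: "r \<le> k"
begin

text \<open>Conjugation always produces singletons in both rows beyond \<open>r\<close>, so a fixed
  diagram has them as undistinguished blocks. The remaining blocks lie in \<open>{1..r}\<close>,
  where conjugation is the plain action of \<sigma>.\<close>

lemma symd_fixed_iff: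
  assumes \<pi>: "partition_on {1..k} \<pi>" and D: "D \<subseteq> \<pi>"
  shows "compose (compose (pdiag r k \<sigma>) (symd \<pi> D)) (transp (pdiag r k \<sigma>)) = symd \<pi> D \<longleftrightarrow>
    (\<forall>i\<in>{r+1..k}. {i} \<in> \<pi> - D) \<and> (\<forall>B\<in>\<pi>. B \<subseteq> {1..r} \<longrightarrow> \<sigma> ` B \<in> \<pi>) \<and> (\<forall>B\<in>D. \<sigma> ` B \<in> D)"
    (is "?w' = ?w \<longleftrightarrow> ?sing \<and> ?inv \<and> ?invD")
proof -
  have w: "?w \<in> Pk k" by (rule symd_in_Pk[OF \<pi> D])
  have w': "?w' = (act_both r \<sigma> ` ?w - {{}}) \<union> (\<lambda>i. {Top i}) ` {r+1..k} \<union> (\<lambda>i. {Bot i}) ` {r+1..k}"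
    by (rule compose_pdiag_conj[OF \<sigma> rk w])
  have ne: "{} \<notin> \<pi>" by (rule partition_onD3[OF \<pi>])
  have neB: "B \<noteq> {}" if "B \<in> \<pi>" for B using that ne by metis
  have subB: "B \<subseteq> {1..k}" if "B \<in> \<pi>" for B using that partition_onD1[OF \<pi>] by blast
  note mem = symd_mem[OF ne D]
  show ?thesis
  proof
    assume eq: "?w' = ?w"
    have sing: ?sing
    proof
      fix i assume "i \<in> {r+1..k}"
      then have "{Top i} \<in> ?w'" unfolding w' by simp
      then have "Top ` {i} \<in> ?w" using eq by simp
      then show "{i} \<in> \<pi> - D" using mem(2)[of "{i}"] by simp
    qed
    \<comment> \<open>A distinguished block reaching beyond \<open>r\<close> would have to be one of
      the undistinguished singletons.\<close>
    have subr: "B \<subseteq> {1..r}" if "B \<in> D" for B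
    proof
      fix i assume i: "i \<in> B"
      have B: "B \<in> \<pi>" using that D by blast
      show "i \<in> {1..r}"
      proof (rule ccontr)
        assume "i \<notin> {1..r}"
        then have "i \<in> {r+1..k}" using subB[OF B] i by auto
        then have "{i} \<in> \<pi>" "{i} \<notin> D" using sing by auto
        moreover have "B = {i}" by (rule partition_on_unique[OF \<pi> B \<open>{i} \<in> \<pi>\<close> i]) simp
        ultimately show False using that by simp
      qed
    qed
    have invD: ?invD
    proof
      fix B assume B: "B \<in> D"
      then have Bne: "B \<noteq> {}" using neB D by blast
      have "B \<inter> {1..r} = B" using subr[OF B] by blast
      then have "act_both r \<sigma> (Top ` B \<union> Bot ` B) = Top ` \<sigma> ` B \<union> Bot ` \<sigma> ` B" by (simp add: act_both_symd_blocks)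
      moreover have "Top ` B \<union> Bot ` B \<in> ?w" using mem(1)[OF Bne] B by simp
      moreover have "Top ` \<sigma> ` B \<union> Bot ` \<sigma> ` B \<noteq> {}" using Bne by simp
      ultimately have "Top ` \<sigma> ` B \<union> Bot ` \<sigma> ` B \<in> ?w'" unfolding w' by (metis DiffI UnI1 imageI singletonD)
      then show "\<sigma> ` B \<in> D" using eq mem(1)[of "\<sigma> ` B"] Bne by simp
    qed
    have inv: ?inv
    proof (intro ballI impI)
      fix B assume B: "B \<in> \<pi>" "B \<subseteq> {1..r}"
      show "\<sigma> ` B \<in> \<pi>"
      proof (cases "B \<in> D")
        case True
        then show ?thesis using invD D by blast
      next
        case False
        have Bne: "B \<noteq> {}" using neB B by blast
        have "B \<inter> {1..r} = B" using B(2) by blast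
        then have "act_both r \<sigma> (Top ` B) = Top ` \<sigma> ` B" by (simp add: act_both_symd_blocks)
        moreover have "Top ` B \<in> ?w" using mem(2)[OF Bne] B False by simp
        moreover have "Top ` \<sigma> ` B \<noteq> {}" using Bne by simp
        ultimately have "Top ` \<sigma> ` B \<in> ?w'" unfolding w' by (metis DiffI UnI1 imageI singletonD)
        then show ?thesis using eq mem(2)[of "\<sigma> ` B"] Bne by simp
      qed
    qed
    show "?sing \<and> ?inv \<and> ?invD" using sing inv invD by blast
  next
    assume rhs: "?sing \<and> ?inv \<and> ?invD"
    have sing: "{i} \<in> \<pi> - D" if "i \<in> {r+1..k}" for i using rhs that by blast
    have inv: "\<sigma> ` B \<in> \<pi>" if "B \<in> \<pi>" "B \<subseteq> {1..r}" for B using rhs that by blast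
    have invD: "\<sigma> ` B \<in> D" if "B \<in> D" for B using rhs that by blast
    have cases: "B \<subseteq> {1..r} \<or> (B \<notin> D \<and> B \<inter> {1..r} = {})" if B: "B \<in> \<pi>" for B
    proof (cases "B \<subseteq> {1..r}")
      case False
      then obtain i where i: "i \<in> B" "i \<notin> {1..r}" by blast
      then have i': "i \<in> {r+1..k}" using subB[OF B] by auto
      then have "B = {i}" using sing[OF i'] partition_on_unique[OF \<pi> B _ i(1), of "{i}"] by simp
      then show ?thesis using sing[OF i'] i by auto
    qed simp
    \<comment> \<open>Injectivity makes \<sigma> permute the finite set \<open>D\<close>, so a block
      outside \<open>D\<close> cannot be sent into it.\<close>
    have invc: "\<sigma> ` B \<in> \<pi> - D" if B: "B \<in> \<pi> - D" "B \<subseteq> {1..r}" for B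
    proof -
      have "\<sigma> ` B \<notin> D"
      proof
        assume *: "\<sigma> ` B \<in> D"
        have fin: "finite D" using finite_elements[OF _ \<pi>] D finite_subset by blast
        have "image \<sigma> ` D = D"
          by (rule endo_inj_surj[OF fin])
             (use invD permutes_inj[OF \<sigma>] in \<open>auto simp: inj_on_def inj_image_eq_iff\<close>)
        then obtain B' where "B' \<in> D" "\<sigma> ` B = \<sigma> ` B'" using * by (metis imageE)
        then have "B = B'" using permutes_inj[OF \<sigma>] by (simp add: inj_image_eq_iff)
        then show False using \<open>B' \<in> D\<close> B by simp
      qed
      then show ?thesis using inv that by simp
    qed
    \<comment> \<open>One inclusion is enough, because both sides are partitions of
      \<open>pts k\<close>.\<close>
    have sub: "?w' \<subseteq> ?w"
    proof
      fix X assume "X \<in> ?w'"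
      then consider Y where "Y \<in> ?w" "X = act_both r \<sigma> Y" "X \<noteq> {}" | i where "i \<in> {r+1..k}" "X = Top ` {i}"
        | i where "i \<in> {r+1..k}" "X = Bot ` {i}" unfolding w' by auto
      then show "X \<in> ?w"
      proof cases
        case 1
        from 1(1) show ?thesis unfolding symd_iff[of Y]
        proof (elim disjE bexE)
          fix B assume B: "B \<in> D" "Y = Top ` B \<union> Bot ` B"
          then have "B \<subseteq> {1..r}" using cases[of B] D by blast
          then have "B \<inter> {1..r} = B" by blast
          then have "X = Top ` \<sigma> ` B \<union> Bot ` \<sigma> ` B" using 1(2) B(2) by (simp only: act_both_symd_blocks)
          moreover have "B \<noteq> {}" using neB D B(1) by blast
          ultimately show ?thesis using mem(1)[of "\<sigma> ` B"] invD[OF B(1)] by simp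
        next
          fix B assume B: "B \<in> \<pi> - D" "Y = Top ` B"
          have X: "X = Top ` \<sigma> ` (B \<inter> {1..r})" using 1(2) B(2) by (simp only: act_both_symd_blocks)
          then have "B \<inter> {1..r} \<noteq> {}" using 1(3) by auto
          then have "B \<subseteq> {1..r}" using cases[of B] B(1) by blast
          then have "B \<inter> {1..r} = B" "\<sigma> ` B \<in> \<pi> - D" using invc[OF B(1)] by blast+
          moreover have "B \<noteq> {}" using neB B(1) by blast
          ultimately show ?thesis using X mem(2)[of "\<sigma> ` B"] by simp
        next
          fix B assume B: "B \<in> \<pi> - D" "Y = Bot ` B"
          have X: "X = Bot ` \<sigma> ` (B \<inter> {1..r})" using 1(2) B(2) by (simp only: act_both_symd_blocks)
          then have "B \<inter> {1..r} \<noteq> {}" using 1(3) by auto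
          then have "B \<subseteq> {1..r}" using cases[of B] B(1) by blast
          then have "B \<inter> {1..r} = B" "\<sigma> ` B \<in> \<pi> - D" using invc[OF B(1)] by blast+
          moreover have "B \<noteq> {}" using neB B(1) by blast
          ultimately show ?thesis using X mem(3)[of "\<sigma> ` B"] by simp
        qed
      next
        case 2
        then show ?thesis using mem(2)[of "{i}"] sing[OF 2(1)] by simp
      next
        case 3
        then show ?thesis using mem(3)[of "{i}"] sing[OF 3(1)] by simp
      qed
    qed
    have "?w' \<in> Pk k" by (rule compose_pdiag_right_Pk[OF \<sigma> rk compose_pdiag_left_Pk[OF \<sigma> rk w]])
    then show "?w' = ?w"
      using w sub partition_on_subset_eq[of "pts k" ?w' ?w] unfolding Pk_def by blast
  qed
qed

lemma inv_parts_symd: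
  assumes PD: "(P, D) \<in> inv_parts \<sigma> {1..r}"
  shows "D \<subseteq> ext_parts r k P"
    "compose (compose (pdiag r k \<sigma>) (symd (ext_parts r k P) D)) (transp (pdiag r k \<sigma>)) = symd (ext_parts r k P) D"
proof -
  note p = inv_partsD[OF PD]
  show D: "D \<subseteq> ext_parts r k P" using p(2) by (auto simp: ext_parts_def)
  have sub: "B \<subseteq> {1..r}" if "B \<in> D" for B using that p(2) partition_onD1[OF p(1)] by blast
  show "compose (compose (pdiag r k \<sigma>) (symd (ext_parts r k P) D)) (transp (pdiag r k \<sigma>)) = symd (ext_parts r k P) D"
    unfolding symd_fixed_iff[OF partition_on_ext_parts[OF p(1) rk] D]
  proof (intro conjI ballI impI)
    fix i assume i: "i \<in> {r+1..k}"
    then have "{i} \<in> ext_parts r k P" by (simp add: ext_parts_def)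
    moreover have "{i} \<notin> D" using sub[of "{i}"] i by auto
    ultimately show "{i} \<in> ext_parts r k P - D" by simp
  next
    fix B assume "B \<in> ext_parts r k P" "B \<subseteq> {1..r}"
    then have "B \<in> P" using ext_parts_inv[OF p(1)] by blast
    then show "\<sigma> ` B \<in> ext_parts r k P" using p(3) by (simp add: ext_parts_def)
  next
    fix B assume "B \<in> D"
    then show "\<sigma> ` B \<in> D" by (rule p(4))
  qed
qed

text \<open>Deleting the singletons beyond \<open>r\<close> recovers \<open>P\<close>. The image of
  a block inside \<open>{1..r}\<close> stays inside \<open>{1..r}\<close>, so it is never one of the
  deleted singletons and invariance is inherited.\<close>

lemma fixed_imp_inv_parts:
  assumes \<pi>: "partition_on {1..k} \<pi>" and D: "D \<subseteq> \<pi>"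
    and "compose (compose (pdiag r k \<sigma>) (symd \<pi> D)) (transp (pdiag r k \<sigma>)) = symd \<pi> D"
  shows "\<exists>P. (P, D) \<in> inv_parts \<sigma> {1..r} \<and> \<pi> = ext_parts r k P"
proof -
  let ?S = "(\<lambda>i. {i}) ` {r+1..k}"
  have rhs: "(\<forall>i\<in>{r+1..k}. {i} \<in> \<pi> - D)" "(\<forall>B\<in>\<pi>. B \<subseteq> {1..r} \<longrightarrow> \<sigma> ` B \<in> \<pi>)" "(\<forall>B\<in>D. \<sigma> ` B \<in> D)"
    using assms(3) unfolding symd_fixed_iff[OF \<pi> D] by auto
  have S: "?S \<subseteq> \<pi>" using rhs(1) by auto
  have "partition_on ({1..k} - \<Union>?S) (\<pi> - ?S)" by (rule partition_on_Diff[OF \<pi> S])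
  moreover have "{1..k} - \<Union>?S = {1..r}" using rk by auto
  ultimately have part: "partition_on {1..r} (\<pi> - ?S)" by simp
  have "(\<pi> - ?S, D) \<in> inv_parts \<sigma> {1..r}"
  proof (rule inv_partsI[OF part])
    show "D \<subseteq> \<pi> - ?S" using D rhs(1) by blast
    show "\<sigma> ` B \<in> \<pi> - ?S" if B: "B \<in> \<pi> - ?S" for B
    proof -
      have sub: "B \<subseteq> {1..r}" using B partition_onD1[OF part] by blast
      have ne: "B \<noteq> {}" using B partition_onD3[OF part] by metis
      have "\<sigma> ` B \<subseteq> {1..r}" using sub permutes_image[OF \<sigma>] by blast
      moreover have "\<not> X \<subseteq> {1..r}" if "X \<in> ?S" for X using that by auto
      ultimately show ?thesis using rhs(2) B sub by blast
    qed
    show "\<sigma> ` B \<in> D" if "B \<in> D" for B using that rhs(3) by blast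
  qed
  moreover have "\<pi> = ext_parts r k (\<pi> - ?S)" using S by (auto simp: ext_parts_def)
  ultimately show ?thesis by blast
qed

end

section \<open>Propagating blocks, loops and the induced permutation\<close>

lemma prop_blocks_symd:
  assumes "{} \<notin> \<pi>" "D \<subseteq> \<pi>"
  shows "prop_blocks (symd \<pi> D) = (\<lambda>B. Top ` B \<union> Bot ` B) ` D"
proof
  show "prop_blocks (symd \<pi> D) \<subseteq> (\<lambda>B. Top ` B \<union> Bot ` B) ` D"
    unfolding prop_blocks_def symd_eq is_prop_def by auto
  show "(\<lambda>B. Top ` B \<union> Bot ` B) ` D \<subseteq> prop_blocks (symd \<pi> D)"
  proof
    fix X assume "X \<in> (\<lambda>B. Top ` B \<union> Bot ` B) ` D"
    then obtain B where B: "B \<in> D" "X = Top ` B \<union> Bot ` B" by blast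
    then have "B \<noteq> {}" using assms by auto
    then obtain i where "i \<in> B" by blast
    then have "is_prop X" unfolding is_prop_def B(2) by blast
    moreover have "X \<in> symd \<pi> D" using B unfolding symd_eq by blast
    ultimately show "X \<in> prop_blocks (symd \<pi> D)" unfolding prop_blocks_def by blast
  qed
qed

lemma top_idx_dbl [simp]: "top_idx (Top ` B \<union> Bot ` B) = B"
  unfolding top_idx_def by auto

lemma inj_on_dbl: "inj_on (\<lambda>B. Top ` B \<union> Bot ` B) D"
  by (rule inj_on_inverseI[where g = top_idx]) simp

lemma card_prop_blocks_symd:
  "{} \<notin> \<pi> \<Longrightarrow> D \<subseteq> \<pi> \<Longrightarrow> card (prop_blocks (symd \<pi> D)) = card D"
  by (simp add: prop_blocks_symd card_image inj_on_dbl)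

lemma symd_inj:
  assumes "{} \<notin> \<pi>" "D \<subseteq> \<pi>" "{} \<notin> \<pi>'" "D' \<subseteq> \<pi>'" "symd \<pi> D = symd \<pi>' D'"
  shows "\<pi> = \<pi>'" "D = D'"
proof -
  have D: "B \<in> D \<longleftrightarrow> B \<in> D'" for B
    using symd_mem(1)[OF assms(1,2), of B] symd_mem(1)[OF assms(3,4), of B] assms
    by (cases "B = {}") auto
  moreover have "B \<in> \<pi> - D \<longleftrightarrow> B \<in> \<pi>' - D'" for B
    using symd_mem(2)[OF assms(1,2), of B] symd_mem(2)[OF assms(3,4), of B] assms
    by (cases "B = {}") auto
  ultimately show "D = D'" "\<pi> = \<pi>'" using assms(2,4) by blast+
qed

text \<open>Disjoint blocks have distinct largest elements, so sorting these enumerates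
  \<open>D\<close> in the order that \<open>prop_block\<close> uses; \<open>j - 1\<close> translates
  from positions counted from 1 to list indices.\<close>

lemma sorted_by_Max:
  assumes part: "partition_on A P" and fin: "finite A" and D: "D \<subseteq> P"
  obtains b where "bij_betw b {1..card D} D"
    "\<And>j. j \<in> {1..card D} \<Longrightarrow> Max (b j) = sorted_list_of_set (Max ` D) ! (j - 1)"
proof -
  let ?L = "sorted_list_of_set (Max ` D)"
  have finB: "finite B" "B \<noteq> {}" if "B \<in> D" for B
  proof -
    have "B \<subseteq> A" using that D partition_onD1[OF part] by blast
    then show "finite B" using fin by (rule finite_subset)
    show "B \<noteq> {}" using that D partition_onD3[OF part] by blast
  qed
  have finD: "finite D" using finite_elements[OF fin part] D finite_subset by blast
  have inj: "inj_on Max D"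
  proof (rule inj_onI)
    fix B B' assume B: "B \<in> D" "B' \<in> D" "Max B = Max B'"
    have "Max B \<in> B" "Max B' \<in> B'" using finB B(1,2) by (auto intro: Max_in)
    then show "B = B'" using partition_on_unique[OF part, of B B' "Max B"] B D by auto
  qed
  have len: "length ?L = card D" using finD inj by (simp add: card_image)
  have "bij_betw ((!) ?L) {..<card D} (Max ` D)"
    by (rule bij_betw_nth) (use len finD in auto)
  moreover have "bij_betw (\<lambda>j :: nat. j - 1) {1..card D} {..<card D}"
    by (rule bij_betw_byWitness[where f' = Suc]) auto
  ultimately have "bij_betw ((!) ?L \<circ> (\<lambda>j. j - 1)) {1..card D} (Max ` D)"
    by (rule bij_betw_trans[rotated])
  moreover have "bij_betw (inv_into D Max) (Max ` D) D"
    using inj by (simp add: bij_betw_inv_into bij_betw_imageI)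
  ultimately have bij: "bij_betw (inv_into D Max \<circ> ((!) ?L \<circ> (\<lambda>j. j - 1))) {1..card D} D"
    by (rule bij_betw_trans)
  have "Max ((inv_into D Max \<circ> ((!) ?L \<circ> (\<lambda>j. j - 1))) j) = ?L ! (j - 1)" if j: "j \<in> {1..card D}" for j
  proof -
    have "?L ! (j - 1) \<in> set ?L" using j len by (intro nth_mem) auto
    then have "?L ! (j - 1) \<in> Max ` D" using finD by simp
    then show ?thesis by (simp add: f_inv_into_f)
  qed
  with bij show ?thesis by (rule that)
qed

context
  fixes r k :: nat and \<sigma> :: "nat \<Rightarrow> nat" and P D :: "nat set set"
  assumes \<sigma>: "\<sigma> permutes {1..r}" and rk: "r \<le> k" and PD: "(P, D) \<in> inv_parts \<sigma> {1..r}"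
begin

text \<open>A component stays in the middle row exactly when it comes from a top singleton beyond
  \<open>r\<close>: any other block has bottom points, or has top points that \<sigma> carries to
  the upper row.\<close>

lemma loops_inv_parts: "loops (pdiag r k \<sigma>) (symd (ext_parts r k P) D) = k - r"
proof -
  note p = inv_partsD[OF PD]
  let ?w = "symd (ext_parts r k P) D"
  have \<pi>: "partition_on {1..k} (ext_parts r k P)" by (rule partition_on_ext_parts[OF p(1) rk])
  have Dsub: "D \<subseteq> ext_parts r k P" by (rule inv_parts_symd(1)[OF \<sigma> rk PD])
  have w: "?w \<in> Pk k" by (rule symd_in_Pk[OF \<pi> Dsub])
  have ne: "{} \<notin> ext_parts r k P" by (rule partition_onD3[OF \<pi>])
  have mid: "act_top r \<sigma> X = {} \<longleftrightarrow> (\<exists>i\<in>{r+1..k}. X = {Top i})" if X: "X \<in> ?w" for X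
  proof
    assume act_top: "act_top r \<sigma> X = {}"
    from X show "\<exists>i\<in>{r+1..k}. X = {Top i}" unfolding symd_iff
    proof (elim disjE bexE)
      fix B assume B: "B \<in> D" "X = Top ` B \<union> Bot ` B"
      have "B \<noteq> {}" using B(1) ne Dsub by (metis subsetD)
      then obtain i where "i \<in> B" by blast
      then have "Bot i \<in> act_top r \<sigma> X" unfolding act_top_def B(2) by blast
      then show ?thesis using act_top by simp
    next
      fix B assume B: "B \<in> ext_parts r k P - D" "X = Top ` B"
      show ?thesis
      proof (cases "B \<in> P")
        case True
        then have "B \<noteq> {}" using partition_onD3[OF p(1)] by metis
        then obtain i where i: "i \<in> B" by blast
        then have "i \<in> {1..r}" using True partition_onD1[OF p(1)] by blast
        then have "Top (\<sigma> i) \<in> act_top r \<sigma> X" using i unfolding act_top_def B(2) by blast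
        then show ?thesis using act_top by simp
      next
        case False
        then have "B \<in> (\<lambda>i. {i}) ` {r+1..k}" using B(1) by (simp add: ext_parts_def)
        then show ?thesis using B(2) by auto
      qed
    next
      fix B assume B: "B \<in> ext_parts r k P - D" "X = Bot ` B"
      have "B \<noteq> {}" using B(1) ne by (metis DiffD1)
      then obtain i where "i \<in> B" by blast
      then have "Bot i \<in> act_top r \<sigma> X" unfolding act_top_def B(2) by blast
      then show ?thesis using act_top by simp
    qed
  next
    assume "\<exists>i\<in>{r+1..k}. X = {Top i}"
    then show "act_top r \<sigma> X = {}" unfolding act_top_def by auto
  qed
  have sing: "{Top i} \<in> ?w" if i: "i \<in> {r+1..k}" for i
  proof -
    have "{i} \<in> ext_parts r k P" using i by (simp add: ext_parts_def)
    moreover have "{i} \<notin> D" 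
    proof
      assume "{i} \<in> D"
      then have "i \<in> {1..r}" using p(2) partition_onD1[OF p(1)] by blast
      then show False using i by simp
    qed
    ultimately have "Top ` {i} \<in> ?w" using symd_mem(2)[OF ne Dsub, of "{i}"] by simp
    then show ?thesis by simp
  qed
  have cA: "left_comp r \<sigma> {Top i} = {(1, i)}" if "i \<in> {r+1..k}" for i
    using that unfolding left_comp_def by auto
  have "{C \<in> comps (pdiag r k \<sigma>) ?w. in_middle C} = (\<lambda>i. {(1, i)}) ` {r+1..k}"
  proof
    show "{C \<in> comps (pdiag r k \<sigma>) ?w. in_middle C} \<subseteq> (\<lambda>i. {(1, i)}) ` {r+1..k}"
    proof
      fix C assume C: "C \<in> {C \<in> comps (pdiag r k \<sigma>) ?w. in_middle C}"
      have "\<not> in_middle {(0, i)}" for i by (simp add: in_middle_def)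
      then obtain X where X: "X \<in> ?w" "C = left_comp r \<sigma> X"
        using C unfolding comps_pdiag_left[OF \<sigma> rk w] by auto
      then have "act_top r \<sigma> X = {}" using C by (simp add: in_middle_left_comp)
      then obtain i where "i \<in> {r+1..k}" "X = {Top i}" using mid[OF X(1)] by blast
      then show "C \<in> (\<lambda>i. {(1, i)}) ` {r+1..k}" using X(2) cA by simp
    qed
    show "(\<lambda>i. {(1, i)}) ` {r+1..k} \<subseteq> {C \<in> comps (pdiag r k \<sigma>) ?w. in_middle C}"
    proof
      fix C assume "C \<in> (\<lambda>i. {(1 :: nat, i)}) ` {r+1..k}"
      then obtain i where i: "i \<in> {r+1..k}" "C = {(1, i)}" by blast
      then have "C = left_comp r \<sigma> {Top i}" using cA by simp
      then have "C \<in> comps (pdiag r k \<sigma>) ?w"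
        using sing[OF i(1)] unfolding comps_pdiag_left[OF \<sigma> rk w] by blast
      then show "C \<in> {C \<in> comps (pdiag r k \<sigma>) ?w. in_middle C}" using i(2) by (simp add: in_middle_def)
    qed
  qed
  moreover have "card ((\<lambda>i. {(1 :: nat, i)}) ` {r+1..k}) = k - r"
    by (subst card_image) (auto simp: inj_on_def)
  ultimately show ?thesis unfolding loops_def by simp
qed

text \<open>Along the enumeration \<open>b\<close> of \<open>D\<close> by largest elements, the
  permutation in the module action becomes the action of \<sigma> on the distinguished blocks. Its
  definition reads the target off the conjugated diagram, which here is the diagram itself.\<close>

lemma sigma_dw_inv_parts:
  assumes m: "card D = m"
  defines "s \<equiv> sigma_dw m (pdiag r k \<sigma>) (symd (ext_parts r k P) D)"
  shows "\<exists>b. bij_betw b {1..m} D \<and> s permutes {1..m} \<and> (\<forall>j\<in>{1..m}. b (s j) = \<sigma> ` b j)"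
proof -
  note p = inv_partsD[OF PD]
  let ?w = "symd (ext_parts r k P) D"
  have \<pi>: "partition_on {1..k} (ext_parts r k P)" by (rule partition_on_ext_parts[OF p(1) rk])
  have Dsub: "D \<subseteq> ext_parts r k P" by (rule inv_parts_symd(1)[OF \<sigma> rk PD])
  have w: "?w \<in> Pk k" by (rule symd_in_Pk[OF \<pi> Dsub])
  have ne: "{} \<notin> ext_parts r k P" by (rule partition_onD3[OF \<pi>])
  have neD: "B \<noteq> {}" if "B \<in> D" for B using that ne Dsub by blast
  have subD: "B \<subseteq> {1..r}" if "B \<in> D" for B using that p(2) partition_onD1[OF p(1)] by blast
  obtain b where b: "bij_betw b {1..m} D"
    and Maxb: "\<And>j. j \<in> {1..m} \<Longrightarrow> Max (b j) = sorted_list_of_set (Max ` D) ! (j - 1)"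
    using sorted_by_Max[OF \<pi> _ Dsub] m by auto
  have bD: "b j \<in> D" if "j \<in> {1..m}" for j using b that by (rule bij_betwE[rule_format])
  have injb: "inj_on b {1..m}" by (rule bij_betw_imp_inj_on[OF b])
  have dblw: "Top ` B \<union> Bot ` B \<in> ?w" if "B \<in> D" for B using that unfolding symd_iff by blast
  have pb: "prop_block ?w j = Top ` b j \<union> Bot ` b j" if j: "j \<in> {1..m}" for j
    unfolding prop_block_def prop_blocks_symd[OF ne Dsub] image_image top_idx_dbl
  proof (rule the_equality)
    show "Top ` b j \<union> Bot ` b j \<in> (\<lambda>B. Top ` B \<union> Bot ` B) ` D \<and>
        Max (top_idx (Top ` b j \<union> Bot ` b j)) = sorted_list_of_set (Max ` D) ! (j - 1)"
      using bD[OF j] Maxb[OF j] by simp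
    fix X assume X: "X \<in> (\<lambda>B. Top ` B \<union> Bot ` B) ` D \<and> Max (top_idx X) = sorted_list_of_set (Max ` D) ! (j - 1)"
    then obtain B where B: "B \<in> D" "X = Top ` B \<union> Bot ` B" by blast
    have eq: "Max B = Max (b j)" using X B Maxb[OF j] by simp
    have "Max B \<in> B" "Max (b j) \<in> b j"
      using neD subD finite_subset[OF subD] B(1) bD[OF j] by (auto intro!: Max_in)
    then have "B = b j" using eq partition_on_unique[OF p(1), of B "b j" "Max B"] B(1) bD[OF j] p(2) by auto
    then show "X = Top ` b j \<union> Bot ` b j" using B(2) by simp
  qed
  \<comment> \<open>The component through the \<open>j\<close>-th propagating block meets the top
    row exactly in the image of \<open>b j\<close> under \<sigma>. This image and \<open>b i\<close>
    are both blocks of \<open>P\<close>, so a common point makes them equal.\<close>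
  have cond: "(\<exists>C\<in>comps (pdiag r k \<sigma>) ?w. (\<exists>u\<in>top_idx (prop_block ?w j). (1, u) \<in> C) \<and>
      (\<exists>u. (0, u) \<in> C \<and> Top u \<in> prop_block ?w i)) \<longleftrightarrow> b i = \<sigma> ` b j"
    if j: "j \<in> {1..m}" and i: "i \<in> {1..m}" for i j
    unfolding pb[OF j] pb[OF i] top_idx_dbl
  proof
    let ?X = "Top ` b j \<union> Bot ` b j"
    assume "b i = \<sigma> ` b j"
    moreover obtain u where u: "u \<in> b j" using neD[OF bD[OF j]] by blast
    ultimately have "(1, u) \<in> left_comp r \<sigma> ?X" "(0, \<sigma> u) \<in> left_comp r \<sigma> ?X" "Top (\<sigma> u) \<in> Top ` b i \<union> Bot ` b i"
      using subD[OF bD[OF j]] by auto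
    moreover have "left_comp r \<sigma> ?X \<in> comps (pdiag r k \<sigma>) ?w"
      unfolding comps_pdiag_left[OF \<sigma> rk w] using dblw[OF bD[OF j]] by blast
    ultimately show "\<exists>C\<in>comps (pdiag r k \<sigma>) ?w. (\<exists>u\<in>b j. (1, u) \<in> C) \<and>
      (\<exists>u. (0, u) \<in> C \<and> Top u \<in> Top ` b i \<union> Bot ` b i)" using u by blast
  next
    assume "\<exists>C\<in>comps (pdiag r k \<sigma>) ?w. (\<exists>u\<in>b j. (1, u) \<in> C) \<and>
      (\<exists>u. (0, u) \<in> C \<and> Top u \<in> Top ` b i \<union> Bot ` b i)"
    then obtain C u v where C: "C \<in> comps (pdiag r k \<sigma>) ?w" "u \<in> b j" "(1, u) \<in> C" "(0, v) \<in> C"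
      "Top v \<in> Top ` b i \<union> Bot ` b i" by blast
    then obtain X where X: "X \<in> ?w" "C = left_comp r \<sigma> X"
      unfolding comps_pdiag_left[OF \<sigma> rk w] by auto
    have "Top u \<in> X" using C(3) X(2) by simp
    then have "X = Top ` b j \<union> Bot ` b j"
      using C(2) by (intro Pk_unique[OF w X(1) dblw[OF bD[OF j]], of "Top u"]) auto
    then have "v \<in> \<sigma> ` b j" using C(4) X(2) by auto
    moreover have "v \<in> b i" using C(5) by auto
    ultimately show "b i = \<sigma> ` b j"
      using p(2) by (intro partition_on_unique[OF p(1), of _ _ v]) (use bD[OF i] p(4)[OF bD[OF j]] in auto)
  qed
  have ex: "s j \<in> {1..m} \<and> b (s j) = \<sigma> ` b j" if j: "j \<in> {1..m}" for j
  proof -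
    have "\<sigma> ` b j \<in> b ` {1..m}" using p(4)[OF bD[OF j]] bij_betw_imp_surj_on[OF b] by simp
    then obtain i where i: "i \<in> {1..m}" "b i = \<sigma> ` b j" by auto
    have "s j = i"
      unfolding s_def sigma_dw_def inv_parts_symd(2)[OF \<sigma> rk PD] if_P[OF j]
    proof (rule the_equality)
      show "i \<in> {1..m} \<and> (\<exists>C\<in>comps (pdiag r k \<sigma>) ?w. (\<exists>u\<in>top_idx (prop_block ?w j). (1, u) \<in> C) \<and>
        (\<exists>u. (0, u) \<in> C \<and> Top u \<in> prop_block ?w i))"
        using cond[OF j i(1)] i by blast
      fix i' assume i': "i' \<in> {1..m} \<and> (\<exists>C\<in>comps (pdiag r k \<sigma>) ?w. (\<exists>u\<in>top_idx (prop_block ?w j). (1, u) \<in> C) \<and>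
        (\<exists>u. (0, u) \<in> C \<and> Top u \<in> prop_block ?w i'))"
      then have "b i' = \<sigma> ` b j" using cond[OF j, of i'] by blast
      then show "i' = i" using i i' inj_onD[OF injb, of i' i] by simp
    qed
    then show ?thesis using i by simp
  qed
  have "s permutes {1..m}"
  proof (rule inj_imp_permutes)
    show "inj_on s {1..m}"
    proof (rule inj_onI)
      fix x y assume xy: "x \<in> {1..m}" "y \<in> {1..m}" "s x = s y"
      then have "\<sigma> ` b x = \<sigma> ` b y" using ex[of x] ex[of y] by simp
      then have "b x = b y" using permutes_inj[OF \<sigma>] by (simp add: inj_image_eq_iff)
      then show "x = y" using inj_onD[OF injb _ xy(1,2)] by simp
    qed
    show "s x \<in> {1..m}" if "x \<in> {1..m}" for x using ex[OF that] by simp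
    show "s x = x" if "x \<notin> {1..m}" for x unfolding s_def sigma_dw_def if_not_P[OF that] ..
  qed simp
  then show ?thesis using b ex by blast
qed

end

text \<open>Invariant pairs with \<open>card D = m\<close> correspond bijectively to the diagrams
  that contribute to the trace, and all of these carry the same power of \<open>n\<close>.\<close>

lemma pchar_diag_pdiag:
  assumes \<sigma>: "\<sigma> permutes {1..r}" and rk: "r \<le> k" and m: "m = sum_list (star lam)"
  shows "pchar_diag n k lam (pdiag r k \<sigma>) = (\<Sum>(P, D) | (P, D) \<in> inv_parts \<sigma> {1..r} \<and> card D = m.
    of_nat n ^ (k - r) * sym_char (star lam) m (sigma_dw m (pdiag r k \<sigma>) (symd (ext_parts r k P) D)))"
proof -
  let ?d = "pdiag r k \<sigma>"
  let ?w' = "\<lambda>w. compose (compose ?d w) (transp ?d)"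
  let ?W = "{w \<in> sym_mdiags k m. card (prop_blocks (?w' w)) = m \<and> ?w' w = w}"
  let ?I = "{(P, D). (P, D) \<in> inv_parts \<sigma> {1..r} \<and> card D = m}"
  let ?s = "\<lambda>(P, D). symd (ext_parts r k P) D"
  have ext: "partition_on {1..k} (ext_parts r k P)" "D \<subseteq> ext_parts r k P" "{} \<notin> ext_parts r k P"
    if "(P, D) \<in> inv_parts \<sigma> {1..r}" for P D
  proof -
    show 1: "partition_on {1..k} (ext_parts r k P)"
      by (rule partition_on_ext_parts[OF inv_partsD(1)[OF that] rk])
    show "D \<subseteq> ext_parts r k P" by (rule inv_parts_symd(1)[OF \<sigma> rk that])
    show "{} \<notin> ext_parts r k P" by (rule partition_onD3[OF 1])
  qed
  have fin: "finite (sym_mdiags k m)"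
  proof (rule finite_subset[OF _ finite_Pk])
    show "sym_mdiags k m \<subseteq> Pk k" unfolding sym_mdiags_def using symd_in_Pk by blast
  qed
  have inj: "inj_on ?s ?I"
  proof (rule inj_onI, clarify)
    fix P D P' D' assume PD: "(P, D) \<in> inv_parts \<sigma> {1..r}" "(P', D') \<in> inv_parts \<sigma> {1..r}"
      and eq: "symd (ext_parts r k P) D = symd (ext_parts r k P') D'"
    note inj = symd_inj[OF ext(3,2)[OF PD(1)] ext(3,2)[OF PD(2)] eq]
    have "P = P'"
      using ext_parts_inv[OF inv_partsD(1)[OF PD(1)], of k] ext_parts_inv[OF inv_partsD(1)[OF PD(2)], of k] inj(1)
      by simp
    then show "P = P' \<and> D = D'" using inj(2) by simp
  qed
  have img: "?W = ?s ` ?I"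
  proof
    show "?W \<subseteq> ?s ` ?I"
    proof
      fix w assume w: "w \<in> ?W"
      then obtain \<pi> D where \<pi>: "w = symd \<pi> D" "partition_on {1..k} \<pi>" "D \<subseteq> \<pi>" "card D = m"
        unfolding sym_mdiags_def by blast
      then have "?w' (symd \<pi> D) = symd \<pi> D" using w by simp
      then obtain P where "(P, D) \<in> inv_parts \<sigma> {1..r}" "\<pi> = ext_parts r k P"
        using fixed_imp_inv_parts[OF \<sigma> rk \<pi>(2,3)] by blast
      then show "w \<in> ?s ` ?I" using \<pi> by (intro image_eqI[of _ _ "(P, D)"]) auto
    qed
    show "?s ` ?I \<subseteq> ?W"
    proof
      fix w assume "w \<in> ?s ` ?I"
      then obtain P D where PD: "(P, D) \<in> inv_parts \<sigma> {1..r}" "card D = m" "w = symd (ext_parts r k P) D"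
        by auto
      have fixed: "?w' w = w" unfolding PD(3) by (rule inv_parts_symd(2)[OF \<sigma> rk PD(1)])
      have "w \<in> sym_mdiags k m" unfolding sym_mdiags_def using PD ext[OF PD(1)] by blast
      moreover have "card (prop_blocks w) = m"
        unfolding PD(3) using card_prop_blocks_symd[OF ext(3,2)[OF PD(1)]] PD(2) by simp
      ultimately show "w \<in> ?W" using fixed by simp
    qed
  qed
  have "pchar_diag n k lam ?d = (\<Sum>w\<in>?W. of_nat n ^ loops ?d w * sym_char (star lam) m (sigma_dw m ?d w))"
    unfolding pchar_diag_def Let_def m[symmetric] by (rule sum.inter_filter[OF fin, symmetric])
  also have "\<dots> = (\<Sum>x\<in>?I. of_nat n ^ loops ?d (?s x) * sym_char (star lam) m (sigma_dw m ?d (?s x)))"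
    unfolding img by (subst sum.reindex[OF inj]) simp
  also have "\<dots> = (\<Sum>(P, D)\<in>?I. of_nat n ^ (k - r) * sym_char (star lam) m (sigma_dw m ?d (symd (ext_parts r k P) D)))"
    by (intro sum.cong refl) (auto simp: loops_inv_parts[OF \<sigma> rk])
  finally show ?thesis .
qed

text \<open>The bounds on \<open>i\<close> and \<open>t\<close> only make the product and the inner
  sum finite: for \<open>i > k\<close> both multiplicities are 0 and the factor would be 1, and for
  \<open>t > mult i \<nu>\<close> the Stirling number is 0.\<close>

theorem mainTheorem13:
  fixes n k m :: nat and lam \<kappa> :: "nat list"
  assumes "2 * k \<le> n"
    and "is_partition lam n"
    and "m = sum_list (star lam)" and "m \<le> k"
    and "is_partition \<kappa> (sum_list \<kappa>)" and "sum_list \<kappa> \<le> k"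
  shows "pchar n k lam (etensor (sum_list \<kappa>) (k - sum_list \<kappa>)
            (basis_el (gamma_kappa \<kappa>)) (e_pow n (k - sum_list \<kappa>)))
       = (\<Sum>\<mu>\<in>{\<mu>. is_partition \<mu> m}. \<Sum>\<nu>\<in>divisors_of \<kappa>.
            (\<Prod>i\<in>{1..k}. \<Sum>t\<in>{0..mult i \<nu>}.
               of_nat (Stirling (mult i \<nu>) t * (t choose mult i \<mu>) * i ^ (mult i \<nu> - t)))
            * sym_char (star lam) m (gamma_perm_list \<mu>))"
proof -
  let ?r = "sum_list \<kappa>" and ?\<sigma> = "gamma_perm_list \<kappa>"
  let ?I = "inv_parts ?\<sigma> {1..?r}"
  let ?ind = "\<lambda>D \<mu>. \<Prod>i\<in>{1..k}. of_bool (period_count (image ?\<sigma>) D i = i * mult i \<mu>) :: complex"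
  have \<sigma>: "?\<sigma> permutes {1..?r}" by (rule gamma_perm_list_permutes)
  have fo: "fin_ord ?\<sigma>" by (rule fin_ord_permutes[OF \<sigma>]) simp
  have foI: "fin_ord (image ?\<sigma>)" by (rule fin_ord_image[OF fo])
  have finI: "finite ?I" by (rule finite_inv_parts) simp
  have pos: "0 \<notin> set \<kappa>" using assms(5) by (simp add: is_partition_def)
  have cyc: "cycle_list ?\<sigma> {1..?r} \<kappa>" by (rule cycle_list_gamma[OF pos])
  have sub: "set \<kappa> \<subseteq> {1..k}"
  proof
    fix x assume x: "x \<in> set \<kappa>"
    then have "x \<noteq> 0" "x \<le> ?r" using pos member_le_sum_list[of x \<kappa>] by (metis, simp)
    then show "x \<in> {1..k}" using assms(6) by simp
  qed
  have expand: "sym_char (star lam) m (sigma_dw m (pdiag ?r k ?\<sigma>) (symd (ext_parts ?r k P) D))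
      = (\<Sum>\<mu> | is_partition \<mu> m. ?ind D \<mu> * sym_char (star lam) m (gamma_perm_list \<mu>))"
    if PD: "(P, D) \<in> ?I" and cD: "card D = m" for P D
  proof -
    let ?s = "sigma_dw m (pdiag ?r k ?\<sigma>) (symd (ext_parts ?r k P) D)"
    obtain b where b: "bij_betw b {1..m} D" "?s permutes {1..m}" "\<forall>j\<in>{1..m}. b (?s j) = ?\<sigma> ` b j"
      using sigma_dw_inv_parts[OF \<sigma> assms(6) PD cD] by blast
    show ?thesis by (rule sym_char_expand[OF b(2) foI b(1) _ assms(4)]) (use b(3) in blast)
  qed
  \<comment> \<open>Pairs with the wrong number of distinguished blocks have indicator 0, so they
    may be added to the sum, which can then be evaluated over all invariant pairs. The required
    bound \<open>card D \<le> k\<close> holds because disjoint nonempty blocks are at most as many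
    as the points.\<close>
  have zero: "?ind D \<mu> = 0" if PD: "(P, D) \<in> ?I" and cD: "card D \<noteq> m" and \<mu>: "is_partition \<mu> m" for P D \<mu>
  proof -
    note p = inv_partsD[OF PD]
    have finP: "finite P" by (rule finite_elements[OF _ p(1)]) simp
    have "card D \<le> card P" using finP p(2) by (rule card_mono)
    also have "card P \<le> ?r"
    proof -
      have B: "finite B \<and> B \<noteq> {}" if "B \<in> P" for B
      proof -
        have "B \<subseteq> {1..?r}" using that partition_onD1[OF p(1)] by blast
        moreover have "B \<noteq> {}" using that partition_onD3[OF p(1)] by metis
        ultimately show ?thesis using finite_subset by blast
      qed
      have "card P = (\<Sum>B\<in>P. 1)" by simp
      also have "\<dots> \<le> (\<Sum>B\<in>P. card B)" using B by (intro sum_mono) (simp add: Suc_le_eq card_gt_0_iff)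
      also have "\<dots> = card {1..?r}" by (rule product_partition[OF p(1), symmetric]) (use B in simp)
      finally show ?thesis by simp
    qed
    finally have le: "card D \<le> k" using assms(6) by simp
    have "\<not> (\<forall>i\<in>{1..k}. period_count (image ?\<sigma>) D i = i * mult i \<mu>)"
    proof
      assume "\<forall>i\<in>{1..k}. period_count (image ?\<sigma>) D i = i * mult i \<mu>"
      then have "card D = m"
        by (intro card_eq_sum_mult[OF foI finite_subset[OF p(2) finP] _ le \<mu> assms(4)]) (use p(4) in auto)
      then show False using cD by simp
    qed
    then obtain i where "i \<in> {1..k}" "period_count (image ?\<sigma>) D i \<noteq> i * mult i \<mu>" by blast
    then show ?thesis by (auto intro!: prod_zero)
  qed
  \<comment> \<open>If \<open>n = 0\<close>, then \<open>2 * k \<le> n\<close> gives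
    \<open>k = 0\<close>, and both powers have exponent 0.\<close>
  have cancel: "(1 / of_nat n) ^ (k - ?r) * of_nat n ^ (k - ?r) = (1 :: complex)"
  proof (cases "n = 0")
    case True
    then have "k = 0" using assms(1) by simp
    then show ?thesis by simp
  qed (simp add: power_mult_distrib[symmetric])
  have "pchar n k lam (etensor ?r (k - ?r) (basis_el (gamma_kappa \<kappa>)) (e_pow n (k - ?r)))
      = (1 / of_nat n) ^ (k - ?r) * (\<Sum>(P, D) | (P, D) \<in> ?I \<and> card D = m. of_nat n ^ (k - ?r) *
          sym_char (star lam) m (sigma_dw m (pdiag ?r k ?\<sigma>) (symd (ext_parts ?r k P) D)))"
    unfolding pchar_eq[OF assms(6)] pchar_diag_pdiag[OF \<sigma> assms(6,3)] ..
  also have "\<dots> = (\<Sum>(P, D) | (P, D) \<in> ?I \<and> card D = m.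
          sym_char (star lam) m (sigma_dw m (pdiag ?r k ?\<sigma>) (symd (ext_parts ?r k P) D)))"
    unfolding sum_distrib_left
    by (intro sum.cong refl) (auto simp: mult.assoc[symmetric] cancel)
  also have "\<dots> = (\<Sum>(P, D) | (P, D) \<in> ?I \<and> card D = m.
      \<Sum>\<mu> | is_partition \<mu> m. ?ind D \<mu> * sym_char (star lam) m (gamma_perm_list \<mu>))"
    by (intro sum.cong refl, simp only: split_paired_all mem_Collect_eq split_conv, erule conjE, rule expand)
  also have "\<dots> = (\<Sum>(P, D)\<in>?I.
      \<Sum>\<mu> | is_partition \<mu> m. ?ind D \<mu> * sym_char (star lam) m (gamma_perm_list \<mu>))"
  proof (rule sum.mono_neutral_left[OF finI])
    show "\<forall>x\<in>?I - {(P, D). (P, D) \<in> ?I \<and> card D = m}. (case x of (P, D) \<Rightarrow>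
        \<Sum>\<mu> | is_partition \<mu> m. ?ind D \<mu> * sym_char (star lam) m (gamma_perm_list \<mu>)) = 0"
    proof
      fix x assume x: "x \<in> ?I - {(P, D). (P, D) \<in> ?I \<and> card D = m}"
      obtain P D where PD: "x = (P, D)" by (cases x)
      have z: "?ind D \<mu> = 0" if "is_partition \<mu> m" for \<mu>
        by (rule zero[of P D]) (use x that in \<open>auto simp: PD\<close>)
      show "(case x of (P, D) \<Rightarrow>
          \<Sum>\<mu> | is_partition \<mu> m. ?ind D \<mu> * sym_char (star lam) m (gamma_perm_list \<mu>)) = 0"
        unfolding PD split_conv by (rule sum.neutral, rule ballI, subst z) simp_all
    qed
  qed auto
  \<comment> \<open>Exchanging the sums isolates, for each \<mu>, a sum over invariant pairs of a
    product over \<open>i\<close>, which is the form that \<open>sum_inv_parts_indicator\<close>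
    evaluates.\<close>
  also have "\<dots> = (\<Sum>\<mu> | is_partition \<mu> m. (\<Sum>(P, D)\<in>?I. ?ind D \<mu>) * sym_char (star lam) m (gamma_perm_list \<mu>))"
    unfolding case_prod_unfold by (subst sum.swap) (simp add: sum_distrib_right)
  also have "\<dots> = (\<Sum>\<mu> | is_partition \<mu> m. (\<Sum>\<nu>\<in>divisors_of \<kappa>.
            \<Prod>i\<in>{1..k}. \<Sum>t\<in>{0..mult i \<nu>}.
               of_nat (Stirling (mult i \<nu>) t * (t choose mult i \<mu>) * i ^ (mult i \<nu> - t)))
            * sym_char (star lam) m (gamma_perm_list \<mu>))"
    by (intro sum.cong refl) (subst sum_inv_parts_indicator[OF fo cyc sub], rule refl)
  finally show ?thesis by (simp only: sum_distrib_right)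
qed

end
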